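(* Let $(M,g)$ be a Riemannian manifold of dimension $n>1$ with positive constant sectional curvature $c$, let $A>0$ be a real constant, and let $\lambda:(0,\infty)\to\mathbf{R}$ be a smooth function satisfying $$\lambda(t)>0,\qquad 2c-A^2t\lambda(t)^2>0,\qquad \lambda(t)+2t\lambda'(t)>0\qquad\text{for all } t>0 .$$ On the nonzero cotangent bundle $T^*_0M$ let $J$ be the natural complex structure of diagonal type given in the adapted local frames by $$J\frac{\delta}{\delta q^i}=J^{(1)}_{ij}\frac{\partial}{\partial p_j},\qquad J\frac{\partial}{\partial p_i}=-J_{(2)}^{ij}\frac{\delta}{\delta q^j},$$ $$J^{(1)}_{ij}=At\lambda\, g_{ij}+\frac{c-A^2t\lambda(\lambda+t\lambda')}{At(\lambda+2t\lambda')}\,p_ip_j,\qquad J_{(2)}^{ij}=\frac{1}{At\lambda}\,g^{ij}-\frac{c-A^2t\lambda(\lambda+t\lambda')}{At^2\lambda(2c-A^2t\lambda^2)}\,g^{0i}g^{0j},$$ and let $G$ be the natural Riemannian metric of diagonal type $G=G^{(1)}_{ij}dq^idq^j+G_{(2)}^{ij}Dp_iDp_j$ with $$G^{(1)}_{ij}=At\lambda^2 g_{ij}+\frac{c-A^2t\lambda^2}{At}\,p_ip_j,\qquad G_{(2)}^{ij}=\frac{1}{At}\,g^{ij}-\frac{c-A^2t[\lambda^2+2t\lambda'(\lambda+t\lambda')]}{At^2(2c-A^2t\lambda^2)}\,g^{0i}g^{0j}.$$ Then $(G,J)$ is a locally symmetric K\"ahler Einstein structure on $T^*_0M$.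
   Context: Everything is smooth; repeated indices are summed over $1,\dots,n$. $(M,g)$ is a smooth $n$-dimensional Riemannian manifold, $\pi:T^*M\to M$ its cotangent bundle, $T^*_0M$ is $T^*M$ minus the zero section. A chart $(U,x^1,\dots,x^n)$ of $M$ induces the chart $(\pi^{-1}(U),q^1,\dots,q^n,p_1,\dots,p_n)$ of $T^*M$, where $q^i=x^i\circ\pi$ and $p=p_i\,dx^i_{\pi(p)}$. With $\Gamma^k_{ih}$ the Christoffel symbols of $g$, put $\Gamma^0_{ih}=p_k\Gamma^k_{ih}$, $\frac{\delta}{\delta q^i}=\frac{\partial}{\partial q^i}+\Gamma^0_{ih}\frac{\partial}{\partial p_h}$, $Dp_i=dp_i-\Gamma^0_{ij}dq^j$. The vector fields $\frac{\delta}{\delta q^i},\frac{\partial}{\partial p_i}$ form a local frame adapted to the splitting $TT^*M=HT^*M\oplus VT^*M$ into horizontal and vertical distributions, with dual coframe $dq^i,Dp_i$. Further, $(g^{ij})$ is the inverse of $(g_{ij})$, $g^{0i}=p_hg^{hi}$, and $t=\frac12 g^{ij}p_ip_j>0$ on $T^*_0M$ is the energy density. The functions of $t$ (such as $\lambda$, $\lambda'=d\lambda/dt$) are evaluated at the energy density. Locally symmetric means $\nabla K=0$, where $\nabla$ is the Levi-Civita connection of $G$ and $K$ its curvature tensor field; Einstein means that the Ricci tensor of $G$ is a constant multiple of $G$. *)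

theory Defs
  imports "HOL-Analysis.Analysis"
begin

section \<open>Smooth functions on open subsets of a normed space\<close>

abbreviation dird ::
    "('a::real_normed_vector \<Rightarrow> 'b::real_normed_vector) \<Rightarrow> 'a \<Rightarrow> 'a \<Rightarrow> 'b" where
  "dird f y u \<equiv> frechet_derivative f (at y) u"

primrec Ck_on ::
    "nat \<Rightarrow> 'a::real_normed_vector set \<Rightarrow> ('a \<Rightarrow> 'b::real_normed_vector) \<Rightarrow> bool" where
  "Ck_on 0 S f = continuous_on S f"
| "Ck_on (Suc k) S f =
     ((\<forall>y\<in>S. f differentiable (at y)) \<and> (\<forall>u. Ck_on k S (\<lambda>y. dird f y u)))"

definition smooth_on ::
    "'a::real_normed_vector set \<Rightarrow> ('a \<Rightarrow> 'b::real_normed_vector) \<Rightarrow> bool" where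
  "smooth_on S f \<longleftrightarrow> (\<forall>k. Ck_on k S f)"


section \<open>Smooth manifolds\<close>

text \<open>An atlas is an indexed family of charts \<open>chart_map M i\<close> on \<open>chart_dom M i\<close>,
  \<open>i \<in> chart_ix M\<close>; the underlying set of the manifold is the union of the chart domains.
  A maximal atlas is the special case in which the charts index themselves.\<close>

record ('i, 'a, 'e) atlas =
  chart_ix :: "'i set"
  chart_dom :: "'i \<Rightarrow> 'a set"
  chart_map :: "'i \<Rightarrow> 'a \<Rightarrow> 'e"

definition points :: "('i, 'a, 'e) atlas \<Rightarrow> 'a set" where
  "points M = (\<Union>i\<in>chart_ix M. chart_dom M i)"

definition chart_range :: "('i, 'a, 'e) atlas \<Rightarrow> 'i \<Rightarrow> 'e set" where
  "chart_range M i = chart_map M i ` chart_dom M i"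

definition transition :: "('i, 'a, 'e) atlas \<Rightarrow> 'i \<Rightarrow> 'i \<Rightarrow> 'e \<Rightarrow> 'e" where
  "transition M i j = chart_map M j \<circ> inv_into (chart_dom M i) (chart_map M i)"

text \<open>The Jacobian at the point \<open>x\<close> of the change from the chart \<open>i\<close> to the chart \<open>j\<close>.\<close>

definition jacobian ::
    "('i, 'a, 'e::euclidean_space) atlas \<Rightarrow> 'i \<Rightarrow> 'i \<Rightarrow> 'a \<Rightarrow> 'e \<Rightarrow> 'e" where
  "jacobian M i j x = frechet_derivative (transition M i j) (at (chart_map M i x))"

definition manifold_topology :: "('i, 'a, 'e::euclidean_space) atlas \<Rightarrow> 'a topology" where
  "manifold_topology M = topology (\<lambda>W. W \<subseteq> points M \<and>
     (\<forall>i\<in>chart_ix M. open (chart_map M i ` (W \<inter> chart_dom M i))))"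

definition smooth_manifold :: "('i, 'a, 'e::euclidean_space) atlas \<Rightarrow> bool" where
  "smooth_manifold M \<longleftrightarrow>
     (\<forall>i\<in>chart_ix M. inj_on (chart_map M i) (chart_dom M i)) \<and>
     (\<forall>i\<in>chart_ix M. \<forall>j\<in>chart_ix M.
        open (chart_map M i ` (chart_dom M i \<inter> chart_dom M j)) \<and>
        smooth_on (chart_map M i ` (chart_dom M i \<inter> chart_dom M j)) (transition M i j)) \<and>
     Hausdorff_space (manifold_topology M) \<and>
     second_countable (manifold_topology M)"


section \<open>Tensor fields\<close>

text \<open>A tensor field is the family of its representatives in the charts, subject to the
  transformation law under changes of coordinates.  The representative in the chart \<open>i\<close> at the
  coordinate point \<open>y \<in> chart_range M i\<close> acts on the components of tangent vectors.\<close>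

type_synonym ('i, 'e) form2 = "'i \<Rightarrow> 'e \<Rightarrow> 'e \<Rightarrow> 'e \<Rightarrow> real"
type_synonym ('i, 'e) endo = "'i \<Rightarrow> 'e \<Rightarrow> 'e \<Rightarrow> 'e"

definition riemannian_metric ::
    "('i, 'a, 'e::euclidean_space) atlas \<Rightarrow> ('i, 'e) form2 \<Rightarrow> bool" where
  "riemannian_metric M g \<longleftrightarrow>
     (\<forall>i\<in>chart_ix M. \<forall>y\<in>chart_range M i.
        bilinear (g i y) \<and> (\<forall>u v. g i y u v = g i y v u) \<and> (\<forall>u. u \<noteq> 0 \<longrightarrow> g i y u u > 0)) \<and>
     (\<forall>i\<in>chart_ix M. \<forall>u v. smooth_on (chart_range M i) (\<lambda>y. g i y u v)) \<and>
     (\<forall>i\<in>chart_ix M. \<forall>j\<in>chart_ix M. \<forall>x\<in>chart_dom M i \<inter> chart_dom M j. \<forall>u v.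
        g i (chart_map M i x) u v =
        g j (chart_map M j x) (jacobian M i j x u) (jacobian M i j x v))"

definition endo_field ::
    "('i, 'a, 'e::euclidean_space) atlas \<Rightarrow> ('i, 'e) endo \<Rightarrow> bool" where
  "endo_field M J \<longleftrightarrow>
     (\<forall>i\<in>chart_ix M. \<forall>y\<in>chart_range M i. linear (J i y)) \<and>
     (\<forall>i\<in>chart_ix M. \<forall>u. smooth_on (chart_range M i) (\<lambda>y. J i y u)) \<and>
     (\<forall>i\<in>chart_ix M. \<forall>j\<in>chart_ix M. \<forall>x\<in>chart_dom M i \<inter> chart_dom M j. \<forall>u.
        jacobian M i j x (J i (chart_map M i x) u) =
        J j (chart_map M j x) (jacobian M i j x u))"


section \<open>Levi-Civita connection and curvature in a chart\<close>

text \<open>Here \<open>g\<close> is the representative of a metric in one chart, and vector fields are maps from the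
  chart range to the model space.  The Christoffel map \<open>\<Gamma>(u, v) = \<Gamma>\<^sup>k\<^sub>i\<^sub>j u\<^sup>i v\<^sup>j \<partial>\<^sub>k\<close> is given by
  the Koszul formula for the constant fields \<open>u\<close>, \<open>v\<close>, \<open>w\<close>.\<close>

definition christoffel ::
    "('e \<Rightarrow> 'e \<Rightarrow> 'e \<Rightarrow> real) \<Rightarrow> 'e::euclidean_space \<Rightarrow> 'e \<Rightarrow> 'e \<Rightarrow> 'e" where
  "christoffel g y u v = (THE z. \<forall>w. g y z w =
     (dird (\<lambda>x. g x v w) y u + dird (\<lambda>x. g x u w) y v - dird (\<lambda>x. g x u v) y w) / 2)"

definition cov_deriv ::
    "('e \<Rightarrow> 'e \<Rightarrow> 'e \<Rightarrow> real) \<Rightarrow> ('e \<Rightarrow> 'e) \<Rightarrow> ('e \<Rightarrow> 'e) \<Rightarrow> 'e::euclidean_space \<Rightarrow> 'e" where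
  "cov_deriv g X Y y = dird Y y (X y) + christoffel g y (X y) (Y y)"

definition lie_bracket ::
    "('e \<Rightarrow> 'e) \<Rightarrow> ('e \<Rightarrow> 'e) \<Rightarrow> 'e::euclidean_space \<Rightarrow> 'e" where
  "lie_bracket X Y y = dird Y y (X y) - dird X y (Y y)"

text \<open>\<open>K(u, v)w\<close>, computed on the constant (that is, coordinate) fields \<open>u\<close>, \<open>v\<close>, \<open>w\<close>, for which
  the term \<open>\<nabla>\<^bsub>[u,v]\<^esub>w\<close> vanishes.\<close>

definition curvature ::
    "('e \<Rightarrow> 'e \<Rightarrow> 'e \<Rightarrow> real) \<Rightarrow> 'e::euclidean_space \<Rightarrow> 'e \<Rightarrow> 'e \<Rightarrow> 'e \<Rightarrow> 'e" where
  "curvature g y u v w =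
     cov_deriv g (\<lambda>_. u) (cov_deriv g (\<lambda>_. v) (\<lambda>_. w)) y
   - cov_deriv g (\<lambda>_. v) (cov_deriv g (\<lambda>_. u) (\<lambda>_. w)) y"

text \<open>\<open>(\<nabla>\<^sub>z K)(u, v)w\<close>.\<close>

definition nabla_curvature ::
    "('e \<Rightarrow> 'e \<Rightarrow> 'e \<Rightarrow> real) \<Rightarrow> 'e::euclidean_space \<Rightarrow> 'e \<Rightarrow> 'e \<Rightarrow> 'e \<Rightarrow> 'e \<Rightarrow> 'e" where
  "nabla_curvature g y z u v w =
     cov_deriv g (\<lambda>_. z) (\<lambda>x. curvature g x u v w) y
   - curvature g y (christoffel g y z u) v w
   - curvature g y u (christoffel g y z v) w
   - curvature g y u v (christoffel g y z w)"

text \<open>The trace of \<open>u \<mapsto> K(u, v)w\<close>.\<close>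

definition ricci ::
    "('e \<Rightarrow> 'e \<Rightarrow> 'e \<Rightarrow> real) \<Rightarrow> 'e::euclidean_space \<Rightarrow> 'e \<Rightarrow> 'e \<Rightarrow> real" where
  "ricci g y v w = (\<Sum>b\<in>Basis. curvature g y b v w \<bullet> b)"

definition sectional_curvature ::
    "('e \<Rightarrow> 'e \<Rightarrow> 'e \<Rightarrow> real) \<Rightarrow> 'e::euclidean_space \<Rightarrow> 'e \<Rightarrow> 'e \<Rightarrow> real" where
  "sectional_curvature g y u v =
     g y (curvature g y u v v) u / (g y u u * g y v v - (g y u v)\<^sup>2)"

definition constant_sectional_curvature ::
    "('i, 'a, 'e::euclidean_space) atlas \<Rightarrow> ('i, 'e) form2 \<Rightarrow> real \<Rightarrow> bool" where
  "constant_sectional_curvature M g c \<longleftrightarrow>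
     (\<forall>i\<in>chart_ix M. \<forall>y\<in>chart_range M i. \<forall>u v.
        u \<noteq> v \<and> independent {u, v} \<longrightarrow> sectional_curvature (g i) y u v = c)"

definition locally_symmetric ::
    "('i, 'a, 'e::euclidean_space) atlas \<Rightarrow> ('i, 'e) form2 \<Rightarrow> bool" where
  "locally_symmetric M g \<longleftrightarrow>
     (\<forall>i\<in>chart_ix M. \<forall>y\<in>chart_range M i. \<forall>z u v w. nabla_curvature (g i) y z u v w = 0)"

definition einstein ::
    "('i, 'a, 'e::euclidean_space) atlas \<Rightarrow> ('i, 'e) form2 \<Rightarrow> bool" where
  "einstein M g \<longleftrightarrow>
     (\<exists>k::real. \<forall>i\<in>chart_ix M. \<forall>y\<in>chart_range M i. \<forall>v w. ricci (g i) y v w = k * g i y v w)"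


section \<open>Kaehler structures\<close>

text \<open>Components of the Nijenhuis tensor and of the exterior derivative of a 2-form, that is,
  their values on constant fields.\<close>

definition nijenhuis ::
    "('e \<Rightarrow> 'e \<Rightarrow> 'e) \<Rightarrow> 'e::euclidean_space \<Rightarrow> 'e \<Rightarrow> 'e \<Rightarrow> 'e" where
  "nijenhuis J y u v =
     lie_bracket (\<lambda>x. J x u) (\<lambda>x. J x v) y
   - J y (lie_bracket (\<lambda>x. J x u) (\<lambda>_. v) y)
   - J y (lie_bracket (\<lambda>_. u) (\<lambda>x. J x v) y)
   - lie_bracket (\<lambda>_. u) (\<lambda>_. v) y"

definition ext_deriv ::
    "('e \<Rightarrow> 'e \<Rightarrow> 'e \<Rightarrow> real) \<Rightarrow> 'e::euclidean_space \<Rightarrow> 'e \<Rightarrow> 'e \<Rightarrow> 'e \<Rightarrow> real" where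
  "ext_deriv \<omega> y u v w =
     dird (\<lambda>x. \<omega> x v w) y u + dird (\<lambda>x. \<omega> x w u) y v + dird (\<lambda>x. \<omega> x u v) y w"

definition complex_structure ::
    "('i, 'a, 'e::euclidean_space) atlas \<Rightarrow> ('i, 'e) endo \<Rightarrow> bool" where
  "complex_structure M J \<longleftrightarrow> endo_field M J \<and>
     (\<forall>i\<in>chart_ix M. \<forall>y\<in>chart_range M i. \<forall>u v.
        J i y (J i y u) = - u \<and> nijenhuis (J i) y u v = 0)"

definition kaehler_structure ::
    "('i, 'a, 'e::euclidean_space) atlas \<Rightarrow> ('i, 'e) form2 \<Rightarrow> ('i, 'e) endo \<Rightarrow> bool" where
  "kaehler_structure M G J \<longleftrightarrow> riemannian_metric M G \<and> complex_structure M J \<and>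
     (\<forall>i\<in>chart_ix M. \<forall>y\<in>chart_range M i. \<forall>u v w.
        G i y (J i y u) (J i y v) = G i y u v \<and>
        ext_deriv (\<lambda>x a b. G i x a (J i x b)) y u v w = 0)"


section \<open>The nonzero cotangent bundle\<close>

text \<open>A covector at \<open>x\<close> is the family of its component vectors \<open>(p\<^sub>1, \<dots>, p\<^sub>n)\<close> in the charts
  around \<open>x\<close>, so that \<open>p i \<bullet> u\<close> is its value on the tangent vector with components \<open>u\<close> in the
  chart \<open>i\<close>; the entries at all other indices are set to 0.\<close>

definition cotangent_space ::
    "('i, 'a, 'e::euclidean_space) atlas \<Rightarrow> 'a \<Rightarrow> ('i \<Rightarrow> 'e) set" where
  "cotangent_space M x = {p.
     (\<forall>i\<in>chart_ix M. \<forall>j\<in>chart_ix M. x \<in> chart_dom M i \<inter> chart_dom M j \<longrightarrow>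
        (\<forall>u. p i \<bullet> u = p j \<bullet> jacobian M i j x u)) \<and>
     (\<forall>i. i \<notin> chart_ix M \<or> x \<notin> chart_dom M i \<longrightarrow> p i = 0)}"

definition cotangent0 ::
    "('i, 'a, 'e::euclidean_space) atlas \<Rightarrow> ('i, 'a \<times> ('i \<Rightarrow> 'e), 'e \<times> 'e) atlas" where
  "cotangent0 M =
     \<lparr> chart_ix = chart_ix M,
       chart_dom = (\<lambda>i. {(x, p). x \<in> chart_dom M i \<and> p \<in> cotangent_space M x \<and> p \<noteq> (\<lambda>_. 0)}),
       chart_map = (\<lambda>i (x, p). (chart_map M i x, p i)) \<rparr>"

text \<open>In the following, \<open>g\<close> is the representative of the metric of \<open>M\<close> in one chart, and
  \<open>(q, p)\<close> are the induced coordinates on the cotangent bundle.\<close>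

type_synonym 'n vec_metric = "real^'n \<Rightarrow> real^'n \<Rightarrow> real^'n \<Rightarrow> real"

definition g_lo :: "'n vec_metric \<Rightarrow> real^'n \<Rightarrow> real^'n^'n::finite" where
  "g_lo g q = (\<chi> i j. g q (axis i 1) (axis j 1))"

definition g_up :: "'n vec_metric \<Rightarrow> real^'n \<Rightarrow> real^'n^'n::finite" where
  "g_up g q = matrix_inv (g_lo g q)"

text \<open>\<open>\<Gamma>\<^sup>0\<^sub>i\<^sub>h = p\<^sub>k \<Gamma>\<^sup>k\<^sub>i\<^sub>h\<close>\<close>

definition Gamma0 :: "'n vec_metric \<Rightarrow> real^'n \<Rightarrow> real^'n \<Rightarrow> 'n::finite \<Rightarrow> 'n \<Rightarrow> real" where
  "Gamma0 g q p i h = (\<Sum>k\<in>UNIV. p $ k * christoffel g q (axis i 1) (axis h 1) $ k)"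

text \<open>\<open>g\<^sup>0\<^sup>i = p\<^sub>h g\<^sup>h\<^sup>i\<close>\<close>

definition g0_up :: "'n vec_metric \<Rightarrow> real^'n \<Rightarrow> real^'n \<Rightarrow> 'n::finite \<Rightarrow> real" where
  "g0_up g q p i = (\<Sum>h\<in>UNIV. p $ h * g_up g q $ h $ i)"

definition energy :: "'n vec_metric \<Rightarrow> real^'n \<Rightarrow> real^'n::finite \<Rightarrow> real" where
  "energy g q p = (1/2) * (\<Sum>i\<in>UNIV. \<Sum>j\<in>UNIV. g_up g q $ i $ j * p $ i * p $ j)"

text \<open>The adapted frame \<open>\<delta>/\<delta>q\<^sup>i\<close>, \<open>\<partial>/\<partial>p\<^sub>i\<close> and its dual coframe \<open>dq\<^sup>i\<close>, \<open>Dp\<^sub>i\<close>, in components.\<close>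

definition delta_q ::
    "'n vec_metric \<Rightarrow> real^'n \<Rightarrow> real^'n \<Rightarrow> 'n::finite \<Rightarrow> (real^'n) \<times> (real^'n)" where
  "delta_q g q p i = (axis i 1, \<Sum>h\<in>UNIV. Gamma0 g q p i h *\<^sub>R axis h 1)"

definition partial_p :: "'n::finite \<Rightarrow> (real^'n) \<times> (real^'n)" where
  "partial_p i = (0, axis i 1)"

definition dq :: "'n::finite \<Rightarrow> (real^'n) \<times> (real^'n) \<Rightarrow> real" where
  "dq i v = fst v $ i"

definition Dp ::
    "'n vec_metric \<Rightarrow> real^'n \<Rightarrow> real^'n \<Rightarrow> 'n::finite \<Rightarrow> (real^'n) \<times> (real^'n) \<Rightarrow> real" where
  "Dp g q p i v = snd v $ i - (\<Sum>j\<in>UNIV. Gamma0 g q p i j * fst v $ j)"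


section \<open>The structure \<open>(G, J)\<close>\<close>

definition J1 ::
    "real \<Rightarrow> real \<Rightarrow> (real \<Rightarrow> real) \<Rightarrow> 'n vec_metric \<Rightarrow> real^'n \<Rightarrow> real^'n
       \<Rightarrow> 'n::finite \<Rightarrow> 'n \<Rightarrow> real" where
  "J1 A c lam g q p i j =
     (let t = energy g q p; l = lam t; l' = deriv lam t in
        A * t * l * g_lo g q $ i $ j
      + (c - A\<^sup>2 * t * l * (l + t * l')) / (A * t * (l + 2 * t * l')) * p $ i * p $ j)"

definition J2 ::
    "real \<Rightarrow> real \<Rightarrow> (real \<Rightarrow> real) \<Rightarrow> 'n vec_metric \<Rightarrow> real^'n \<Rightarrow> real^'n
       \<Rightarrow> 'n::finite \<Rightarrow> 'n \<Rightarrow> real" where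
  "J2 A c lam g q p i j =
     (let t = energy g q p; l = lam t; l' = deriv lam t in
        1 / (A * t * l) * g_up g q $ i $ j
      - (c - A\<^sup>2 * t * l * (l + t * l')) / (A * t\<^sup>2 * l * (2 * c - A\<^sup>2 * t * l\<^sup>2))
          * g0_up g q p i * g0_up g q p j)"

definition G1 ::
    "real \<Rightarrow> real \<Rightarrow> (real \<Rightarrow> real) \<Rightarrow> 'n vec_metric \<Rightarrow> real^'n \<Rightarrow> real^'n
       \<Rightarrow> 'n::finite \<Rightarrow> 'n \<Rightarrow> real" where
  "G1 A c lam g q p i j =
     (let t = energy g q p; l = lam t in
        A * t * l\<^sup>2 * g_lo g q $ i $ j
      + (c - A\<^sup>2 * t * l\<^sup>2) / (A * t) * p $ i * p $ j)"

definition G2 ::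
    "real \<Rightarrow> real \<Rightarrow> (real \<Rightarrow> real) \<Rightarrow> 'n vec_metric \<Rightarrow> real^'n \<Rightarrow> real^'n
       \<Rightarrow> 'n::finite \<Rightarrow> 'n \<Rightarrow> real" where
  "G2 A c lam g q p i j =
     (let t = energy g q p; l = lam t; l' = deriv lam t in
        1 / (A * t) * g_up g q $ i $ j
      - (c - A\<^sup>2 * t * (l\<^sup>2 + 2 * t * l' * (l + t * l'))) / (A * t\<^sup>2 * (2 * c - A\<^sup>2 * t * l\<^sup>2))
          * g0_up g q p i * g0_up g q p j)"

text \<open>\<open>J\<close> is the linear map with \<open>J \<delta>/\<delta>q\<^sup>i = J\<^sup>(\<^sup>1\<^sup>)\<^sub>i\<^sub>j \<partial>/\<partial>p\<^sub>j\<close> and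
  \<open>J \<partial>/\<partial>p\<^sub>i = - J\<^sub>(\<^sub>2\<^sub>)\<^sup>i\<^sup>j \<delta>/\<delta>q\<^sup>j\<close>, written out on
  \<open>v = dq\<^sup>i(v) \<delta>/\<delta>q\<^sup>i + Dp\<^sub>i(v) \<partial>/\<partial>p\<^sub>i\<close>.\<close>

definition J_diag ::
    "real \<Rightarrow> real \<Rightarrow> (real \<Rightarrow> real) \<Rightarrow> ('i, real^'n::finite) form2
       \<Rightarrow> ('i, (real^'n) \<times> (real^'n)) endo" where
  "J_diag A c lam g \<alpha> = (\<lambda>(q, p) v.
     (\<Sum>i\<in>UNIV. dq i v *\<^sub>R (\<Sum>j\<in>UNIV. J1 A c lam (g \<alpha>) q p i j *\<^sub>R partial_p j))
   + (\<Sum>i\<in>UNIV. Dp (g \<alpha>) q p i v *\<^sub>R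
        (- (\<Sum>j\<in>UNIV. J2 A c lam (g \<alpha>) q p i j *\<^sub>R delta_q (g \<alpha>) q p j))))"

definition G_diag ::
    "real \<Rightarrow> real \<Rightarrow> (real \<Rightarrow> real) \<Rightarrow> ('i, real^'n::finite) form2
       \<Rightarrow> ('i, (real^'n) \<times> (real^'n)) form2" where
  "G_diag A c lam g \<alpha> = (\<lambda>(q, p) v w.
     (\<Sum>i\<in>UNIV. \<Sum>j\<in>UNIV. G1 A c lam (g \<alpha>) q p i j * dq i v * dq j w)
   + (\<Sum>i\<in>UNIV. \<Sum>j\<in>UNIV. G2 A c lam (g \<alpha>) q p i j * Dp (g \<alpha>) q p i v * Dp (g \<alpha>) q p j w))"

end

theory Submission
  imports Defs
begin

text \<open>The structure \<open>(G, J)\<close> is a piece of the complex quadric, the Grassmannian of oriented planes in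
  \<open>\<real>\<^sup>n\<^sup>+\<^sup>2\<close> with its Hermitian symmetric structure, which is Einstein.  If \<open>M\<close> is the sphere of curvature
  \<open>c\<close> in \<open>\<real>\<^sup>n\<^sup>+\<^sup>1\<close>, let \<open>e\<^sub>0\<close> be the unit position vector of the base point, \<open>e\<close> the direction of the covector \<open>p\<close>, and
  \<open>e\<^sub>\<infinity>\<close> a unit vector in the additional direction of \<open>\<real>\<^sup>n\<^sup>+\<^sup>2\<close>; then \<open>p\<close> is sent to the plane
  spanned by \<open>e\<close> and \<open>cos \<theta> e\<^sub>\<infinity> + sin \<theta> e\<^sub>0\<close>, where \<open>sin \<theta> = A \<surd>(2t) \<lambda> / (2 \<surd>c)\<close>.  The function \<open>\<lambda>\<close>
  enters only through \<open>\<theta>\<close>, that is, as a radial reparametrisation of the fibres, and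
  \<open>2/A\<close> is the factor between the metric of the quadric and \<open>G\<close>.

  A map into the quadric is not needed, because the tangent space of the Grassmannian at a plane is the sum of
  two copies of the normal space of the plane, and the pull-backs of these bundles and their connections
  can be written down on the cotangent bundle of any space of curvature \<open>c\<close>.  Let \<open>P\<close> be
  the vector dual to the covector, a section of the pulled-back tangent bundle, \<open>\<nabla>\<close> the pulled-back
  Levi-Civita connection, \<open>e = P / \<bar>P\<bar>\<close>, \<open>\<epsilon> = \<nabla>e\<close> and \<open>\<ll> = \<surd>c d\<pi>\<close>.  The differential of the map above
  becomes the bundle isomorphism \<open>(\<alpha>, \<beta>)\<close> with
  \<open>\<alpha> = \<epsilon> - cos \<theta> \<langle>\<ll>, e\<rangle> e\<close> and \<open>\<beta> = sin \<theta> (\<ll> - \<langle>\<ll>, e\<rangle> e) + d\<theta> e\<close>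
  from the tangent bundle of the cotangent bundle to two copies of the pulled-back tangent
  bundle.  There is an explicit metric connection on the target for which \<open>(\<alpha>, \<beta>)\<close> has
  no torsion (\<open>torsion_\<alpha>\<close>, \<open>torsion_\<beta>\<close>); constant curvature is used here and in the
  computation of its curvature, in the form \<open>\<nabla>\<^sub>u\<nabla>\<^sub>v - \<nabla>\<^sub>v\<nabla>\<^sub>u = \<ll>\<^sub>u \<and> \<ll>\<^sub>v\<close>.  By uniqueness of the Levi-Civita
  connection (\<open>christoffel_solder\<close>) this connection is that of \<open>G\<close>.  Its curvature is the
  algebraic tensor \<open>Q\<close> of the quadric (\<open>F_Rm_eq\<close>), which is parallel (\<open>Q_parallel\<close>), so the curvature
  tensor of \<open>G\<close> is parallel; the trace of \<open>Q\<close> gives the Einstein constant \<open>n A / 2\<close>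
  (\<open>Q_trace\<close>); and \<open>J\<close> corresponds to the parallel structure \<open>(a, b) \<mapsto> (b, -a)\<close>, so it is
  integrable and its fundamental form is closed.

  It remains to recognise \<open>G\<close> and \<open>J\<close>, given by their coefficients in the adapted frame, in this form
  (\<open>G_soldered\<close>, \<open>J_soldered\<close>), to obtain the full curvature tensor of \<open>M\<close> from its sectional curvature
  (\<open>constant_curvature_tensor\<close>), and to show that \<open>G\<close> and \<open>J\<close> transform as tensors.  The last
  point holds because they are built from the metric, \<open>P\<close> and the splitting of a
  tangent vector into \<open>d\<pi>\<close> and \<open>\<nabla>P\<close>, all of which are independent of the chart.\<close>

section \<open>Calculus of smooth functions\<close>

lemma dird_eqI: "(f has_derivative f') (at y) \<Longrightarrow> dird f y u = f' u"
  using frechet_derivative_at[of f f' y] by simp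

lemma has_derivative_dird:
  "f differentiable (at y) \<Longrightarrow> (f has_derivative (\<lambda>u. dird f y u)) (at y)"
  using frechet_derivative_works[of f "at y"] by simp

lemma dird_cong_open:
  assumes "open S" "y \<in> S" "f differentiable (at y)" "\<And>x. x \<in> S \<Longrightarrow> f x = g x"
  shows "dird f y u = dird g y u"
  using frechet_derivative_transform_within_open[OF assms(3,1,2), of g] assms(4) by simp

lemma differentiable_cong_open:
  assumes "open S" "y \<in> S" "f differentiable (at y)" "\<And>x. x \<in> S \<Longrightarrow> f x = g x"
  shows "g differentiable (at y)"
proof -
  obtain D where "(f has_derivative D) (at y)" using assms(3) unfolding differentiable_def by blast
  then have "(g has_derivative D) (at y)"
    by (rule has_derivative_transform_within_open[OF _ assms(1,2)]) (rule assms(4))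
  then show ?thesis unfolding differentiable_def by blast
qed

lemma Ck_on_cong:
  assumes "open S" "\<And>x. x \<in> S \<Longrightarrow> f x = g x" "Ck_on k S f"
  shows "Ck_on k S g"
  using assms(2,3)
proof (induction k arbitrary: f g)
  case 0
  then show ?case using continuous_on_cong by fastforce
next
  case (Suc k)
  have d: "f differentiable (at y)" if "y \<in> S" for y using Suc.prems that by auto
  show ?case unfolding Ck_on.simps
  proof (intro conjI ballI allI)
    fix y assume "y \<in> S"
    then show "g differentiable (at y)"
      using differentiable_cong_open[OF assms(1) _ d Suc.prems(1)] by blast
  next
    fix u
    have "dird f x u = dird g x u" if "x \<in> S" for x
      using dird_cong_open[OF assms(1) that d[OF that] Suc.prems(1)] by blast
    then show "Ck_on k S (\<lambda>y. dird g y u)"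
      using Suc.IH[of "\<lambda>y. dird f y u"] Suc.prems by auto
  qed
qed

lemma Ck_on_SucI:
  assumes "open S" "\<And>y. y \<in> S \<Longrightarrow> (f has_derivative f' y) (at y)" "\<And>u. Ck_on k S (\<lambda>y. f' y u)"
  shows "Ck_on (Suc k) S f"
  unfolding Ck_on.simps
proof (intro conjI ballI allI)
  fix y assume "y \<in> S"
  then show "f differentiable (at y)" using assms(2) unfolding differentiable_def by blast
next
  fix u
  show "Ck_on k S (\<lambda>y. dird f y u)"
    by (rule Ck_on_cong[OF assms(1) _ assms(3)[of u]]) (simp add: dird_eqI[OF assms(2)])
qed

lemma Ck_on_Suc_imp:
  assumes "Ck_on (Suc k) S f"
  shows "y \<in> S \<Longrightarrow> f differentiable (at y)" "Ck_on k S (\<lambda>y. dird f y u)"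
  using assms by simp_all

lemma Ck_on_SucD: "Ck_on (Suc k) S f \<Longrightarrow> Ck_on k S f"
proof (induction k arbitrary: f)
  case 0
  then show ?case
    by (auto intro!: continuous_at_imp_continuous_on differentiable_imp_continuous_within)
next
  case (Suc k)
  show ?case unfolding Ck_on.simps(2)[of k]
    using Ck_on_Suc_imp[OF Suc.prems] Suc.IH by blast
qed

lemma Ck_on_has_derivative:
  "Ck_on (Suc k) S f \<Longrightarrow> y \<in> S \<Longrightarrow> (f has_derivative (\<lambda>u. dird f y u)) (at y)"
  by (simp add: has_derivative_dird)

lemma Ck_on_subset: "Ck_on k T f \<Longrightarrow> S \<subseteq> T \<Longrightarrow> Ck_on k S f"
  by (induction k arbitrary: f) (auto intro: continuous_on_subset)

lemma Ck_on_const: "open S \<Longrightarrow> Ck_on k S (\<lambda>_. a)"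
  by (induction k arbitrary: a) (auto)

lemma Ck_on_bounded_linear:
  assumes "open S" "bounded_linear L" "Ck_on k S f"
  shows "Ck_on k S (\<lambda>y. L (f y))"
  using assms(3)
proof (induction k arbitrary: f)
  case 0
  then show ?case using linear_continuous_on_compose assms(2) bounded_linear.continuous_on by fastforce
next
  case (Suc k)
  show ?case
  proof (rule Ck_on_SucI[OF assms(1)])
    fix y assume "y \<in> S"
    show "((\<lambda>y. L (f y)) has_derivative (\<lambda>u. L (dird f y u))) (at y)"
      by (rule bounded_linear.has_derivative[OF assms(2) Ck_on_has_derivative[OF Suc.prems \<open>y \<in> S\<close>]])
  next
    fix u show "Ck_on k S (\<lambda>y. L (dird f y u))" using Suc by auto
  qed
qed

lemma Ck_on_add:
  assumes "open S" "Ck_on k S f" "Ck_on k S g"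
  shows "Ck_on k S (\<lambda>y. f y + g y)"
  using assms(2,3)
proof (induction k arbitrary: f g)
  case 0 then show ?case by (auto intro: continuous_intros)
next
  case (Suc k)
  show ?case
  proof (rule Ck_on_SucI[OF assms(1)])
    fix y assume "y \<in> S"
    show "((\<lambda>y. f y + g y) has_derivative (\<lambda>u. dird f y u + dird g y u)) (at y)"
      using Suc.prems[THEN Ck_on_has_derivative, OF \<open>y \<in> S\<close>] by (rule has_derivative_add)
  next
    fix u show "Ck_on k S (\<lambda>y. dird f y u + dird g y u)" using Suc by auto
  qed
qed

lemma Ck_on_sum:
  assumes "open S" "\<And>i. i \<in> I \<Longrightarrow> Ck_on k S (f i)"
  shows "Ck_on k S (\<lambda>y. \<Sum>i\<in>I. f i y)"
proof (cases "finite I")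
  case True
  then show ?thesis using assms(2)
    by (induction I rule: finite_induct) (auto intro: Ck_on_add Ck_on_const assms(1))
qed (simp add: Ck_on_const assms(1))

lemma Ck_on_bilinear:
  assumes "open S" "bounded_bilinear b" "Ck_on k S f" "Ck_on k S g"
  shows "Ck_on k S (\<lambda>y. b (f y) (g y))"
  using assms(3,4)
proof (induction k arbitrary: f g)
  case 0 then show ?case using bounded_bilinear.continuous_on[OF assms(2)] by auto
next
  case (Suc k)
  show ?case
  proof (rule Ck_on_SucI[OF assms(1)])
    fix y assume "y \<in> S"
    show "((\<lambda>y. b (f y) (g y)) has_derivative (\<lambda>u. b (f y) (dird g y u) + b (dird f y u) (g y))) (at y)"
      using Suc.prems[THEN Ck_on_has_derivative, OF \<open>y \<in> S\<close>]
      by (rule bounded_bilinear.FDERIV[OF assms(2)])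
  next
    fix u show "Ck_on k S (\<lambda>y. b (f y) (dird g y u) + b (dird f y u) (g y))"
      using Suc.IH Suc.prems Suc.prems[THEN Ck_on_SucD] by (intro Ck_on_add[OF assms(1)]) auto
  qed
qed

text \<open>A family of linear maps is a linear combination of its values on the basis with scalar
  coefficients.  This turns statements about \<open>f x (X x)\<close>, in which both the map and its argument
  vary, into the product rule.\<close>

lemma linear_family_expand:
  fixes f :: "'v \<Rightarrow> 'a::euclidean_space \<Rightarrow> 'b::real_vector"
  assumes "linear (f x)"
  shows "f x z = (\<Sum>b\<in>Basis. (z \<bullet> b) *\<^sub>R f x b)"
proof -
  have "f x z = f x (\<Sum>b\<in>Basis. (z \<bullet> b) *\<^sub>R b)" by (simp add: euclidean_representation)
  also have "\<dots> = (\<Sum>b\<in>Basis. (z \<bullet> b) *\<^sub>R f x b)"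
    using assms by (simp add: linear_sum linear_scale)
  finally show ?thesis .
qed

text \<open>The chain rule writes the derivative of the composition as a sum of products of derivatives of
  \<open>\<phi>\<close> with compositions of derivatives of \<open>f\<close> with \<open>\<phi>\<close>, to which the induction hypothesis applies.\<close>

lemma Ck_on_compose:
  fixes \<phi> :: "'a::real_normed_vector \<Rightarrow> 'b::euclidean_space" and f :: "'b \<Rightarrow> 'c::real_normed_vector"
  assumes S: "open S" and \<phi>: "Ck_on k S \<phi>" "\<phi> ` S \<subseteq> T" and f: "Ck_on k T f"
  shows "Ck_on k S (\<lambda>y. f (\<phi> y))"
  using \<phi>(1) f
proof (induction k arbitrary: f)
  case 0
  then show ?case using continuous_on_compose2[of T f S \<phi>] \<phi>(2) by simp
next
  case (Suc k)
  show ?case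
  proof (rule Ck_on_SucI[OF S])
    fix y assume y: "y \<in> S"
    then have "\<phi> y \<in> T" using \<phi>(2) by auto
    from Ck_on_has_derivative[OF Suc.prems(2) this]
    have f: "(f has_derivative (\<lambda>u. dird f (\<phi> y) u)) (at (\<phi> y))" .
    have "((\<lambda>y. f (\<phi> y)) has_derivative (\<lambda>u. dird f (\<phi> y) (dird \<phi> y u))) (at y)"
      using diff_chain_at[OF Ck_on_has_derivative[OF Suc.prems(1) y] f] by (simp add: o_def)
    then show "((\<lambda>y. f (\<phi> y)) has_derivative
        (\<lambda>u. \<Sum>b\<in>Basis. (dird \<phi> y u \<bullet> b) *\<^sub>R dird f (\<phi> y) b)) (at y)"
      by (rule has_derivative_eq_rhs)
         (rule ext, rule linear_family_expand[of "\<lambda>_. dird f (\<phi> y)", OF has_derivative_linear[OF f]])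
  next
    fix u
    show "Ck_on k S (\<lambda>y. \<Sum>b\<in>Basis. (dird \<phi> y u \<bullet> b) *\<^sub>R dird f (\<phi> y) b)"
    proof (rule Ck_on_sum[OF S])
      fix b :: 'b
      have "Ck_on k S (\<lambda>y. dird f (\<phi> y) b)"
        by (rule Suc.IH[OF Ck_on_SucD[OF Suc.prems(1)] Ck_on_Suc_imp(2)[OF Suc.prems(2)]])
      then show "Ck_on k S (\<lambda>y. (dird \<phi> y u \<bullet> b) *\<^sub>R dird f (\<phi> y) b)"
        by (rule Ck_on_bilinear[OF S bounded_bilinear_scaleR
              Ck_on_bilinear[OF S bounded_bilinear_inner Ck_on_Suc_imp(2)[OF Suc.prems(1)] Ck_on_const[OF S]]])
    qed
  qed
qed

lemma smooth_onI:
  assumes "open S" "\<And>y. y \<in> S \<Longrightarrow> (f has_derivative f' y) (at y)" "\<And>u. smooth_on S (\<lambda>y. f' y u)"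
  shows "smooth_on S f"
  unfolding smooth_on_def
proof
  fix k
  show "Ck_on k S f"
    using Ck_on_SucI[OF assms(1,2), of k] Ck_on_SucD assms(3) unfolding smooth_on_def by blast
qed

lemma smooth_on_differentiable: "smooth_on S f \<Longrightarrow> y \<in> S \<Longrightarrow> f differentiable (at y)"
  unfolding smooth_on_def using Ck_on_Suc_imp(1)[of _ S f y] by blast

lemma smooth_on_has_derivative:
  "smooth_on S f \<Longrightarrow> y \<in> S \<Longrightarrow> (f has_derivative (\<lambda>u. dird f y u)) (at y)"
  by (simp add: has_derivative_dird smooth_on_differentiable)

lemma smooth_on_dird: "smooth_on S f \<Longrightarrow> smooth_on S (\<lambda>y. dird f y u)"
  unfolding smooth_on_def using Ck_on_Suc_imp(2)[of _ S f u] by blast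

lemma smooth_on_cong: "open S \<Longrightarrow> (\<And>x. x \<in> S \<Longrightarrow> f x = g x) \<Longrightarrow> smooth_on S f \<Longrightarrow> smooth_on S g"
  unfolding smooth_on_def using Ck_on_cong[of S f g] by blast

lemma smooth_on_subset: "smooth_on T f \<Longrightarrow> S \<subseteq> T \<Longrightarrow> smooth_on S f"
  unfolding smooth_on_def using Ck_on_subset[of _ T f S] by blast

lemma smooth_on_const: "open S \<Longrightarrow> smooth_on S (\<lambda>_. a)"
  unfolding smooth_on_def using Ck_on_const[of S _ a] by blast

lemma smooth_on_bounded_linear:
  "open S \<Longrightarrow> bounded_linear L \<Longrightarrow> smooth_on S f \<Longrightarrow> smooth_on S (\<lambda>y. L (f y))"
  unfolding smooth_on_def using Ck_on_bounded_linear[of S L _ f] by simp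

lemma smooth_on_bilinear:
  "open S \<Longrightarrow> bounded_bilinear b \<Longrightarrow> smooth_on S f \<Longrightarrow> smooth_on S g \<Longrightarrow> smooth_on S (\<lambda>y. b (f y) (g y))"
  unfolding smooth_on_def using Ck_on_bilinear[of S b _ f g] by simp

lemma smooth_on_add:
  "open S \<Longrightarrow> smooth_on S f \<Longrightarrow> smooth_on S g \<Longrightarrow> smooth_on S (\<lambda>y. f y + g y)"
  unfolding smooth_on_def using Ck_on_add[of S _ f g] by simp

lemma smooth_on_compose:
  fixes \<phi> :: "'a::real_normed_vector \<Rightarrow> 'b::euclidean_space" and f :: "'b \<Rightarrow> 'c::real_normed_vector"
  assumes "open S" "smooth_on S \<phi>" "\<phi> ` S \<subseteq> T" "smooth_on T f"
  shows "smooth_on S (\<lambda>y. f (\<phi> y))"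
  unfolding smooth_on_def
proof
  fix k
  show "Ck_on k S (\<lambda>y. f (\<phi> y))"
    by (rule Ck_on_compose[OF assms(1) _ assms(3)]) (use assms(2,4) in \<open>simp_all add: smooth_on_def\<close>)
qed

lemma dird_compose:
  assumes "\<phi> differentiable (at y)" "f differentiable (at (\<phi> y))"
  shows "dird (\<lambda>x. f (\<phi> x)) y u = dird f (\<phi> y) (dird \<phi> y u)"
  using dird_eqI[OF diff_chain_at[OF assms[THEN has_derivative_dird]], of u] by (simp add: o_def)

lemma smooth_on_minus: "open S \<Longrightarrow> smooth_on S f \<Longrightarrow> smooth_on S (\<lambda>y. - f y)"
  by (rule smooth_on_bounded_linear[OF _ bounded_linear_minus[OF bounded_linear_ident]])

lemma smooth_on_diff:
  "open S \<Longrightarrow> smooth_on S f \<Longrightarrow> smooth_on S g \<Longrightarrow> smooth_on S (\<lambda>y. f y - g y)"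
  using smooth_on_add[of S f "\<lambda>y. - g y"] smooth_on_minus by auto

lemma smooth_on_sum:
  "open S \<Longrightarrow> (\<And>i. i \<in> I \<Longrightarrow> smooth_on S (f i)) \<Longrightarrow> smooth_on S (\<lambda>y. \<Sum>i\<in>I. f i y)"
  unfolding smooth_on_def using Ck_on_sum[of S I _ f] by simp

lemmas smooth_on_scaleR = smooth_on_bilinear[OF _ bounded_bilinear_scaleR]
lemmas smooth_on_mult = smooth_on_bilinear[OF _ bounded_bilinear_mult]
lemmas smooth_on_inner = smooth_on_bilinear[OF _ bounded_bilinear_inner]

lemma smooth_on_power:
  fixes f :: "'a::real_normed_vector \<Rightarrow> real"
  shows "open S \<Longrightarrow> smooth_on S f \<Longrightarrow> smooth_on S (\<lambda>y. f y ^ n)"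
proof (induction n)
  case (Suc n)
  then show ?case using smooth_on_mult[of S f "\<lambda>y. f y ^ n"] by simp
qed (simp add: smooth_on_const)

lemma smooth_on_Pair:
  assumes S: "open S" and "smooth_on S f" "smooth_on S g"
  shows "smooth_on S (\<lambda>y. (f y, g y))"
proof -
  have "bounded_linear (\<lambda>x. (x, 0))" "bounded_linear (\<lambda>x. (0, x))"
    by (auto intro!: bounded_linear_intros)
  then have "smooth_on S (\<lambda>y. (f y, 0) + (0, g y))"
    using assms smooth_on_bounded_linear[of S "\<lambda>x. (x, 0)" f] smooth_on_bounded_linear[of S "\<lambda>x. (0, x)" g]
    by (intro smooth_on_add[OF S]) auto
  then show ?thesis by simp
qed

lemma smooth_on_linear:
  assumes "open S" "bounded_linear L"
  shows "smooth_on S L"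
  by (rule smooth_onI[OF assms(1) bounded_linear_imp_has_derivative[OF assms(2)]])
     (simp add: smooth_on_const assms(1))

lemma smooth_on_ident: "open S \<Longrightarrow> smooth_on S (\<lambda>y. y)"
  by (rule smooth_on_linear[OF _ bounded_linear_ident])

lemma smooth_on_fst: "open S \<Longrightarrow> smooth_on S fst"
  and smooth_on_snd: "open S \<Longrightarrow> smooth_on S snd"
  by (simp_all add: smooth_on_linear bounded_linear_fst bounded_linear_snd)

lemma smooth_on_real_inverse: "smooth_on (- {0}) (inverse :: real \<Rightarrow> real)"
  unfolding smooth_on_def
proof
  fix k
  have o: "open (- {0::real})" by auto
  show "Ck_on k (- {0}) (inverse :: real \<Rightarrow> real)"
  proof (induction k)
    case 0 then show ?case by (auto intro!: continuous_intros)
  next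
    case (Suc k)
    show ?case
    proof (rule Ck_on_SucI[OF o])
      fix y :: real assume "y \<in> - {0}"
      then show "(inverse has_derivative (\<lambda>u. - (inverse y * u * inverse y))) (at y)"
        by (auto intro: has_derivative_inverse')
    next
      fix u :: real
      have "Ck_on k (- {0}) (\<lambda>y. (- u) * (inverse y * inverse y) :: real)"
        by (intro Ck_on_bilinear[OF o bounded_bilinear_mult] Ck_on_const[OF o] Suc.IH)
      then show "Ck_on k (- {0}) (\<lambda>y. - (inverse y * u * inverse y))"
        by (simp add: mult.commute mult.left_commute)
    qed
  qed
qed

lemma smooth_on_divide:
  fixes f g :: "'a::real_normed_vector \<Rightarrow> real"
  assumes "open S" "smooth_on S f" "smooth_on S g" "\<And>y. y \<in> S \<Longrightarrow> g y \<noteq> 0"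
  shows "smooth_on S (\<lambda>y. f y / g y)"
proof -
  have "smooth_on S (\<lambda>y. inverse (g y))"
    by (rule smooth_on_compose[OF assms(1,3) _ smooth_on_real_inverse]) (use assms(4) in auto)
  then show ?thesis unfolding divide_inverse by (rule smooth_on_mult[OF assms(1,2)])
qed

text \<open>The derivative of the square root is a smooth function of the square root itself, so one order of
  differentiability follows from the preceding one; the sine and the cosine are treated in the same
  way, together.\<close>

lemma smooth_on_real_sqrt: "smooth_on {0<..} sqrt"
  unfolding smooth_on_def
proof
  fix k
  have o: "open {0::real<..}" by auto
  show "Ck_on k {0<..} sqrt"
  proof (induction k)
    case 0 then show ?case by (auto intro!: continuous_intros)
  next
    case (Suc k)
    show ?case
    proof (rule Ck_on_SucI[OF o])
      fix y :: real assume y: "y \<in> {0<..}"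
      show "(sqrt has_derivative (\<lambda>u. u * (inverse (sqrt y) / 2))) (at y)"
        using DERIV_real_sqrt[of y] y
        by (auto simp: has_field_derivative_def mult.commute elim!: has_derivative_eq_rhs)
    next
      fix u :: real
      have "Ck_on k {0<..} (\<lambda>y. inverse (sqrt y))"
        by (rule Ck_on_compose[OF o Suc.IH, of "- {0}" inverse])
           (use smooth_on_real_inverse in \<open>auto simp: smooth_on_def\<close>)
      then have "Ck_on k {0<..} (\<lambda>y. (u / 2) * (inverse (sqrt y)))"
        by (intro Ck_on_bilinear[OF o bounded_bilinear_mult] Ck_on_const[OF o])
      then show "Ck_on k {0<..} (\<lambda>y. u * (inverse (sqrt y) / 2))" by simp
    qed
  qed
qed

lemma smooth_on_sin_cos: "smooth_on UNIV (sin :: real \<Rightarrow> real)" "smooth_on UNIV (cos :: real \<Rightarrow> real)"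
proof -
  have "Ck_on k UNIV (\<lambda>x::real. sin x) \<and> Ck_on k UNIV (\<lambda>x::real. cos x)" for k
  proof (induction k)
    case 0 then show ?case by (auto intro!: continuous_intros)
  next
    case (Suc k)
    have "Ck_on (Suc k) UNIV (\<lambda>x::real. sin x)"
    proof (rule Ck_on_SucI[of UNIV _ "\<lambda>y u. u * cos y"])
      fix u :: real
      show "Ck_on k UNIV (\<lambda>y. u * cos y)"
        using Suc.IH by (intro Ck_on_bilinear[OF _ bounded_bilinear_mult] Ck_on_const) auto
    qed (auto intro!: derivative_eq_intros)
    moreover have "Ck_on (Suc k) UNIV (\<lambda>x::real. cos x)"
    proof (rule Ck_on_SucI[of UNIV _ "\<lambda>y u. (- u) * sin y"])
      fix u :: real
      show "Ck_on k UNIV (\<lambda>y. (- u) * sin y)"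
        using Suc.IH by (intro Ck_on_bilinear[OF _ bounded_bilinear_mult] Ck_on_const) auto
    qed (auto intro!: derivative_eq_intros)
    ultimately show ?case by blast
  qed
  then show "smooth_on UNIV (sin :: real \<Rightarrow> real)" "smooth_on UNIV (cos :: real \<Rightarrow> real)"
    unfolding smooth_on_def by auto
qed

lemma smooth_on_real_arcsin: "smooth_on {-1<..<1} arcsin"
proof (rule smooth_onI[of _ _ "\<lambda>y u. u * (1 / sqrt (1 - y ^ 2))"])
  fix y :: real assume y: "y \<in> {-1<..<1}"
  then show "(arcsin has_derivative (\<lambda>u. u * (1 / sqrt (1 - y ^ 2)))) (at y)"
    using DERIV_arcsin[of y]
    by (auto simp: has_field_derivative_def mult.commute inverse_eq_divide elim!: has_derivative_eq_rhs)
next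
  fix u :: real
  have o: "open {-1<..<1::real}" by auto
  have "1 - y ^ 2 > 0" if "y \<in> {-1<..<1}" for y :: real
    using that by (simp add: abs_square_less_1 abs_less_iff)
  then have pos: "(\<lambda>y::real. 1 - y ^ 2) ` {-1<..<1} \<subseteq> {0<..}" by auto
  have "smooth_on {-1<..<1} (\<lambda>y::real. 1 - y ^ 2)"
    by (intro smooth_on_diff smooth_on_power smooth_on_const smooth_on_ident o)
  from smooth_on_compose[OF o this pos smooth_on_real_sqrt]
  have "smooth_on {-1<..<1} (\<lambda>y::real. sqrt (1 - y ^ 2))" by simp
  then have "smooth_on {-1<..<1} (\<lambda>y::real. 1 / sqrt (1 - y ^ 2))"
    by (rule smooth_on_divide[OF o smooth_on_const[OF o]]) (use pos in force)
  then show "smooth_on {-1<..<1} (\<lambda>y::real. u * (1 / sqrt (1 - y ^ 2)))"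
    by (rule smooth_on_mult[OF o smooth_on_const[OF o]])
qed auto


subsection \<open>Families of linear maps\<close>

lemma has_derivative_linear_family:
  fixes f :: "'v::real_normed_vector \<Rightarrow> 'a::euclidean_space \<Rightarrow> 'b::real_normed_vector"
  assumes S: "open S" "y \<in> S" and lin: "\<And>x. x \<in> S \<Longrightarrow> linear (f x)"
    and f: "\<And>b. (\<lambda>x. f x b) differentiable (at y)" and X: "(X has_derivative X') (at y)"
  shows "((\<lambda>x. f x (X x)) has_derivative (\<lambda>u. dird (\<lambda>x. f x (X y)) y u + f y (X' u))) (at y)"
proof -
  have D: "((\<lambda>x. \<Sum>b\<in>Basis. (Z x \<bullet> b) *\<^sub>R f x b) has_derivative
      (\<lambda>u. \<Sum>b\<in>Basis. (Z y \<bullet> b) *\<^sub>R dird (\<lambda>x. f x b) y u + (Z' u \<bullet> b) *\<^sub>R f y b)) (at y)"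
    if "(Z has_derivative Z') (at y)" for Z Z'
    using that has_derivative_dird[OF f] by (auto intro!: derivative_eq_intros)
  have "((\<lambda>x. f x (X x)) has_derivative
      (\<lambda>u. \<Sum>b\<in>Basis. (X y \<bullet> b) *\<^sub>R dird (\<lambda>x. f x b) y u + (X' u \<bullet> b) *\<^sub>R f y b)) (at y)"
    by (rule has_derivative_transform_within_open[OF D[OF X] S]) (simp add: linear_family_expand[of f, OF lin])
  moreover have "((\<lambda>x. f x (X y)) has_derivative
      (\<lambda>u. \<Sum>b\<in>Basis. (X y \<bullet> b) *\<^sub>R dird (\<lambda>x. f x b) y u + (0 \<bullet> b) *\<^sub>R f y b)) (at y)"
    using has_derivative_transform_within_open[OF D[OF has_derivative_const[of "X y"]] S,
        of "\<lambda>x. f x (X y)"] linear_family_expand[of f, OF lin] by simp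
  then have "dird (\<lambda>x. f x (X y)) y u = (\<Sum>b\<in>Basis. (X y \<bullet> b) *\<^sub>R dird (\<lambda>x. f x b) y u)" for u
    by (simp add: dird_eqI)
  moreover have "(\<Sum>b\<in>Basis. (X' u \<bullet> b) *\<^sub>R f y b) = f y (X' u)" for u
    by (rule linear_family_expand[of f y "X' u", OF lin[OF S(2)], symmetric])
  ultimately show ?thesis by (simp add: sum.distrib)
qed

lemma smooth_on_linear_family:
  fixes f :: "'v::real_normed_vector \<Rightarrow> 'a::euclidean_space \<Rightarrow> 'b::real_normed_vector"
  assumes S: "open S" and lin: "\<And>x. x \<in> S \<Longrightarrow> linear (f x)"
    and f: "\<And>b. smooth_on S (\<lambda>x. f x b)" and X: "smooth_on S X"
  shows "smooth_on S (\<lambda>x. f x (X x))"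
proof (rule smooth_on_cong[OF S])
  show "smooth_on S (\<lambda>x. \<Sum>b\<in>Basis. (X x \<bullet> b) *\<^sub>R f x b)"
    by (rule smooth_on_sum[OF S], rule smooth_on_scaleR[OF S _ f], rule smooth_on_inner[OF S X smooth_on_const[OF S]])
next
  fix x assume "x \<in> S"
  then show "(\<Sum>b\<in>Basis. (X x \<bullet> b) *\<^sub>R f x b) = f x (X x)"
    using linear_family_expand[of f x "X x", OF lin] by simp
qed

text \<open>The solution \<open>X\<close> of a linear system \<open>f X = h\<close> inherits the regularity of the system.  With a left
  inverse \<open>L\<close> of the matrix at the base point \<open>y\<close>, the equation reads
  \<open>X x = L (h x) - L (f x (X x) - f y (X x))\<close>, and the last term is small compared with \<open>X x\<close>.  This
  replaces Cramer's rule, and serves for Christoffel symbols, for the vector dual to a covector, and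
  for coordinate changes of covectors.\<close>

lemma linear_system_solution_tendsto:
  fixes f :: "'v::real_normed_vector \<Rightarrow> 'a::euclidean_space \<Rightarrow> 'b::euclidean_space"
  assumes S: "open S" "y \<in> S" and lin: "\<And>x. x \<in> S \<Longrightarrow> linear (f x)" and inj: "inj (f y)"
    and fc: "\<And>b. ((\<lambda>x. f x b) \<longlongrightarrow> f y b) (at y)"
    and hc: "(h \<longlongrightarrow> h y) (at y)"
    and eq: "\<And>x. x \<in> S \<Longrightarrow> f x (X x) = h x"
  shows "(X \<longlongrightarrow> X y) (at y)"
proof -
  obtain L where L0: "linear L" "L \<circ> f y = id"
    using linear_injective_left_inverse[OF lin[OF S(2)] inj] by blast
  have L: "linear L" "L (f y z) = z" for z
    using L0(1) fun_cong[OF L0(2), of z] by simp_all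
  have bL: "bounded_linear L" using L(1) linear_conv_bounded_linear by blast
  define N where "N x = (\<Sum>b\<in>Basis. norm (L (f x b - f y b)))" for x
  have Nb: "norm (L (f x z - f y z)) \<le> N x * norm z" if "x \<in> S" for x z
  proof -
    have "L (f x z - f y z) = (\<Sum>b\<in>Basis. (z \<bullet> b) *\<^sub>R L (f x b - f y b))"
      using linear_family_expand[of f, OF lin[OF that], of z] linear_family_expand[of f, OF lin[OF S(2)], of z] L(1)
      by (simp add: linear_diff linear_sum linear_scale scaleR_diff_right sum_subtractf)
    also have "norm \<dots> \<le> (\<Sum>b\<in>Basis. norm z * norm (L (f x b - f y b)))"
      by (rule sum_norm_le) (simp add: Basis_le_norm mult_right_mono)
    finally show ?thesis by (simp add: N_def sum_distrib_left mult.commute)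
  qed
  have key: "X x = L (h x) - L (f x (X x) - f y (X x))" if "x \<in> S" for x
    using eq[OF that] L by (simp add: linear_diff)
  have N0: "(N \<longlongrightarrow> 0) (at y)"
  proof -
    have "(N \<longlongrightarrow> (\<Sum>b\<in>(Basis::'a set). norm (L (f y b - f y b)))) (at y)"
      unfolding N_def by (intro tendsto_intros bounded_linear.tendsto[OF bL] fc)
    then show ?thesis by (simp add: linear_0[OF L(1)])
  qed
  have ev: "\<forall>\<^sub>F x in at y. x \<in> S" using S eventually_at_topological by blast
  have Xb: "\<forall>\<^sub>F x in at y. norm (X x - X y) \<le> 2 * norm (L (h x - h y)) + 2 * N x * norm (X y)"
  proof -
    have "\<forall>\<^sub>F x in at y. N x < 1/2" using order_tendstoD(2)[OF N0, of "1/2"] by simp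
    with ev show ?thesis
    proof eventually_elim
      case (elim x)
      have "X x - X y = L (h x - h y) - L (f x (X x) - f y (X x))"
        using key[OF elim(1)] L(1) L(2)[of "X y"] eq[OF S(2)] by (simp add: linear_diff)
      then have "norm (X x - X y) \<le> norm (L (h x - h y)) + N x * norm (X x)"
        using norm_triangle_ineq4[of "L (h x - h y)" "L (f x (X x) - f y (X x))"] Nb[OF elim(1), of "X x"]
        by simp
      also have "N x * norm (X x) \<le> N x * (norm (X x - X y) + norm (X y))"
        by (rule mult_left_mono) (auto simp: N_def sum_nonneg norm_triangle_sub add.commute)
      also have "N x * (norm (X x - X y) + norm (X y)) \<le> 1/2 * norm (X x - X y) + N x * norm (X y)"
        using elim(2) mult_right_mono[of "N x" "1/2" "norm (X x - X y)"] by (simp add: distrib_left)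
      finally show ?case by (simp add: algebra_simps)
    qed
  qed
  show ?thesis
  proof -
    have "((\<lambda>x. 2 * norm (L (h x - h y)) + 2 * N x * norm (X y)) \<longlongrightarrow> 2 * norm (L (h y - h y)) + 2 * 0 * norm (X y)) (at y)"
      by (intro tendsto_intros bounded_linear.tendsto[OF bL] hc N0)
    then have "((\<lambda>x. 2 * norm (L (h x - h y)) + 2 * N x * norm (X y)) \<longlongrightarrow> 0) (at y)"
      by (simp add: linear_0[OF L(1)])
    then have "((\<lambda>x. X x - X y) \<longlongrightarrow> 0) (at y)"
      using Lim_null_comparison[OF Xb] by simp
    then show ?thesis using LIM_zero_cancel by blast
  qed
qed

text \<open>In \<open>X x = L (h x) - L (f x (X x) - f y (X x))\<close> the coefficients of \<open>f x - f y\<close> are differentiable and vanish at \<open>y\<close>,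
  while \<open>X\<close> is continuous there; such a product is differentiable.\<close>

lemma linear_system_solution_differentiable:
  fixes f :: "'v::real_normed_vector \<Rightarrow> 'a::euclidean_space \<Rightarrow> 'b::euclidean_space"
  assumes S: "open S" "y \<in> S" and lin: "\<And>x. x \<in> S \<Longrightarrow> linear (f x)" and inj: "inj (f y)"
    and f: "\<And>b. (\<lambda>x. f x b) differentiable (at y)"
    and h: "h differentiable (at y)"
    and eq: "\<And>x. x \<in> S \<Longrightarrow> f x (X x) = h x"
  shows "X differentiable (at y)"
proof -
  obtain L where L0: "linear L" "L \<circ> f y = id"
    using linear_injective_left_inverse[OF lin[OF S(2)] inj] by blast
  have L: "linear L" "L (f y z) = z" for z
    using L0(1) fun_cong[OF L0(2), of z] by simp_all
  have bL: "bounded_linear L" using L(1) linear_conv_bounded_linear by blast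
  have fc: "((\<lambda>x. f x b) \<longlongrightarrow> f y b) (at y)" for b
    using differentiable_imp_continuous_within[OF f] by (simp add: continuous_within)
  have hc: "(h \<longlongrightarrow> h y) (at y)"
    using differentiable_imp_continuous_within[OF h] by (simp add: continuous_within)
  have Xc: "(X \<longlongrightarrow> X y) (at y)"
    by (rule linear_system_solution_tendsto[where f = f and h = h, OF S lin inj fc hc eq])
  have key: "X x = L (h x) - L (f x (X x) - f y (X x))" if "x \<in> S" for x
    using eq[OF that] L by (simp add: linear_diff)
  \<comment> \<open>A product of a differentiable factor vanishing at \<open>y\<close> and a continuous factor is differentiable.\<close>
  have prod: "((\<lambda>x. (X x \<bullet> b) *\<^sub>R L (f x b - f y b)) has_derivative
      (\<lambda>u. (X y \<bullet> b) *\<^sub>R L (dird (\<lambda>x. f x b) y u))) (at y)" for b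
  proof -
    let ?F = "\<lambda>x. L (f x b - f y b)"
    have F: "(?F has_derivative (\<lambda>u. L (dird (\<lambda>x. f x b) y u))) (at y)"
      using bounded_linear.has_derivative[OF bL has_derivative_diff[OF has_derivative_dird[OF f[of b]] has_derivative_const[of "f y b"]]]
      by simp
    obtain K where K: "\<forall>\<^sub>F x in at y. norm (?F x) \<le> K * norm (x - y)"
    proof -
      from F have bl: "bounded_linear (\<lambda>u. L (dird (\<lambda>x. f x b) y u))" by (rule has_derivative_bounded_linear)
      obtain B where B: "\<And>u. norm (L (dird (\<lambda>x. f x b) y u)) \<le> norm u * B"
        using bounded_linear.bounded[OF bl] by blast
      have "\<forall>\<^sub>F x in at y. norm (?F x - ?F y - L (dird (\<lambda>x. f x b) y (x - y))) \<le> 1 * norm (x - y)"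
        using has_derivative_within_alt2[THEN iffD1, OF F] zero_less_one by blast
      then have "\<forall>\<^sub>F x in at y. norm (?F x) \<le> (1 + B) * norm (x - y)"
      proof eventually_elim
        case (elim x)
        have "norm (?F x) \<le> norm (?F x - ?F y - L (dird (\<lambda>x. f x b) y (x - y))) + norm (L (dird (\<lambda>x. f x b) y (x - y)))"
          using norm_triangle_ineq[of "?F x - ?F y - L (dird (\<lambda>x. f x b) y (x - y))" "L (dird (\<lambda>x. f x b) y (x - y))"]
          by (simp add: linear_0[OF L(1)])
        with elim B[of "x - y"] show ?case by (simp add: algebra_simps)
      qed
      then show ?thesis using that by blast
    qed
    have "((\<lambda>x. ((X x - X y) \<bullet> b) *\<^sub>R ?F x) has_derivative (\<lambda>u. 0)) (at y)"
      unfolding has_derivative_at_within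
    proof (intro conjI)
      let ?g = "\<lambda>x. (((X x - X y) \<bullet> b) *\<^sub>R ?F x - ((X y - X y) \<bullet> b) *\<^sub>R ?F y - 0) /\<^sub>R norm (x - y)"
      show "(?g \<longlongrightarrow> 0) (at y)"
      proof (rule Lim_null_comparison)
        show "\<forall>\<^sub>F x in at y. norm (?g x) \<le> norm ((X x - X y) \<bullet> b) * K"
          using K eventually_neq_at_within[of y y UNIV]
        proof eventually_elim
          case (elim x)
          have "norm (?g x) = norm ((X x - X y) \<bullet> b) * (norm (?F x) / norm (x - y))"
            by (simp add: divide_inverse mult_ac abs_mult)
          also have "\<dots> \<le> norm ((X x - X y) \<bullet> b) * K"
            using elim by (intro mult_left_mono) (auto simp: divide_le_eq)
          finally show ?case .
        qed
        have "((\<lambda>x. norm ((X x - X y) \<bullet> b) * K) \<longlongrightarrow> norm ((X y - X y) \<bullet> b) * K) (at y)"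
          by (intro tendsto_intros Xc)
        then show "((\<lambda>x. norm ((X x - X y) \<bullet> b) * K) \<longlongrightarrow> 0) (at y)" by simp
      qed
    qed simp
    from has_derivative_add[OF this has_derivative_scaleR_right[OF F, of "X y \<bullet> b"]]
    show ?thesis by (simp add: inner_diff_left scaleR_diff_left)
  qed
  have "((\<lambda>x. L (h x) - (\<Sum>b\<in>Basis. (X x \<bullet> b) *\<^sub>R L (f x b - f y b))) has_derivative
      (\<lambda>u. L (dird h y u) - (\<Sum>b\<in>Basis. (X y \<bullet> b) *\<^sub>R L (dird (\<lambda>x. f x b) y u)))) (at y)"
    by (intro has_derivative_diff has_derivative_sum prod bounded_linear.has_derivative[OF bL] has_derivative_dird h)
  then have "(X has_derivative
      (\<lambda>u. L (dird h y u) - (\<Sum>b\<in>Basis. (X y \<bullet> b) *\<^sub>R L (dird (\<lambda>x. f x b) y u)))) (at y)"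
  proof (rule has_derivative_transform_within_open[OF _ S])
    fix x assume x: "x \<in> S"
    have "f x (X x) - f y (X x) = (\<Sum>b\<in>Basis. (X x \<bullet> b) *\<^sub>R (f x b - f y b))"
      using linear_family_expand[of f, OF lin[OF x], of "X x"] linear_family_expand[of f, OF lin[OF S(2)], of "X x"]
      by (simp add: scaleR_diff_right sum_subtractf)
    then show "L (h x) - (\<Sum>b\<in>Basis. (X x \<bullet> b) *\<^sub>R L (f x b - f y b)) = X x"
      using key[OF x] L(1) by (simp add: linear_sum linear_scale)
  qed
  then show ?thesis unfolding differentiable_def by blast
qed

text \<open>Differentiating \<open>f X = h\<close> gives \<open>f X' = h' - f' X\<close>, a system with the same matrix whose right-hand side
  is one order less regular; hence the induction on the order, for all right-hand sides at once.\<close>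

lemma smooth_on_linear_system_solution:
  fixes f :: "'v::real_normed_vector \<Rightarrow> 'a::euclidean_space \<Rightarrow> 'b::euclidean_space"
  assumes S: "open S" and lin: "\<And>x. x \<in> S \<Longrightarrow> linear (f x)" and inj: "\<And>x. x \<in> S \<Longrightarrow> inj (f x)"
    and f: "\<And>b. smooth_on S (\<lambda>x. f x b)"
    and h: "smooth_on S h"
    and eq: "\<And>x. x \<in> S \<Longrightarrow> f x (X x) = h x"
  shows "smooth_on S X"
proof -
  have fd: "(\<lambda>x. f x b) differentiable (at y)" if "y \<in> S" for y b
    by (rule smooth_on_differentiable[OF f that])
  have "Ck_on k S X" if "Ck_on k S h" "\<And>x. x \<in> S \<Longrightarrow> f x (X x) = h x" for k X h
    using that
  proof (induction k arbitrary: X h)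
    case 0
    have "(X \<longlongrightarrow> X y) (at y)" if y: "y \<in> S" for y
    proof (rule linear_system_solution_tendsto[where f = f and h = h, OF S y lin inj[OF y] _ _ 0(2)])
      show "((\<lambda>x. f x b) \<longlongrightarrow> f y b) (at y)" for b
        using differentiable_imp_continuous_within[OF fd[OF y]] by (simp add: continuous_within)
      show "(h \<longlongrightarrow> h y) (at y)"
        using 0(1) y at_within_open[OF y S] by (metis Ck_on.simps(1) continuous_on_def)
    qed
    then show ?case by (simp add: continuous_on_def at_within_open[OF _ S])
  next
    case (Suc k)
    have diff: "X differentiable (at y)" if "y \<in> S" for y
      using linear_system_solution_differentiable[where f = f and h = h and X = X, OF S that lin inj[OF that] fd[OF that] _ Suc.prems(2)]
        Suc.prems(1) that by auto
    have dX: "f y (dird X y u) = dird h y u - (\<Sum>b\<in>Basis. (X y \<bullet> b) *\<^sub>R dird (\<lambda>x. f x b) y u)"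
      if y: "y \<in> S" for y u
    proof -
      have Xd: "(X has_derivative (\<lambda>u. dird X y u)) (at y)" 
        by (rule has_derivative_dird[OF diff[OF y]])
      have "(h has_derivative (\<lambda>u. dird (\<lambda>x. f x (X y)) y u + f y (dird X y u))) (at y)"
        by (rule has_derivative_transform_within_open[OF has_derivative_linear_family[where f = f, OF S y lin fd[OF y] Xd] S y])
           (auto simp: Suc.prems(2))
      then have "dird h y u = dird (\<lambda>x. f x (X y)) y u + f y (dird X y u)" by (rule dird_eqI)
      moreover have "((\<lambda>x. \<Sum>b\<in>Basis. (X y \<bullet> b) *\<^sub>R f x b) has_derivative
          (\<lambda>u. \<Sum>b\<in>Basis. (X y \<bullet> b) *\<^sub>R dird (\<lambda>x. f x b) y u)) (at y)"
        using has_derivative_dird[OF fd[OF y]] by (auto intro!: derivative_eq_intros)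
      then have "((\<lambda>x. f x (X y)) has_derivative
          (\<lambda>u. \<Sum>b\<in>Basis. (X y \<bullet> b) *\<^sub>R dird (\<lambda>x. f x b) y u)) (at y)"
        by (rule has_derivative_transform_within_open[OF _ S y])
           (simp add: linear_family_expand[of f, OF lin])
      then have "dird (\<lambda>x. f x (X y)) y u = (\<Sum>b\<in>Basis. (X y \<bullet> b) *\<^sub>R dird (\<lambda>x. f x b) y u)"
        by (rule dird_eqI)
      ultimately show ?thesis by simp
    qed
    show ?case unfolding Ck_on.simps
    proof (intro conjI ballI allI)
      fix y assume "y \<in> S" then show "X differentiable (at y)" using diff by blast
    next
      fix u
      have "Ck_on k S X" using Suc.IH[OF Ck_on_SucD[OF Suc.prems(1)] Suc.prems(2)] .
      moreover have "Ck_on k S (\<lambda>y. dird (\<lambda>x. f x b) y u)" for b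
        using smooth_on_dird[OF f] unfolding smooth_on_def by blast
      ultimately have "Ck_on k S (\<lambda>y. \<Sum>b\<in>Basis. (X y \<bullet> b) *\<^sub>R dird (\<lambda>x. f x b) y u)"
        by (intro Ck_on_sum Ck_on_bilinear[OF S bounded_bilinear_scaleR] Ck_on_bilinear[OF S bounded_bilinear_inner]
            Ck_on_const S) auto
      then have "Ck_on k S (\<lambda>y. dird h y u + (- 1) *\<^sub>R (\<Sum>b\<in>Basis. (X y \<bullet> b) *\<^sub>R dird (\<lambda>x. f x b) y u))"
        by (rule Ck_on_add[OF S Ck_on_Suc_imp(2)[OF Suc.prems(1)]
              Ck_on_bilinear[OF S bounded_bilinear_scaleR Ck_on_const[OF S]]])
      then show "Ck_on k S (\<lambda>y. dird X y u)"
        by (rule Suc.IH) (use dX in auto)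
    qed
  qed
  then show ?thesis using h eq unfolding smooth_on_def by blast
qed


subsection \<open>Symmetry of second derivatives\<close>

text \<open>The mean value theorem, applied once in each direction, expresses the second difference by a
  mixed derivative at a nearby point.  The second difference is symmetric in \<open>u\<close> and \<open>v\<close>, so by
  continuity the mixed derivatives agree in the limit.\<close>

lemma second_difference_mean_value:
  fixes f :: "'a::real_normed_vector \<Rightarrow> real"
  assumes f: "smooth_on (ball y r) f" and h: "0 < h" "h * (norm u + norm v) < r"
  shows "\<exists>p. dist y p \<le> h * (norm u + norm v) \<and>
    f (y + h *\<^sub>R u + h *\<^sub>R v) - f (y + h *\<^sub>R u) - f (y + h *\<^sub>R v) + f y
      = h\<^sup>2 * dird (\<lambda>x. dird f x u) p v"
proof -
  let ?B = "ball y r"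
  have inB: "y + s *\<^sub>R u + t *\<^sub>R v \<in> ?B" "dist y (y + s *\<^sub>R u + t *\<^sub>R v) \<le> h * (norm u + norm v)"
    if "0 \<le> s" "s \<le> h" "0 \<le> t" "t \<le> h" for s t
  proof -
    have "norm (s *\<^sub>R u + t *\<^sub>R v) \<le> s * norm u + t * norm v"
      using norm_triangle_ineq[of "s *\<^sub>R u" "t *\<^sub>R v"] that by simp
    also have "\<dots> \<le> h * (norm u + norm v)"
      using that by (simp add: distrib_left add_mono mult_right_mono)
    finally have *: "norm (s *\<^sub>R u + t *\<^sub>R v) \<le> h * (norm u + norm v)" .
    then show "dist y (y + s *\<^sub>R u + t *\<^sub>R v) \<le> h * (norm u + norm v)"
      by (metis add.assoc add_diff_cancel_left' dist_commute dist_norm)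
    then show "y + s *\<^sub>R u + t *\<^sub>R v \<in> ?B" using h(2) by simp
  qed
  have D: "((\<lambda>s. g (a + s *\<^sub>R w)) has_real_derivative dird g (a + s *\<^sub>R w) w) (at s)"
    if "smooth_on ?B g" "a + s *\<^sub>R w \<in> ?B" for g :: "'a \<Rightarrow> real" and a w s
  proof -
    have g: "(g has_derivative (\<lambda>u. dird g (a + s *\<^sub>R w) u)) (at (a + s *\<^sub>R w))"
      by (rule smooth_on_has_derivative[OF that])
    have "((\<lambda>s. a + s *\<^sub>R w) has_derivative (\<lambda>t. t *\<^sub>R w)) (at s)"
      by (auto intro!: derivative_eq_intros)
    from diff_chain_at[OF this g]
    have "((\<lambda>s. g (a + s *\<^sub>R w)) has_derivative (\<lambda>t. dird g (a + s *\<^sub>R w) (t *\<^sub>R w))) (at s)"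
      by (simp add: o_def)
    then show ?thesis unfolding has_field_derivative_def
      by (rule has_derivative_eq_rhs)
         (simp add: fun_eq_iff linear_scale[OF has_derivative_linear[OF g]] mult.commute)
  qed
  \<comment> \<open>The second difference is the increment over \<open>[0, h]\<close> of this first difference.\<close>
  define \<phi> where "\<phi> s = f ((y + h *\<^sub>R v) + s *\<^sub>R u) - f (y + s *\<^sub>R u)" for s
  have "\<exists>s. 0 < s \<and> s < h \<and> \<phi> h - \<phi> 0
      = (h - 0) * (dird f ((y + h *\<^sub>R v) + s *\<^sub>R u) u - dird f (y + s *\<^sub>R u) u)"
  proof (rule MVT2[OF h(1)])
    fix s assume s: "0 \<le> s" "s \<le> h"
    have "(y + h *\<^sub>R v) + s *\<^sub>R u \<in> ?B" "y + s *\<^sub>R u \<in> ?B"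
      using inB(1)[OF s, of h] inB(1)[OF s, of 0] h(1) by (simp_all add: algebra_simps)
    then show "(\<phi> has_real_derivative
        dird f ((y + h *\<^sub>R v) + s *\<^sub>R u) u - dird f (y + s *\<^sub>R u) u) (at s)"
      unfolding \<phi>_def by (intro DERIV_diff D[OF f])
  qed
  then obtain s where s: "0 < s" "s < h" and \<phi>: "\<phi> h - \<phi> 0
      = h * (dird f ((y + h *\<^sub>R v) + s *\<^sub>R u) u - dird f (y + s *\<^sub>R u) u)" by auto
  define \<psi> where "\<psi> t = dird f ((y + s *\<^sub>R u) + t *\<^sub>R v) u" for t
  have "\<exists>t. 0 < t \<and> t < h \<and> \<psi> h - \<psi> 0
      = (h - 0) * dird (\<lambda>x. dird f x u) ((y + s *\<^sub>R u) + t *\<^sub>R v) v"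
  proof (rule MVT2[OF h(1)])
    fix t assume t: "0 \<le> t" "t \<le> h"
    have "(y + s *\<^sub>R u) + t *\<^sub>R v \<in> ?B" using inB(1)[of s t] s t by simp
    then show "(\<psi> has_real_derivative dird (\<lambda>x. dird f x u) ((y + s *\<^sub>R u) + t *\<^sub>R v) v) (at t)"
      unfolding \<psi>_def by (rule D[OF smooth_on_dird[OF f]])
  qed
  then obtain t where t: "0 < t" "t < h" and \<psi>: "\<psi> h - \<psi> 0
      = h * dird (\<lambda>x. dird f x u) ((y + s *\<^sub>R u) + t *\<^sub>R v) v" by auto
  have "f (y + h *\<^sub>R u + h *\<^sub>R v) - f (y + h *\<^sub>R u) - f (y + h *\<^sub>R v) + f y = \<phi> h - \<phi> 0"
    by (simp add: \<phi>_def algebra_simps)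
  also have "\<dots> = h * (\<psi> h - \<psi> 0)" unfolding \<phi> by (simp add: \<psi>_def algebra_simps)
  also have "\<dots> = h\<^sup>2 * dird (\<lambda>x. dird f x u) ((y + s *\<^sub>R u) + t *\<^sub>R v) v"
    unfolding \<psi> by (simp add: power2_eq_square)
  finally show ?thesis using inB(2)[of s t] s t by force
qed

lemma dird_dird_commute_real:
  fixes f :: "'a::real_normed_vector \<Rightarrow> real"
  assumes S: "open S" "y \<in> S" and f: "smooth_on S f"
  shows "dird (\<lambda>x. dird f x u) y v = dird (\<lambda>x. dird f x v) y u"
proof (rule ccontr)
  let ?A = "\<lambda>p. dird (\<lambda>x. dird f x u) p v" and ?B = "\<lambda>p. dird (\<lambda>x. dird f x v) p u"
  assume ne: "?A y \<noteq> ?B y"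
  define \<epsilon> where "\<epsilon> = \<bar>?A y - ?B y\<bar> / 2"
  have \<epsilon>: "\<epsilon> > 0" using ne by (simp add: \<epsilon>_def)
  obtain r where r: "r > 0" "ball y r \<subseteq> S" using S open_contains_ball by blast
  have "continuous (at y) ?A" "continuous (at y) ?B"
    using smooth_on_differentiable[OF smooth_on_dird[OF smooth_on_dird[OF f]] S(2)]
    by (auto intro: differentiable_imp_continuous_within)
  then obtain d e where d: "d > 0" "\<And>p. dist p y < d \<Longrightarrow> dist (?A p) (?A y) < \<epsilon>"
    and e: "e > 0" "\<And>p. dist p y < e \<Longrightarrow> dist (?B p) (?B y) < \<epsilon>"
    unfolding continuous_at_eps_delta using \<epsilon> by (metis dist_norm dist_commute)
  define m where "m = min r (min d e)"
  define K where "K = norm u + norm v + 1"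
  define h where "h = m / K / 2"
  have m: "m > 0" using r d e by (simp add: m_def)
  have n: "K > 0" using norm_ge_zero[of u] norm_ge_zero[of v] unfolding K_def by linarith
  have h: "h > 0" using m n by (simp add: h_def)
  have "h * (norm u + norm v) \<le> h * K" using h by (simp add: K_def)
  also have "\<dots> = m / 2" using n by (simp add: h_def)
  finally have hm: "h * (norm u + norm v) < m" using m by simp
  have fr: "smooth_on (ball y r) f" by (rule smooth_on_subset[OF f r(2)])
  obtain p where p: "dist y p \<le> h * (norm u + norm v)"
    "f (y + h *\<^sub>R u + h *\<^sub>R v) - f (y + h *\<^sub>R u) - f (y + h *\<^sub>R v) + f y = h\<^sup>2 * ?A p"
    using second_difference_mean_value[OF fr h, of u v] hm m_def by auto
  obtain q where q: "dist y q \<le> h * (norm v + norm u)"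
    "f (y + h *\<^sub>R v + h *\<^sub>R u) - f (y + h *\<^sub>R v) - f (y + h *\<^sub>R u) + f y = h\<^sup>2 * ?B q"
    using second_difference_mean_value[OF fr h, of v u] hm m_def by (auto simp: add.commute)
  have "h\<^sup>2 * ?A p = h\<^sup>2 * ?B q" using p(2) q(2) by (simp add: algebra_simps)
  then have "?A p = ?B q" using h by simp
  moreover have "dist (?A p) (?A y) < \<epsilon>"
    by (rule d(2)) (use p(1) hm m_def in \<open>simp add: dist_commute\<close>)
  moreover have "dist (?B q) (?B y) < \<epsilon>"
    by (rule e(2)) (use q(1) hm m_def in \<open>simp add: dist_commute add.commute\<close>)
  ultimately have "\<bar>?A y - ?B y\<bar> < 2 * \<epsilon>" unfolding dist_real_def by linarith
  then show False by (simp add: \<epsilon>_def)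
qed

lemma dird_dird_commute:
  fixes f :: "'a::real_normed_vector \<Rightarrow> 'b::euclidean_space"
  assumes S: "open S" "y \<in> S" and f: "smooth_on S f"
  shows "dird (\<lambda>x. dird f x u) y v = dird (\<lambda>x. dird f x v) y u"
proof (rule euclidean_eqI)
  fix b :: 'b
  have inn: "dird (\<lambda>x. g x \<bullet> b) x w = dird g x w \<bullet> b" if "smooth_on S g" "x \<in> S" for g :: "'a \<Rightarrow> 'b" and x w
    by (rule dird_eqI[OF has_derivative_inner_left[OF smooth_on_has_derivative[OF that]]])
  have fb: "smooth_on S (\<lambda>x. f x \<bullet> b)" by (rule smooth_on_inner[OF S(1) f smooth_on_const[OF S(1)]])
  have key: "dird (\<lambda>x. dird f x u) y v \<bullet> b = dird (\<lambda>x. dird (\<lambda>x. f x \<bullet> b) x u) y v" for u v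
  proof -
    have "dird (\<lambda>x. dird f x u \<bullet> b) y v = dird (\<lambda>x. dird (\<lambda>x. f x \<bullet> b) x u) y v"
      by (rule dird_cong_open[OF S smooth_on_differentiable[OF smooth_on_inner[OF S(1) smooth_on_dird[OF f] smooth_on_const[OF S(1)]] S(2)]])
         (simp add: inn[OF f])
    then show ?thesis using inn[OF smooth_on_dird[OF f] S(2)] by simp
  qed
  show "dird (\<lambda>x. dird f x u) y v \<bullet> b = dird (\<lambda>x. dird f x v) y u \<bullet> b"
    unfolding key by (rule dird_dird_commute_real[OF S fb])
qed


section \<open>Metric connections\<close>

lemma smooth_on_bilinear_family:
  fixes H :: "'v::real_normed_vector \<Rightarrow> 'a::euclidean_space \<Rightarrow> 'a \<Rightarrow> real"
  assumes S: "open S" and H: "\<And>x. x \<in> S \<Longrightarrow> bilinear (H x)" "\<And>a b. smooth_on S (\<lambda>x. H x a b)"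
    and X: "smooth_on S X" and Y: "smooth_on S Y"
  shows "smooth_on S (\<lambda>x. H x (X x) (Y x))"
proof (rule smooth_on_linear_family[where f = "\<lambda>x a. H x a (Y x)", OF S _ _ X])
  show "linear (\<lambda>a. H x a (Y x))" if "x \<in> S" for x using H(1)[OF that] by (simp add: bilinear_def)
  show "smooth_on S (\<lambda>x. H x b (Y x))" for b
    by (rule smooth_on_linear_family[where f = "\<lambda>x. H x b", OF S _ H(2) Y])
       (use H(1) in \<open>simp add: bilinear_def\<close>)
qed

text \<open>A trivialised vector bundle over \<open>S\<close> with fibre \<open>'f\<close>, a fibre metric \<open>H\<close> and a metric connection
  \<open>\<nabla>\<^sub>u = \<partial>\<^sub>u + C u\<close>.  The fibre need not be the tangent space: the bundle that carries the geometry of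
  the quadric has a fibre of its own.\<close>

locale metric_connection =
  fixes S :: "'v::euclidean_space set"
    and H :: "'v \<Rightarrow> 'f::euclidean_space \<Rightarrow> 'f \<Rightarrow> real"
    and C :: "'v \<Rightarrow> 'v \<Rightarrow> 'f \<Rightarrow> 'f"
  assumes open_S: "open S"
    and H_bilinear: "y \<in> S \<Longrightarrow> bilinear (H y)"
    and H_sym: "y \<in> S \<Longrightarrow> H y a b = H y b a"
    and H_pos: "y \<in> S \<Longrightarrow> a \<noteq> 0 \<Longrightarrow> H y a a > 0"
    and H_smooth: "smooth_on S (\<lambda>y. H y a b)"
    and C_linear_left: "y \<in> S \<Longrightarrow> linear (\<lambda>u. C y u a)"
    and C_linear: "y \<in> S \<Longrightarrow> linear (C y u)"
    and C_smooth: "smooth_on S (\<lambda>y. C y u a)"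
    and compatible: "y \<in> S \<Longrightarrow> dird (\<lambda>x. H x a b) y u = H y (C y u a) b + H y a (C y u b)"
begin

definition nab :: "('v \<Rightarrow> 'f) \<Rightarrow> 'v \<Rightarrow> 'v \<Rightarrow> 'f" where
  "nab \<zeta> y u = dird \<zeta> y u + C y u (\<zeta> y)"

definition Rm :: "'v \<Rightarrow> 'v \<Rightarrow> 'v \<Rightarrow> 'f \<Rightarrow> 'f" where
  "Rm y u v a = dird (\<lambda>x. C x v a) y u - dird (\<lambda>x. C x u a) y v
     + C y u (C y v a) - C y v (C y u a)"

lemma H_linear_left: "y \<in> S \<Longrightarrow> linear (\<lambda>a. H y a b)"
  using H_bilinear[of y] by (simp add: bilinear_def)

lemma H_linear_right: "y \<in> S \<Longrightarrow> linear (H y a)"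
  using H_bilinear[of y] by (simp add: bilinear_def)

lemma H_simps:
  assumes "y \<in> S"
  shows "H y (a + a') b = H y a b + H y a' b" "H y (a - a') b = H y a b - H y a' b"
    "H y (- a) b = - H y a b" "H y (r *\<^sub>R a) b = r * H y a b" "H y 0 b = 0"
    "H y b (a + a') = H y b a + H y b a'" "H y b (a - a') = H y b a - H y b a'"
    "H y b (- a) = - H y b a" "H y b (r *\<^sub>R a) = r * H y b a" "H y b 0 = 0"
  using linear_add[OF H_linear_left[OF assms]] linear_diff[OF H_linear_left[OF assms]]
    linear_neg[OF H_linear_left[OF assms]] linear_scale[OF H_linear_left[OF assms]]
    linear_0[OF H_linear_left[OF assms]]
    linear_add[OF H_linear_right[OF assms]] linear_diff[OF H_linear_right[OF assms]]
    linear_neg[OF H_linear_right[OF assms]] linear_scale[OF H_linear_right[OF assms]]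
    linear_0[OF H_linear_right[OF assms]]
  by simp_all

lemma H_nondegenerate:
  assumes "y \<in> S" "\<And>b. H y a b = H y a' b"
  shows "a = a'"
proof (rule ccontr)
  assume "a \<noteq> a'"
  then have "H y (a - a') (a - a') > 0" by (intro H_pos assms(1)) simp
  then show False using assms by (simp add: H_simps)
qed

lemma C_simps:
  assumes "y \<in> S"
  shows "C y u (a + b) = C y u a + C y u b" "C y u (a - b) = C y u a - C y u b"
    "C y u (- a) = - C y u a" "C y u (r *\<^sub>R a) = r *\<^sub>R C y u a" "C y u 0 = 0"
  using linear_add[OF C_linear[OF assms]] linear_diff[OF C_linear[OF assms]]
    linear_neg[OF C_linear[OF assms]] linear_scale[OF C_linear[OF assms]]
    linear_0[OF C_linear[OF assms]]
  by simp_all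

lemma has_derivative_C:
  assumes y: "y \<in> S" and \<zeta>: "\<zeta> differentiable (at y)"
  shows "((\<lambda>x. C x v (\<zeta> x)) has_derivative
    (\<lambda>u. dird (\<lambda>x. C x v (\<zeta> y)) y u + C y v (dird \<zeta> y u))) (at y)"
  by (rule has_derivative_linear_family[where f = "\<lambda>x. C x v", OF open_S y C_linear
        smooth_on_differentiable[OF C_smooth y] has_derivative_dird[OF \<zeta>]])

lemma smooth_C: "smooth_on S \<zeta> \<Longrightarrow> smooth_on S (\<lambda>x. C x v (\<zeta> x))"
  by (rule smooth_on_linear_family[where f = "\<lambda>x. C x v", OF open_S C_linear C_smooth])

lemma smooth_H: "smooth_on S \<zeta> \<Longrightarrow> smooth_on S \<eta> \<Longrightarrow> smooth_on S (\<lambda>x. H x (\<zeta> x) (\<eta> x))"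
  by (rule smooth_on_bilinear_family[where H = H, OF open_S H_bilinear H_smooth])

lemma smooth_nab: "smooth_on S \<zeta> \<Longrightarrow> smooth_on S (\<lambda>y. nab \<zeta> y u)"
  unfolding nab_def by (rule smooth_on_add[OF open_S smooth_on_dird smooth_C])

lemma has_derivative_H:
  assumes y: "y \<in> S" and \<zeta>: "\<zeta> differentiable (at y)" and \<eta>: "\<eta> differentiable (at y)"
  shows "((\<lambda>x. H x (\<zeta> x) (\<eta> x)) has_derivative
    (\<lambda>u. H y (nab \<zeta> y u) (\<eta> y) + H y (\<zeta> y) (nab \<eta> y u))) (at y)"
proof -
  have d: "((\<lambda>x. H x a (\<eta> x)) has_derivative
      (\<lambda>u. dird (\<lambda>x. H x a (\<eta> y)) y u + H y a (dird \<eta> y u))) (at y)" for a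
    by (rule has_derivative_linear_family[where f = "\<lambda>x. H x a", OF open_S y H_linear_right
          smooth_on_differentiable[OF H_smooth y] has_derivative_dird[OF \<eta>]])
  have "((\<lambda>x. H x (\<zeta> x) (\<eta> x)) has_derivative
      (\<lambda>u. dird (\<lambda>x. H x (\<zeta> y) (\<eta> x)) y u + H y (dird \<zeta> y u) (\<eta> y))) (at y)"
  proof (rule has_derivative_linear_family[where f = "\<lambda>x a. H x a (\<eta> x)", OF open_S y H_linear_left
          _ has_derivative_dird[OF \<zeta>]])
    show "(\<lambda>x. H x b (\<eta> x)) differentiable (at y)" for b
      using d[of b] unfolding differentiable_def by blast
  qed
  then show ?thesis
    by (rule has_derivative_eq_rhs) (simp add: fun_eq_iff dird_eqI[OF d] compatible[OF y] nab_def H_simps[OF y])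
qed

lemma nab_cong:
  assumes "y \<in> S" "\<zeta> differentiable (at y)" "\<And>x. x \<in> S \<Longrightarrow> \<zeta> x = \<eta> x"
  shows "nab \<zeta> y u = nab \<eta> y u"
  using dird_cong_open[OF open_S assms] assms(1,3) by (simp add: nab_def)

lemma nab_add:
  assumes "y \<in> S" "\<zeta> differentiable (at y)" "\<eta> differentiable (at y)"
  shows "nab (\<lambda>x. \<zeta> x + \<eta> x) y u = nab \<zeta> y u + nab \<eta> y u"
  using dird_eqI[OF has_derivative_add[OF assms(2,3)[THEN has_derivative_dird]]]
  by (simp add: nab_def C_simps assms(1))

lemma nab_diff:
  assumes "y \<in> S" "\<zeta> differentiable (at y)" "\<eta> differentiable (at y)"
  shows "nab (\<lambda>x. \<zeta> x - \<eta> x) y u = nab \<zeta> y u - nab \<eta> y u"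
  using dird_eqI[OF has_derivative_diff[OF assms(2,3)[THEN has_derivative_dird]]]
  by (simp add: nab_def C_simps assms(1))

lemma nab_scaleR:
  assumes "y \<in> S" "f differentiable (at y)" "\<zeta> differentiable (at y)"
  shows "nab (\<lambda>x. f x *\<^sub>R \<zeta> x) y u = dird f y u *\<^sub>R \<zeta> y + f y *\<^sub>R nab \<zeta> y u"
  using dird_eqI[OF has_derivative_scaleR[OF assms(2,3)[THEN has_derivative_dird]]]
  by (simp add: nab_def C_simps assms(1) algebra_simps)

lemma nab_const: "nab (\<lambda>_. a) y u = C y u a"
  by (simp add: nab_def)

lemma nab_linear:
  assumes "y \<in> S" "\<zeta> differentiable (at y)"
  shows "linear (nab \<zeta> y)"
  using linear_compose_add[OF has_derivative_linear[OF has_derivative_dird[OF assms(2)]] C_linear_left[OF assms(1)]]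
  unfolding nab_def by simp

lemma Rm_eq_nab:
  assumes "y \<in> S"
  shows "Rm y u v a = nab (\<lambda>x. C x v a) y u - nab (\<lambda>x. C x u a) y v"
  by (simp add: Rm_def nab_def)

text \<open>Second covariant derivatives commute up to the curvature; the ordinary second derivatives cancel
  by symmetry.\<close>

lemma Ricci_identity:
  assumes y: "y \<in> S" and \<zeta>: "smooth_on S \<zeta>"
  shows "nab (\<lambda>x. nab \<zeta> x v) y u - nab (\<lambda>x. nab \<zeta> x u) y v = Rm y u v (\<zeta> y)"
proof -
  note \<zeta>' = smooth_on_differentiable[OF \<zeta> y] smooth_on_differentiable[OF smooth_on_dird[OF \<zeta>] y]
  have "nab (\<lambda>x. nab \<zeta> x v) y u = dird (\<lambda>x. dird \<zeta> x v) y u + dird (\<lambda>x. C x v (\<zeta> y)) y u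
      + C y v (dird \<zeta> y u) + C y u (dird \<zeta> y v) + C y u (C y v (\<zeta> y))" for u v
    unfolding nab_def
    using dird_eqI[OF has_derivative_add[OF has_derivative_dird[OF \<zeta>'(2)] has_derivative_C[OF y \<zeta>'(1)]]]
    by (simp add: C_simps[OF y])
  then show ?thesis
    using dird_dird_commute[OF open_S y \<zeta>, of v u] by (simp add: Rm_def)
qed

text \<open>Differentiate \<open>H a b\<close> twice, for constant sections \<open>a\<close>, \<open>b\<close>, and antisymmetrise.\<close>

lemma Rm_skew:
  assumes y: "y \<in> S"
  shows "H y (Rm y u v a) b = - H y a (Rm y u v b)"
proof -
  let ?f = "\<lambda>x. H x a b"
  have C: "(\<lambda>x. C x w c) differentiable (at y)" for w c
    by (rule smooth_on_differentiable[OF C_smooth y])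
  have c: "(\<lambda>x. c) differentiable (at y)" for c :: 'f by simp
  have "dird (\<lambda>x. dird ?f x v) y u = H y (nab (\<lambda>x. C x v a) y u) b + H y (C y v a) (C y u b)
      + (H y (C y u a) (C y v b) + H y a (nab (\<lambda>x. C x v b) y u))" for u v
  proof -
    have "dird (\<lambda>x. dird ?f x v) y u = dird (\<lambda>x. H x (C x v a) b + H x a (C x v b)) y u"
      by (rule dird_cong_open[OF open_S y smooth_on_differentiable[OF smooth_on_dird[OF H_smooth] y]])
         (rule compatible)
    then show ?thesis
      using dird_eqI[OF has_derivative_add[OF has_derivative_H[OF y C c] has_derivative_H[OF y c C]]]
      by (simp add: nab_const)
  qed
  then have "H y (Rm y u v a) b + H y a (Rm y u v b) = 0"
    using dird_dird_commute[OF open_S y H_smooth[of a b], of u v] by (simp add: Rm_eq_nab[OF y] H_simps[OF y])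
  then show ?thesis by simp
qed

end


section \<open>Soldered bundles\<close>

lemma christoffel_eqI:
  assumes z: "\<And>w. g y z w =
      (dird (\<lambda>x. g x v w) y u + dird (\<lambda>x. g x u w) y v - dird (\<lambda>x. g x u v) y w) / 2"
    and nondeg: "\<And>z z'. (\<And>w. g y z w = g y z' w) \<Longrightarrow> z = z'"
  shows "christoffel g y u v = z"
  unfolding christoffel_def
proof (rule the_equality)
  fix z' assume "\<forall>w. g y z' w =
      (dird (\<lambda>x. g x v w) y u + dird (\<lambda>x. g x u w) y v - dird (\<lambda>x. g x u v) y w) / 2"
  then have "g y z' w = g y z w" for w using z[of w] by metis
  then show "z' = z" by (rule nondeg)
qed (use z in blast)

lemma trace_cyclic:
  fixes A :: "'f::euclidean_space \<Rightarrow> 'v::euclidean_space" and B :: "'v \<Rightarrow> 'f"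
  assumes "linear A" "linear B"
  shows "(\<Sum>b\<in>Basis. A (B b) \<bullet> b) = (\<Sum>c\<in>Basis. B (A c) \<bullet> c)"
proof -
  have A: "A (B b) = (\<Sum>c\<in>Basis. (B b \<bullet> c) *\<^sub>R A c)" for b
    using linear_family_expand[of "\<lambda>_. A", OF assms(1)] .
  have B: "B (A c) = (\<Sum>b\<in>Basis. (A c \<bullet> b) *\<^sub>R B b)" for c
    using linear_family_expand[of "\<lambda>_. B", OF assms(2)] .
  have "(\<Sum>b\<in>Basis. A (B b) \<bullet> b) = (\<Sum>b\<in>Basis. \<Sum>c\<in>Basis. (B b \<bullet> c) * (A c \<bullet> b))"
    by (simp add: A inner_sum_left)
  also have "\<dots> = (\<Sum>c\<in>Basis. \<Sum>b\<in>Basis. (B b \<bullet> c) * (A c \<bullet> b))" by (rule sum.swap)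
  also have "\<dots> = (\<Sum>c\<in>Basis. B (A c) \<bullet> c)" by (simp add: B inner_sum_left mult.commute)
  finally show ?thesis .
qed

text \<open>A metric \<open>G\<close> that is the pull-back of \<open>H\<close> under a torsion-free bundle isomorphism \<open>\<sigma>\<close> from the tangent bundle.
  Then \<open>\<sigma>\<close> carries the Levi-Civita connection of \<open>G\<close> to the given connection, so that the curvature
  of \<open>G\<close> can be computed in the bundle, where no derivative of \<open>G\<close> occurs.\<close>

locale soldered_bundle = metric_connection S H C
  for S :: "'v::euclidean_space set"
    and H :: "'v \<Rightarrow> 'f::euclidean_space \<Rightarrow> 'f \<Rightarrow> real"
    and C :: "'v \<Rightarrow> 'v \<Rightarrow> 'f \<Rightarrow> 'f" +
  fixes \<sigma> :: "'v \<Rightarrow> 'v \<Rightarrow> 'f"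
    and G :: "'v \<Rightarrow> 'v \<Rightarrow> 'v \<Rightarrow> real"
  assumes \<sigma>_linear: "y \<in> S \<Longrightarrow> linear (\<sigma> y)"
    and \<sigma>_inj: "y \<in> S \<Longrightarrow> inj (\<sigma> y)"
    and dim_eq: "DIM('v) = DIM('f)"
    and \<sigma>_smooth: "smooth_on S (\<lambda>y. \<sigma> y u)"
    and torsion_free: "y \<in> S \<Longrightarrow> nab (\<lambda>x. \<sigma> x v) y u = nab (\<lambda>x. \<sigma> x u) y v"
    and G_eq: "y \<in> S \<Longrightarrow> G y u v = H y (\<sigma> y u) (\<sigma> y v)"
begin

lemma \<sigma>_simps:
  assumes "y \<in> S"
  shows "\<sigma> y (a + b) = \<sigma> y a + \<sigma> y b" "\<sigma> y (a - b) = \<sigma> y a - \<sigma> y b"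
    "\<sigma> y (- a) = - \<sigma> y a" "\<sigma> y 0 = 0"
  using linear_add[OF \<sigma>_linear[OF assms]] linear_diff[OF \<sigma>_linear[OF assms]]
    linear_neg[OF \<sigma>_linear[OF assms]] linear_0[OF \<sigma>_linear[OF assms]]
  by simp_all

lemma \<sigma>_eqD: "y \<in> S \<Longrightarrow> \<sigma> y u = \<sigma> y v \<Longrightarrow> u = v"
  using \<sigma>_inj by (simp add: inj_def)

lemma \<sigma>_surj: "y \<in> S \<Longrightarrow> \<exists>u. \<sigma> y u = a"
proof -
  assume y: "y \<in> S"
  have "dim (range (\<sigma> y)) = DIM('f)"
    using dim_image_eq[OF \<sigma>_linear[OF y], of UNIV] \<sigma>_inj[OF y] dim_eq by simp
  then have "span (range (\<sigma> y)) = UNIV" by (simp add: dim_eq_full)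
  then have "range (\<sigma> y) = UNIV"
    using span_linear_image[OF \<sigma>_linear[OF y], of UNIV] by simp
  then show ?thesis by (metis surjD)
qed

lemma G_smooth: "smooth_on S (\<lambda>y. G y u v)"
  by (rule smooth_on_cong[OF open_S _ smooth_H[OF \<sigma>_smooth \<sigma>_smooth]]) (rule G_eq[symmetric])

text \<open>Uniqueness of the Levi-Civita connection: the pull-back of a metric connection under a
  torsion-free isomorphism satisfies the Koszul formula.\<close>

lemma christoffel_solder:
  assumes y: "y \<in> S"
  shows "\<sigma> y (christoffel G y u v) = nab (\<lambda>x. \<sigma> x v) y u"
proof -
  let ?N = "\<lambda>u v. nab (\<lambda>x. \<sigma> x v) y u"
  obtain z where z: "\<sigma> y z = ?N u v" using \<sigma>_surj[OF y] by blast
  have D: "dird (\<lambda>x. G x a b) y w = H y (?N w a) (\<sigma> y b) + H y (\<sigma> y a) (?N w b)" for a b w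
  proof -
    have "dird (\<lambda>x. G x a b) y w = dird (\<lambda>x. H x (\<sigma> x a) (\<sigma> x b)) y w"
      by (rule dird_cong_open[OF open_S y smooth_on_differentiable[OF G_smooth y]]) (rule G_eq)
    then show ?thesis
      using dird_eqI[OF has_derivative_H[OF y smooth_on_differentiable[OF \<sigma>_smooth y] smooth_on_differentiable[OF \<sigma>_smooth y]]]
      by simp
  qed
  have "christoffel G y u v = z"
  proof (rule christoffel_eqI)
    fix w
    show "G y z w = (dird (\<lambda>x. G x v w) y u + dird (\<lambda>x. G x u w) y v - dird (\<lambda>x. G x u v) y w) / 2"
      unfolding D G_eq[OF y] z
      using torsion_free[OF y, of u v] torsion_free[OF y, of w v] torsion_free[OF y, of w u]
        H_sym[OF y, of "\<sigma> y u"] H_sym[OF y, of "?N w u"] by simp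
  next
    fix z z' assume "\<And>w. G y z w = G y z' w"
    then have "H y (\<sigma> y z) a = H y (\<sigma> y z') a" for a
      using \<sigma>_surj[OF y, of a] G_eq[OF y] by metis
    then show "z = z'" using \<sigma>_eqD[OF y] H_nondegenerate[OF y] by blast
  qed
  then show ?thesis using z by simp
qed

lemma nab_solder:
  assumes y: "y \<in> S" and X: "X differentiable (at y)"
  shows "nab (\<lambda>x. \<sigma> x (X x)) y u = nab (\<lambda>x. \<sigma> x (X y)) y u + \<sigma> y (dird X y u)"
  using dird_eqI[OF has_derivative_linear_family[where f = \<sigma>, OF open_S y \<sigma>_linear
        smooth_on_differentiable[OF \<sigma>_smooth y] has_derivative_dird[OF X]]]
  by (simp add: nab_def)

lemma cov_deriv_solder:
  assumes "y \<in> S" "X differentiable (at y)"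
  shows "\<sigma> y (cov_deriv G (\<lambda>_. u) X y) = nab (\<lambda>x. \<sigma> x (X x)) y u"
  unfolding cov_deriv_def
  by (simp add: \<sigma>_simps[OF assms(1)] nab_solder[OF assms] christoffel_solder[OF assms(1)])

lemma smooth_solder_inverse:
  "smooth_on S h \<Longrightarrow> (\<And>x. x \<in> S \<Longrightarrow> \<sigma> x (X x) = h x) \<Longrightarrow> smooth_on S X"
  by (rule smooth_on_linear_system_solution[where f = \<sigma> and h = h and X = X, OF open_S \<sigma>_linear \<sigma>_inj \<sigma>_smooth])

lemma smooth_christoffel: "smooth_on S (\<lambda>x. christoffel G x u v)"
  by (rule smooth_solder_inverse[OF smooth_nab[OF \<sigma>_smooth] christoffel_solder])

lemma curvature_solder:
  assumes y: "y \<in> S"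
  shows "\<sigma> y (curvature G y u v w) = Rm y u v (\<sigma> y w)"
proof -
  have *: "cov_deriv G (\<lambda>_. u) (\<lambda>_. w) = (\<lambda>x. christoffel G x u w)" for u w
    by (simp add: cov_deriv_def fun_eq_iff)
  note dc = smooth_on_differentiable[OF smooth_christoffel y]
  have "\<sigma> y (cov_deriv G (\<lambda>_. u) (\<lambda>x. christoffel G x v w) y) = nab (\<lambda>x. nab (\<lambda>x. \<sigma> x w) x v) y u" for u v
    unfolding cov_deriv_solder[OF y dc]
  proof (rule nab_cong[OF y _ christoffel_solder])
    have "smooth_on S (\<lambda>x. \<sigma> x (christoffel G x v w))"
      by (rule smooth_on_linear_family[where f = \<sigma>, OF open_S \<sigma>_linear \<sigma>_smooth smooth_christoffel])
    then show "(\<lambda>x. \<sigma> x (christoffel G x v w)) differentiable (at y)"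
      by (rule smooth_on_differentiable[OF _ y])
  qed
  then show ?thesis
    unfolding curvature_def * by (simp add: \<sigma>_simps[OF y] Ricci_identity[OF y \<sigma>_smooth])
qed

lemma smooth_Rm:
  assumes "smooth_on S \<zeta>"
  shows "smooth_on S (\<lambda>x. Rm x u v (\<zeta> x))"
  by (rule smooth_on_cong[OF open_S Ricci_identity[OF _ assms]])
     (auto intro!: smooth_on_diff smooth_nab open_S assms)

lemma smooth_curvature: "smooth_on S (\<lambda>x. curvature G x u v w)"
  by (rule smooth_solder_inverse[OF smooth_Rm[OF \<sigma>_smooth] curvature_solder])

text \<open>If the curvature is an expression \<open>Q\<close> in the soldering form and \<open>Q\<close> obeys the Leibniz rule, that is, \<open>Q\<close> is parallel,
  then so is the curvature tensor.\<close>

lemma nabla_curvature_zero: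
  assumes y: "y \<in> S"
    and Q: "\<And>x u v a. x \<in> S \<Longrightarrow> Rm x u v a = Q x (\<sigma> x u) (\<sigma> x v) a"
    and parallel: "\<And>a b \<zeta> u. smooth_on S a \<Longrightarrow> smooth_on S b \<Longrightarrow> smooth_on S \<zeta> \<Longrightarrow>
      nab (\<lambda>x. Q x (a x) (b x) (\<zeta> x)) y u =
      Q y (nab a y u) (b y) (\<zeta> y) + Q y (a y) (nab b y u) (\<zeta> y) + Q y (a y) (b y) (nab \<zeta> y u)"
  shows "nabla_curvature G y z u v w = 0"
proof -
  have K: "\<sigma> x (curvature G x u v w) = Q x (\<sigma> x u) (\<sigma> x v) (\<sigma> x w)" if "x \<in> S" for x u v w
    using curvature_solder[OF that] Q[OF that] by simp
  have sK: "smooth_on S (\<lambda>x. \<sigma> x (curvature G x u v w))"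
    by (rule smooth_on_cong[OF open_S curvature_solder[symmetric] smooth_Rm[OF \<sigma>_smooth]])
  have "\<sigma> y (cov_deriv G (\<lambda>_. z) (\<lambda>x. curvature G x u v w) y)
      = nab (\<lambda>x. Q x (\<sigma> x u) (\<sigma> x v) (\<sigma> x w)) y z"
    unfolding cov_deriv_solder[OF y smooth_on_differentiable[OF smooth_curvature y]]
    by (rule nab_cong[OF y smooth_on_differentiable[OF sK y] K])
  then have "\<sigma> y (nabla_curvature G y z u v w) = 0"
    unfolding nabla_curvature_def
    by (simp add: \<sigma>_simps[OF y] K[OF y] christoffel_solder[OF y] parallel[OF \<sigma>_smooth \<sigma>_smooth \<sigma>_smooth])
  then show ?thesis using \<sigma>_eqD[OF y, of _ 0] \<sigma>_simps(4)[OF y] by simp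
qed

lemma ricci_solder:
  assumes y: "y \<in> S"
    and Q: "\<And>u v a. Rm y u v a = Q (\<sigma> y u) (\<sigma> y v) a"
    and lin: "\<And>b a. linear (\<lambda>c. Q c b a)"
  shows "ricci G y v w = (\<Sum>c\<in>Basis. Q c (\<sigma> y v) (\<sigma> y w) \<bullet> c)"
proof -
  obtain B where B: "linear B" "B \<circ> \<sigma> y = id"
    using linear_injective_left_inverse[OF \<sigma>_linear[OF y] \<sigma>_inj[OF y]] by blast
  have B': "B (\<sigma> y u) = u" for u using fun_cong[OF B(2), of u] by simp
  have s: "\<sigma> y (B c) = c" for c using \<sigma>_surj[OF y, of c] B' by metis
  have K: "curvature G y b v w = B (Q (\<sigma> y b) (\<sigma> y v) (\<sigma> y w))" for b
    using curvature_solder[OF y, of b v w] B' Q by metis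
  have "linear (\<lambda>c. B (Q c (\<sigma> y v) (\<sigma> y w)))"
    using linear_compose[OF lin B(1)] by (simp add: o_def)
  from trace_cyclic[OF this \<sigma>_linear[OF y]]
  show ?thesis by (simp add: ricci_def K s)
qed

end


text \<open>An almost complex structure \<open>J\<close> that corresponds under \<open>\<sigma>\<close> to a parallel orthogonal complex structure \<open>j\<close>
  of the bundle is parallel for the Levi-Civita connection; together with the absence of torsion
  this is the Kaehler condition.\<close>

locale soldered_complex_bundle = soldered_bundle S H C \<sigma> G
  for S :: "'v::euclidean_space set"
    and H :: "'v \<Rightarrow> 'f::euclidean_space \<Rightarrow> 'f \<Rightarrow> real"
    and C :: "'v \<Rightarrow> 'v \<Rightarrow> 'f \<Rightarrow> 'f"
    and \<sigma> :: "'v \<Rightarrow> 'v \<Rightarrow> 'f" and G :: "'v \<Rightarrow> 'v \<Rightarrow> 'v \<Rightarrow> real" +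
  fixes j :: "'f \<Rightarrow> 'f" and J :: "'v \<Rightarrow> 'v \<Rightarrow> 'v"
  assumes j_linear: "linear j"
    and j_j: "j (j a) = - a"
    and j_isometry: "y \<in> S \<Longrightarrow> H y (j a) (j b) = H y a b"
    and j_parallel: "y \<in> S \<Longrightarrow> C y u (j a) = j (C y u a)"
    and J_solder: "y \<in> S \<Longrightarrow> \<sigma> y (J y u) = j (\<sigma> y u)"
begin

lemma J_smooth: "smooth_on S (\<lambda>y. J y u)"
  by (rule smooth_solder_inverse[OF smooth_on_bounded_linear[OF open_S _ \<sigma>_smooth, of j] J_solder])
     (use j_linear linear_conv_bounded_linear in blast)

lemma J_J: "y \<in> S \<Longrightarrow> J y (J y u) = - u"
  by (rule \<sigma>_eqD[of y]) (simp_all add: J_solder \<sigma>_simps j_j)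

lemma J_isometry: "y \<in> S \<Longrightarrow> G y (J y u) (J y v) = G y u v"
  by (simp add: G_eq J_solder j_isometry)

lemma nab_j:
  assumes "y \<in> S" "\<zeta> differentiable (at y)"
  shows "nab (\<lambda>x. j (\<zeta> x)) y u = j (nab \<zeta> y u)"
  using dird_eqI[OF bounded_linear.has_derivative[OF j_linear[unfolded linear_conv_bounded_linear] has_derivative_dird[OF assms(2)]]]
  by (simp add: nab_def j_parallel[OF assms(1)] linear_add[OF j_linear])

text \<open>This says that \<open>J\<close> is parallel, solved for the ordinary derivative of \<open>J\<close>; substituted in the Nijenhuis
  tensor, all terms cancel in pairs because the torsion vanishes.\<close>

lemma dird_J:
  assumes y: "y \<in> S"
  shows "\<sigma> y (dird (\<lambda>x. J x v) y w) = j (nab (\<lambda>x. \<sigma> x v) y w) - nab (\<lambda>x. \<sigma> x (J y v)) y w"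
proof -
  have "nab (\<lambda>x. \<sigma> x (J x v)) y w = nab (\<lambda>x. j (\<sigma> x v)) y w"
  proof (rule nab_cong[OF y _ J_solder])
    have "smooth_on S (\<lambda>x. \<sigma> x (J x v))"
      by (rule smooth_on_linear_family[where f = \<sigma>, OF open_S \<sigma>_linear \<sigma>_smooth J_smooth])
    then show "(\<lambda>x. \<sigma> x (J x v)) differentiable (at y)" by (rule smooth_on_differentiable[OF _ y])
  qed
  then show ?thesis
    unfolding nab_solder[OF y smooth_on_differentiable[OF J_smooth y]]
      nab_j[OF y smooth_on_differentiable[OF \<sigma>_smooth y]] by (simp add: algebra_simps)
qed

lemma nijenhuis_zero:
  assumes y: "y \<in> S"
  shows "nijenhuis J y u v = 0"
proof -
  have "\<sigma> y (nijenhuis J y u v) = 0"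
    unfolding nijenhuis_def lie_bracket_def
    using torsion_free[OF y, of u v] torsion_free[OF y, of u "J y v"]
      torsion_free[OF y, of "J y u" v] torsion_free[OF y, of "J y u" "J y v"]
    by (simp add: \<sigma>_simps[OF y] J_solder[OF y] dird_J[OF y] linear_diff[OF j_linear]
        linear_neg[OF j_linear] j_j)
  then show ?thesis using \<sigma>_eqD[OF y, of _ 0] \<sigma>_simps(4)[OF y] by simp
qed

lemma kaehler_form_closed:
  assumes y: "y \<in> S"
  shows "ext_deriv (\<lambda>x a b. G x a (J x b)) y u v w = 0"
proof -
  have skew: "H y (j a) b = - H y a (j b)" for a b
    using j_isometry[OF y, of a "j b"] by (simp add: j_j H_simps[OF y])
  let ?N = "\<lambda>u v. nab (\<lambda>x. \<sigma> x v) y u"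
  have "dird (\<lambda>x. G x a (J x b)) y c = H y (?N c a) (j (\<sigma> y b)) + H y (\<sigma> y a) (j (?N c b))" for a b c
  proof -
    have js: "smooth_on S (\<lambda>x. j (\<sigma> x b))"
      by (rule smooth_on_bounded_linear[OF open_S j_linear[unfolded linear_conv_bounded_linear] \<sigma>_smooth])
    have "dird (\<lambda>x. H x (\<sigma> x a) (j (\<sigma> x b))) y c = dird (\<lambda>x. G x a (J x b)) y c"
      by (rule dird_cong_open[OF open_S y smooth_on_differentiable[OF smooth_H[OF \<sigma>_smooth js] y]])
         (simp add: G_eq J_solder)
    then show ?thesis
      using dird_eqI[OF has_derivative_H[OF y smooth_on_differentiable[OF \<sigma>_smooth y] smooth_on_differentiable[OF js y]]]
        nab_j[OF y smooth_on_differentiable[OF \<sigma>_smooth y], of b c] by simp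
  qed
  then show ?thesis
    unfolding ext_deriv_def
    using torsion_free[OF y, of u v] torsion_free[OF y, of v w] torsion_free[OF y, of w u]
      H_sym[OF y, of "\<sigma> y u"] H_sym[OF y, of "\<sigma> y v"] H_sym[OF y, of "\<sigma> y w"] by (simp add: skew)
qed

end


section \<open>The soldering form of the complex quadric\<close>

lemma smooth_on_sin: "open S \<Longrightarrow> smooth_on S f \<Longrightarrow> smooth_on S (\<lambda>y. sin (f y) :: real)"
  by (rule smooth_on_compose[OF _ _ _ smooth_on_sin_cos(1)]) auto

lemma smooth_on_cos: "open S \<Longrightarrow> smooth_on S f \<Longrightarrow> smooth_on S (\<lambda>y. cos (f y) :: real)"
  by (rule smooth_on_compose[OF _ _ _ smooth_on_sin_cos(2)]) auto

lemma sum_Basis_prod_split: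
  fixes f :: "'a::euclidean_space \<times> 'b::euclidean_space \<Rightarrow> real"
  shows "sum f Basis = (\<Sum>i\<in>Basis. f (i, 0)) + (\<Sum>i\<in>Basis. f (0, i))"
proof -
  have "sum f Basis = sum f ((\<lambda>u. (u, 0)) ` Basis) + sum f ((\<lambda>u. (0, u)) ` Basis)"
    unfolding Basis_prod_def by (rule sum.union_disjoint) auto
  also have "\<dots> = (\<Sum>i\<in>Basis. f (i, 0)) + (\<Sum>i\<in>Basis. f (0, i))"
    by (simp add: sum.reindex inj_on_def)
  finally show ?thesis .
qed

text \<open>A bundle with the metric and curvature of a space form (after a rescaling, \<open>\<ll>\<close> is the torsion-free
  inclusion of the base directions and the curvature is \<open>\<ll> \<and> \<ll>\<close>), a unit section \<open>e\<close> and an angle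
  \<open>\<theta>\<close>.  Adding two trivial directions \<open>e\<^sub>0\<close>, the position vector, and \<open>e\<^sub>\<infinity>\<close>, gives a flat bundle in which
  \<open>e\<close> and \<open>cos \<theta> e\<^sub>\<infinity> + sin \<theta> e\<^sub>0\<close> span an oriented plane.  The components of the derivatives of these two
  vectors normal to the plane are \<open>\<alpha>\<close> and \<open>\<beta>\<close> below, where the unit normal
  \<open>cos \<theta> e\<^sub>0 - sin \<theta> e\<^sub>\<infinity>\<close> is written \<open>e\<close>, which identifies the normal bundle of the plane with the
  given bundle.\<close>

locale quadric_soldering = metric_connection S H C
  for S :: "'v::euclidean_space set"
    and H :: "'v \<Rightarrow> 'f::euclidean_space \<Rightarrow> 'f \<Rightarrow> real"
    and C :: "'v \<Rightarrow> 'v \<Rightarrow> 'f \<Rightarrow> 'f" +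
  fixes \<ll> :: "'v \<Rightarrow> 'v \<Rightarrow> 'f" and e :: "'v \<Rightarrow> 'f" and \<theta> :: "'v \<Rightarrow> real" and \<kappa> :: real
  assumes \<ll>_linear: "y \<in> S \<Longrightarrow> linear (\<ll> y)"
    and \<ll>_smooth: "smooth_on S (\<lambda>y. \<ll> y u)"
    and \<ll>_torsion_free: "y \<in> S \<Longrightarrow> nab (\<lambda>x. \<ll> x v) y u = nab (\<lambda>x. \<ll> x u) y v"
    and e_smooth: "smooth_on S e"
    and e_unit: "y \<in> S \<Longrightarrow> H y (e y) (e y) = 1"
    and \<theta>_smooth: "smooth_on S \<theta>"
    and Rm_eq: "y \<in> S \<Longrightarrow> Rm y u v \<zeta> = H y (\<ll> y v) \<zeta> *\<^sub>R \<ll> y u - H y (\<ll> y u) \<zeta> *\<^sub>R \<ll> y v"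
    and \<kappa>_pos: "\<kappa> > 0"
begin

abbreviation \<epsilon> where "\<epsilon> y u \<equiv> nab e y u"

text \<open>\<open>C'\<close> is the connection of the normal bundle of the plane, obtained by projection of the flat connection;
  it differs from \<open>C\<close> by the skew map \<open>\<tau> \<and> e\<close>.  The connection of the plane itself is the 1-form \<open>s\<close>.\<close>

definition \<tau> where "\<tau> y u = cos (\<theta> y) *\<^sub>R \<ll> y u - \<epsilon> y u"

definition \<alpha> where "\<alpha> y u = \<epsilon> y u - (cos (\<theta> y) * H y (\<ll> y u) (e y)) *\<^sub>R e y"

definition \<beta> where
  "\<beta> y u = sin (\<theta> y) *\<^sub>R (\<ll> y u - H y (\<ll> y u) (e y) *\<^sub>R e y) + dird \<theta> y u *\<^sub>R e y"

definition C' where "C' y u \<zeta> = C y u \<zeta> + H y (e y) \<zeta> *\<^sub>R \<tau> y u - H y (\<tau> y u) \<zeta> *\<^sub>R e y"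

definition s where "s y u = sin (\<theta> y) * H y (\<ll> y u) (e y)"

lemma \<tau>_smooth: "smooth_on S (\<lambda>y. \<tau> y u)"
  unfolding \<tau>_def
  by (intro smooth_on_diff smooth_on_scaleR smooth_on_cos smooth_nab e_smooth \<ll>_smooth \<theta>_smooth open_S)

lemma s_smooth: "smooth_on S (\<lambda>y. s y u)"
  unfolding s_def by (intro smooth_on_mult smooth_on_sin smooth_H e_smooth \<ll>_smooth \<theta>_smooth open_S)

lemma \<alpha>_smooth: "smooth_on S (\<lambda>y. \<alpha> y u)"
  unfolding \<alpha>_def
  by (intro smooth_on_diff smooth_on_scaleR smooth_on_mult smooth_on_cos smooth_H smooth_nab e_smooth \<ll>_smooth \<theta>_smooth open_S)

lemma \<beta>_smooth: "smooth_on S (\<lambda>y. \<beta> y u)"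
  unfolding \<beta>_def
  by (intro smooth_on_add smooth_on_diff smooth_on_scaleR smooth_on_sin smooth_H smooth_on_dird
      e_smooth \<ll>_smooth \<theta>_smooth open_S)

lemma e_differentiable: "y \<in> S \<Longrightarrow> e differentiable (at y)"
  by (rule smooth_on_differentiable[OF e_smooth])

lemma \<theta>_differentiable: "y \<in> S \<Longrightarrow> \<theta> differentiable (at y)"
  by (rule smooth_on_differentiable[OF \<theta>_smooth])

lemma \<epsilon>_linear: "y \<in> S \<Longrightarrow> linear (\<epsilon> y)"
  by (rule nab_linear[OF _ e_differentiable])

lemma d\<theta>_linear: "y \<in> S \<Longrightarrow> linear (\<lambda>u. dird \<theta> y u)"
  using has_derivative_linear[OF has_derivative_dird[OF \<theta>_differentiable]] .

lemma frame_linear: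
  assumes "y \<in> S"
  shows "linear (\<tau> y)" "linear (\<alpha> y)" "linear (\<beta> y)" "linear (s y)"
proof -
  note l = linear_add[OF \<ll>_linear[OF assms]] linear_scale[OF \<ll>_linear[OF assms]]
    linear_add[OF \<epsilon>_linear[OF assms]] linear_scale[OF \<epsilon>_linear[OF assms]]
    linear_add[OF d\<theta>_linear[OF assms]] linear_scale[OF d\<theta>_linear[OF assms]]
  show "linear (\<tau> y)" "linear (\<alpha> y)" "linear (\<beta> y)" "linear (s y)"
    by (rule linearI; simp add: \<tau>_def \<alpha>_def \<beta>_def s_def l H_simps[OF assms] algebra_simps)+
qed

lemma \<epsilon>_orthogonal:
  assumes y: "y \<in> S"
  shows "H y (\<epsilon> y u) (e y) = 0" "H y (e y) (\<epsilon> y u) = 0"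
proof -
  have "dird (\<lambda>x. H x (e x) (e x)) y u = dird (\<lambda>x. 1) y u"
    by (rule dird_cong_open[OF open_S y smooth_on_differentiable[OF smooth_H[OF e_smooth e_smooth] y]])
       (rule e_unit)
  then have "H y (\<epsilon> y u) (e y) + H y (e y) (\<epsilon> y u) = 0"
    using dird_eqI[OF has_derivative_H[OF y e_differentiable[OF y] e_differentiable[OF y]]] by simp
  then show "H y (\<epsilon> y u) (e y) = 0" "H y (e y) (\<epsilon> y u) = 0"
    using H_sym[OF y, of "\<epsilon> y u" "e y"] by simp_all
qed

text \<open>The only way in which the curvature of the base enters the torsion: the second covariant
  derivatives of \<open>e\<close>.\<close>

lemma d\<epsilon>: "y \<in> S \<Longrightarrow> nab (\<lambda>x. \<epsilon> x v) y u - nab (\<lambda>x. \<epsilon> x u) y v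
    = H y (\<ll> y v) (e y) *\<^sub>R \<ll> y u - H y (\<ll> y u) (e y) *\<^sub>R \<ll> y v"
  using Ricci_identity[OF _ e_smooth] Rm_eq by simp

lemma dird_H:
  "y \<in> S \<Longrightarrow> smooth_on S \<zeta> \<Longrightarrow> smooth_on S \<eta> \<Longrightarrow> dird (\<lambda>x. H x (\<zeta> x) (\<eta> x)) y u =
    H y (nab \<zeta> y u) (\<eta> y) + H y (\<zeta> y) (nab \<eta> y u)"
  by (rule dird_eqI[OF has_derivative_H]) (auto intro: smooth_on_differentiable)

lemma dird_sin_cos:
  assumes "y \<in> S"
  shows "dird (\<lambda>x. sin (\<theta> x)) y u = cos (\<theta> y) * dird \<theta> y u"
    "dird (\<lambda>x. cos (\<theta> x)) y u = - sin (\<theta> y) * dird \<theta> y u"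
  by (rule dird_eqI, rule has_derivative_eq_rhs, rule has_derivative_sin has_derivative_cos,
      rule has_derivative_dird[OF \<theta>_differentiable[OF assms]], simp add: fun_eq_iff)+

lemma dird_mult:
  fixes f h :: "'v \<Rightarrow> real"
  assumes "y \<in> S" "smooth_on S f" "smooth_on S h"
  shows "dird (\<lambda>x. f x * h x) y u = f y * dird h y u + dird f y u * h y"
  by (rule dird_eqI[OF has_derivative_mult[OF assms(2,3)[THEN smooth_on_has_derivative, OF assms(1)]]])

lemma nab_smooth_rules:
  assumes "y \<in> S" "smooth_on S \<zeta>"
  shows "smooth_on S \<eta> \<Longrightarrow> nab (\<lambda>x. \<zeta> x + \<eta> x) y u = nab \<zeta> y u + nab \<eta> y u"
    "smooth_on S \<eta> \<Longrightarrow> nab (\<lambda>x. \<zeta> x - \<eta> x) y u = nab \<zeta> y u - nab \<eta> y u"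
    "smooth_on S f \<Longrightarrow> nab (\<lambda>x. f x *\<^sub>R \<zeta> x) y u = dird f y u *\<^sub>R \<zeta> y + f y *\<^sub>R nab \<zeta> y u"
  using assms by (auto intro!: nab_add nab_diff nab_scaleR smooth_on_differentiable)

lemmas smooth_rules = smooth_on_add[OF open_S] smooth_on_diff[OF open_S] smooth_on_scaleR[OF open_S]
  smooth_on_mult[OF open_S] smooth_on_sin[OF open_S] smooth_on_cos[OF open_S] smooth_H smooth_nab
  smooth_on_dird e_smooth \<ll>_smooth \<theta>_smooth \<tau>_smooth smooth_on_const[OF open_S] C_smooth

lemma nab_\<tau>:
  assumes y: "y \<in> S"
  shows "nab (\<lambda>x. \<tau> x v) y u = (- sin (\<theta> y) * dird \<theta> y u) *\<^sub>R \<ll> y v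
    + cos (\<theta> y) *\<^sub>R nab (\<lambda>x. \<ll> x v) y u - nab (\<lambda>x. \<epsilon> x v) y u"
  unfolding \<tau>_def
  by (simp add: nab_smooth_rules[OF y] smooth_rules dird_sin_cos[OF y])

lemma nab_\<alpha>:
  assumes y: "y \<in> S"
  shows "nab (\<lambda>x. \<alpha> x v) y u = nab (\<lambda>x. \<epsilon> x v) y u
    - ((- sin (\<theta> y) * dird \<theta> y u) * H y (\<ll> y v) (e y)
        + cos (\<theta> y) * (H y (nab (\<lambda>x. \<ll> x v) y u) (e y) + H y (\<ll> y v) (\<epsilon> y u))) *\<^sub>R e y
    - (cos (\<theta> y) * H y (\<ll> y v) (e y)) *\<^sub>R \<epsilon> y u"
  unfolding \<alpha>_def
  by (simp add: nab_smooth_rules[OF y] smooth_rules dird_sin_cos[OF y] dird_mult[OF y] dird_H[OF y]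
      algebra_simps)

lemma nab_\<beta>:
  assumes y: "y \<in> S"
  shows "nab (\<lambda>x. \<beta> x v) y u = (cos (\<theta> y) * dird \<theta> y u) *\<^sub>R (\<ll> y v - H y (\<ll> y v) (e y) *\<^sub>R e y)
    + sin (\<theta> y) *\<^sub>R (nab (\<lambda>x. \<ll> x v) y u
        - (H y (nab (\<lambda>x. \<ll> x v) y u) (e y) + H y (\<ll> y v) (\<epsilon> y u)) *\<^sub>R e y - H y (\<ll> y v) (e y) *\<^sub>R \<epsilon> y u)
    + dird (\<lambda>x. dird \<theta> x v) y u *\<^sub>R e y + dird \<theta> y v *\<^sub>R \<epsilon> y u"
  unfolding \<beta>_def
  by (simp add: nab_smooth_rules[OF y] smooth_rules dird_sin_cos[OF y] dird_mult[OF y] dird_H[OF y] algebra_simps)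

lemma dird_s:
  assumes y: "y \<in> S"
  shows "dird (\<lambda>x. s x v) y u = cos (\<theta> y) * dird \<theta> y u * H y (\<ll> y v) (e y)
    + sin (\<theta> y) * (H y (nab (\<lambda>x. \<ll> x v) y u) (e y) + H y (\<ll> y v) (\<epsilon> y u))"
  unfolding s_def
  by (simp add: smooth_rules dird_sin_cos[OF y] dird_mult[OF y] dird_H[OF y])

lemma d\<theta>_closed: "y \<in> S \<Longrightarrow> dird (\<lambda>x. dird \<theta> x v) y u = dird (\<lambda>x. dird \<theta> x u) y v"
  by (rule dird_dird_commute[OF open_S _ \<theta>_smooth])

lemma C'_linear_left: "y \<in> S \<Longrightarrow> linear (\<lambda>u. C' y u a)"
  unfolding C'_def
  by (rule linearI)
     (simp_all add: linear_add[OF frame_linear(1)] linear_scale[OF frame_linear(1)]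
       linear_add[OF C_linear_left] linear_scale[OF C_linear_left] H_simps algebra_simps)

lemma C'_linear: "y \<in> S \<Longrightarrow> linear (C' y u)"
  unfolding C'_def by (rule linearI) (simp_all add: C_simps H_simps algebra_simps)

lemma C'_smooth: "smooth_on S (\<lambda>y. C' y u a)"
  unfolding C'_def by (intro smooth_rules)

lemma C'_compatible: "y \<in> S \<Longrightarrow> dird (\<lambda>x. H x a b) y u = H y (C' y u a) b + H y a (C' y u b)"
  using H_sym[of y a] by (simp add: C'_def compatible H_simps algebra_simps)

sublocale N: metric_connection S H C'
  by (rule metric_connection.intro; (rule open_S H_smooth C'_smooth |
        (rule H_bilinear H_sym H_pos C'_linear_left C'_linear C'_compatible; assumption)))

lemma N_nab: "N.nab \<zeta> y u = nab \<zeta> y u + H y (e y) (\<zeta> y) *\<^sub>R \<tau> y u - H y (\<tau> y u) (\<zeta> y) *\<^sub>R e y"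
  by (simp add: N.nab_def nab_def C'_def)

text \<open>The soldering form \<open>(\<alpha>, \<beta>)\<close> has no torsion for the connection that acts by \<open>C'\<close> on both components and by
  the rotation \<open>s\<close> between them.  As the fibre metric is nondegenerate, it suffices to pair both
  sides with an arbitrary vector, which leaves a polynomial identity with \<open>cos\<^sup>2 + sin\<^sup>2 = 1\<close>.\<close>

lemma torsion_\<alpha>:
  assumes y: "y \<in> S"
  shows "N.nab (\<lambda>x. \<alpha> x v) y u + s y u *\<^sub>R \<beta> y v = N.nab (\<lambda>x. \<alpha> x u) y v + s y v *\<^sub>R \<beta> y u"
proof -
  have d: "nab (\<lambda>x. \<epsilon> x v) y u = nab (\<lambda>x. \<epsilon> x u) y v
    + H y (\<ll> y v) (e y) *\<^sub>R \<ll> y u - H y (\<ll> y u) (e y) *\<^sub>R \<ll> y v"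
    using d\<epsilon>[OF y, of v u] by (simp add: algebra_simps)
  have sc: "cos (\<theta> y) * cos (\<theta> y) = 1 - sin (\<theta> y) * sin (\<theta> y)"
    using sin_cos_squared_add[of "\<theta> y"] by (simp add: power2_eq_square)
  have sc': "cos (\<theta> y) * (cos (\<theta> y) * r) = r - sin (\<theta> y) * (sin (\<theta> y) * r)" for r
    unfolding mult.assoc[symmetric] sc by (simp add: algebra_simps)
  have sym: "H y (e y) (\<ll> y w) = H y (\<ll> y w) (e y)"
    "H y (\<epsilon> y w) (\<ll> y w') = H y (\<ll> y w') (\<epsilon> y w)" for w w'
    by (rule H_sym[OF y])+
  have "H y (N.nab (\<lambda>x. \<alpha> x v) y u + s y u *\<^sub>R \<beta> y v) z
      = H y (N.nab (\<lambda>x. \<alpha> x u) y v + s y v *\<^sub>R \<beta> y u) z" for z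
  proof -
    show ?thesis
      unfolding N_nab nab_\<alpha>[OF y] unfolding s_def \<alpha>_def \<beta>_def \<tau>_def \<ll>_torsion_free[OF y, of v u] d
      apply (simp only: H_simps[OF y] sym \<epsilon>_orthogonal[OF y] e_unit[OF y])
      using H_sym[OF y, of "\<epsilon> y u" "\<epsilon> y v"] H_sym[OF y, of "\<ll> y u" "\<ll> y v"] by (simp add: algebra_simps sc sc')
  qed
  then show ?thesis by (rule H_nondegenerate[OF y])
qed

lemma torsion_\<beta>:
  assumes y: "y \<in> S"
  shows "N.nab (\<lambda>x. \<beta> x v) y u - s y u *\<^sub>R \<alpha> y v = N.nab (\<lambda>x. \<beta> x u) y v - s y v *\<^sub>R \<alpha> y u"
proof -
  have sym: "H y (e y) (\<ll> y w) = H y (\<ll> y w) (e y)"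
    "H y (\<epsilon> y w) (\<ll> y w') = H y (\<ll> y w') (\<epsilon> y w)" for w w'
    by (rule H_sym[OF y])+
  have "H y (N.nab (\<lambda>x. \<beta> x v) y u - s y u *\<^sub>R \<alpha> y v) z
      = H y (N.nab (\<lambda>x. \<beta> x u) y v - s y v *\<^sub>R \<alpha> y u) z" for z
      unfolding N_nab nab_\<beta>[OF y] unfolding s_def \<alpha>_def \<beta>_def \<tau>_def \<ll>_torsion_free[OF y, of v u] d\<theta>_closed[OF y, of v u]
      apply (simp only: H_simps[OF y] sym \<epsilon>_orthogonal[OF y] e_unit[OF y])
      using H_sym[OF y, of "\<epsilon> y u" "\<epsilon> y v"] H_sym[OF y, of "\<ll> y u" "\<ll> y v"] by (simp add: algebra_simps)
  then show ?thesis by (rule H_nondegenerate[OF y])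
qed

text \<open>The Gauss equation for the tautological plane bundle.\<close>

lemma ds_eq:
  assumes y: "y \<in> S"
  shows "dird (\<lambda>x. s x v) y u - dird (\<lambda>x. s x u) y v = H y (\<alpha> y u) (\<beta> y v) - H y (\<alpha> y v) (\<beta> y u)"
proof -
  have sym: "H y (e y) (\<ll> y w) = H y (\<ll> y w) (e y)"
    "H y (\<epsilon> y w) (\<ll> y w') = H y (\<ll> y w') (\<epsilon> y w)" for w w'
    by (rule H_sym[OF y])+
  show ?thesis
    unfolding dird_s[OF y] unfolding \<alpha>_def \<beta>_def \<ll>_torsion_free[OF y, of v u]
    apply (simp only: H_simps[OF y] sym \<epsilon>_orthogonal[OF y] e_unit[OF y])
    using H_sym[OF y, of "\<epsilon> y u" "\<epsilon> y v"] H_sym[OF y, of "\<ll> y u" "\<ll> y v"] by (simp add: algebra_simps)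
qed

text \<open>The Gauss equation for the normal bundle: the ambient bundle is flat, so its curvature is
  quadratic in the second fundamental form \<open>(\<alpha>, \<beta>)\<close>.\<close>

lemma N_Rm_eq:
  assumes y: "y \<in> S"
  shows "N.Rm y u v \<zeta> = H y (\<alpha> y v) \<zeta> *\<^sub>R \<alpha> y u - H y (\<alpha> y u) \<zeta> *\<^sub>R \<alpha> y v
    + H y (\<beta> y v) \<zeta> *\<^sub>R \<beta> y u - H y (\<beta> y u) \<zeta> *\<^sub>R \<beta> y v"
proof -
  have d: "nab (\<lambda>x. \<epsilon> x v) y u = nab (\<lambda>x. \<epsilon> x u) y v
    + H y (\<ll> y v) (e y) *\<^sub>R \<ll> y u - H y (\<ll> y u) (e y) *\<^sub>R \<ll> y v"
    using d\<epsilon>[OF y, of v u] by (simp add: algebra_simps)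
  have R: "nab (\<lambda>x. C x v \<zeta>) y u = nab (\<lambda>x. C x u \<zeta>) y v
    + H y (\<ll> y v) \<zeta> *\<^sub>R \<ll> y u - H y (\<ll> y u) \<zeta> *\<^sub>R \<ll> y v"
    using Rm_eq[OF y, of u v \<zeta>] by (simp add: Rm_eq_nab[OF y] algebra_simps)
  have sc: "cos (\<theta> y) * cos (\<theta> y) = 1 - sin (\<theta> y) * sin (\<theta> y)"
    using sin_cos_squared_add[of "\<theta> y"] by (simp add: power2_eq_square)
  have sc': "cos (\<theta> y) * (cos (\<theta> y) * r) = r - sin (\<theta> y) * (sin (\<theta> y) * r)" for r
    unfolding mult.assoc[symmetric] sc by (simp add: algebra_simps)
  have sym: "H y (e y) (\<ll> y w) = H y (\<ll> y w) (e y)"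
    "H y (\<epsilon> y w) (\<ll> y w') = H y (\<ll> y w') (\<epsilon> y w)" for w w'
    by (rule H_sym[OF y])+
  have dC: "nab (\<lambda>x. C' x v \<zeta>) y u = nab (\<lambda>x. C x v \<zeta>) y u
     + ((H y (\<epsilon> y u) \<zeta> + H y (e y) (C y u \<zeta>)) *\<^sub>R \<tau> y v + H y (e y) \<zeta> *\<^sub>R nab (\<lambda>x. \<tau> x v) y u)
     - ((H y (nab (\<lambda>x. \<tau> x v) y u) \<zeta> + H y (\<tau> y v) (C y u \<zeta>)) *\<^sub>R e y + H y (\<tau> y v) \<zeta> *\<^sub>R \<epsilon> y u)" for u v
    unfolding C'_def
    by (simp add: nab_smooth_rules[OF y] smooth_rules dird_H[OF y] nab_const)
  have "H y (N.Rm y u v \<zeta>) z = H y (H y (\<alpha> y v) \<zeta> *\<^sub>R \<alpha> y u - H y (\<alpha> y u) \<zeta> *\<^sub>R \<alpha> y v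
    + H y (\<beta> y v) \<zeta> *\<^sub>R \<beta> y u - H y (\<beta> y u) \<zeta> *\<^sub>R \<beta> y v) z" for z
    unfolding N.Rm_eq_nab[OF y] N_nab dC nab_\<tau>[OF y]
    unfolding R d \<ll>_torsion_free[OF y, of v u] C'_def \<alpha>_def \<beta>_def \<tau>_def
    apply (simp only: H_simps[OF y] sym \<epsilon>_orthogonal[OF y] e_unit[OF y])
    using H_sym[OF y, of "\<epsilon> y u" "\<epsilon> y v"] H_sym[OF y, of "\<ll> y u" "\<ll> y v"] by (simp add: algebra_simps sc sc')
  then show ?thesis by (rule H_nondegenerate[OF y])
qed


subsection \<open>The complex bundle\<close>

text \<open>The tangent space of the quadric consists of the pairs of normal vectors, the images of the two basis
  vectors of the plane; the complex structure is the rotation of the plane.\<close>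

definition H2 :: "'v \<Rightarrow> 'f \<times> 'f \<Rightarrow> 'f \<times> 'f \<Rightarrow> real" where
  "H2 y a b = \<kappa> * (H y (fst a) (fst b) + H y (snd a) (snd b))"

definition C2 :: "'v \<Rightarrow> 'v \<Rightarrow> 'f \<times> 'f \<Rightarrow> 'f \<times> 'f" where
  "C2 y u a = (C' y u (fst a) + s y u *\<^sub>R snd a, C' y u (snd a) - s y u *\<^sub>R fst a)"

definition \<sigma> :: "'v \<Rightarrow> 'v \<Rightarrow> 'f \<times> 'f" where "\<sigma> y u = (\<alpha> y u, \<beta> y u)"

sublocale F: metric_connection S H2 C2
proof (rule metric_connection.intro)
  fix y a b u assume y: "y \<in> S"
  show "bilinear (H2 y)"
    unfolding bilinear_def H2_def by (auto intro!: linearI simp: H_simps[OF y] algebra_simps)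
  show "H2 y a b = H2 y b a"
    unfolding H2_def using H_sym[OF y] by metis
  show "linear (\<lambda>u. C2 y u a)"
    unfolding C2_def by (rule linearI)
      (simp_all add: linear_add[OF N.C_linear_left[OF y]] linear_scale[OF N.C_linear_left[OF y]]
        linear_add[OF frame_linear(4)[OF y]] linear_scale[OF frame_linear(4)[OF y]] algebra_simps)
  show "linear (C2 y u)"
    unfolding C2_def by (rule linearI) (simp_all add: N.C_simps[OF y] algebra_simps)
  show "H2 y a a > 0" if "a \<noteq> 0"
  proof -
    have nn: "H y c c \<ge> 0" for c using H_pos[OF y, of c] H_simps(5)[OF y] by (cases "c = 0") (auto simp: less_imp_le)
    have "fst a \<noteq> 0 \<or> snd a \<noteq> 0" using that by (simp add: prod_eq_iff)
    then have "H y (fst a) (fst a) + H y (snd a) (snd a) > 0"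
      using H_pos[OF y] nn add_pos_nonneg add_nonneg_pos by metis
    then show ?thesis unfolding H2_def using \<kappa>_pos by simp
  qed
  have "((\<lambda>x. \<kappa> * (H x (fst a) (fst b) + H x (snd a) (snd b))) has_derivative
     (\<lambda>u. \<kappa> * (dird (\<lambda>x. H x (fst a) (fst b)) y u + dird (\<lambda>x. H x (snd a) (snd b)) y u))) (at y)"
    by (intro has_derivative_mult_right has_derivative_add smooth_on_has_derivative[OF H_smooth y])
  from dird_eqI[OF this] show "dird (\<lambda>x. H2 x a b) y u = H2 y (C2 y u a) b + H2 y a (C2 y u b)"
    using H_sym[OF y, of "fst b"]
    by (simp add: H2_def C2_def N.compatible[OF y] H_simps[OF y] algebra_simps)
next
  fix a b u
  show "smooth_on S (\<lambda>y. H2 y a b)"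
    unfolding H2_def by (intro smooth_on_mult smooth_on_add smooth_on_const H_smooth open_S)
  show "smooth_on S (\<lambda>y. C2 y u a)"
    unfolding C2_def
    by (intro smooth_on_Pair smooth_on_add smooth_on_diff smooth_on_scaleR smooth_on_const N.C_smooth s_smooth open_S)
qed (rule open_S)

lemma F_nab:
  assumes "y \<in> S" "\<zeta> differentiable (at y)" "\<eta> differentiable (at y)"
  shows "F.nab (\<lambda>x. (\<zeta> x, \<eta> x)) y u
    = (N.nab \<zeta> y u + s y u *\<^sub>R \<eta> y, N.nab \<eta> y u - s y u *\<^sub>R \<zeta> y)"
  using dird_eqI[OF has_derivative_Pair[OF assms(2,3)[THEN has_derivative_dird]]]
  by (simp add: F.nab_def N.nab_def C2_def)

text \<open>The curvature tensor of the complex quadric, as a function of two tangent vectors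
  \<open>a = (a\<^sub>1, a\<^sub>2)\<close> and \<open>b = (b\<^sub>1, b\<^sub>2)\<close>: the skew map \<open>a\<^sub>1 \<and> b\<^sub>1 + a\<^sub>2 \<and> b\<^sub>2\<close> in both components and a rotation
  between the components by the symplectic product.\<close>

definition Q :: "'v \<Rightarrow> 'f \<times> 'f \<Rightarrow> 'f \<times> 'f \<Rightarrow> 'f \<times> 'f \<Rightarrow> 'f \<times> 'f" where
  "Q y a b \<zeta> =
    (let R = \<lambda>c. H y (fst b) c *\<^sub>R fst a - H y (fst a) c *\<^sub>R fst b + H y (snd b) c *\<^sub>R snd a - H y (snd a) c *\<^sub>R snd b;
         r = H y (fst a) (snd b) - H y (fst b) (snd a)
     in (R (fst \<zeta>) + r *\<^sub>R snd \<zeta>, R (snd \<zeta>) - r *\<^sub>R fst \<zeta>))"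

lemma F_Rm_eq:
  assumes y: "y \<in> S"
  shows "F.Rm y u v \<zeta> = Q y (\<sigma> y u) (\<sigma> y v) \<zeta>"
proof -
  have s: "smooth_on S (\<lambda>x. C' x v a + s x v *\<^sub>R b)" "smooth_on S (\<lambda>x. C' x v a - s x v *\<^sub>R b)" for v a b
    by (intro smooth_rules N.C_smooth s_smooth)+
  have C2: "(\<lambda>x. C2 x v \<zeta>) = (\<lambda>x. (C' x v (fst \<zeta>) + s x v *\<^sub>R snd \<zeta>, C' x v (snd \<zeta>) - s x v *\<^sub>R fst \<zeta>))" for v
    by (simp add: C2_def fun_eq_iff)
  have "F.nab (\<lambda>x. C2 x v \<zeta>) y u =
    (N.nab (\<lambda>x. C' x v (fst \<zeta>)) y u + dird (\<lambda>x. s x v) y u *\<^sub>R snd \<zeta> + s y v *\<^sub>R C' y u (snd \<zeta>)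
      + s y u *\<^sub>R (C' y v (snd \<zeta>) - s y v *\<^sub>R fst \<zeta>),
     N.nab (\<lambda>x. C' x v (snd \<zeta>)) y u - dird (\<lambda>x. s x v) y u *\<^sub>R fst \<zeta> - s y v *\<^sub>R C' y u (fst \<zeta>)
      - s y u *\<^sub>R (C' y v (fst \<zeta>) + s y v *\<^sub>R snd \<zeta>))" for u v
    unfolding C2
    by (subst F_nab[OF y smooth_on_differentiable[OF s(1) y] smooth_on_differentiable[OF s(2) y]])
       (simp add: N.nab_add[OF y] N.nab_diff[OF y] N.nab_scaleR[OF y] N.nab_const
        smooth_on_differentiable[OF N.C_smooth y] smooth_on_differentiable[OF s_smooth y]
        smooth_on_differentiable[OF smooth_on_scaleR[OF open_S s_smooth smooth_on_const[OF open_S]] y])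
  then have "F.Rm y u v \<zeta> =
     (N.Rm y u v (fst \<zeta>) + (dird (\<lambda>x. s x v) y u - dird (\<lambda>x. s x u) y v) *\<^sub>R snd \<zeta>,
      N.Rm y u v (snd \<zeta>) - (dird (\<lambda>x. s x v) y u - dird (\<lambda>x. s x u) y v) *\<^sub>R fst \<zeta>)"
    by (simp add: F.Rm_eq_nab[OF y] N.Rm_eq_nab[OF y] algebra_simps)
  then show ?thesis
    unfolding N_Rm_eq[OF y] ds_eq[OF y] by (simp add: Q_def \<sigma>_def Let_def)
qed

lemma N_nab_H_scaleR:
  assumes "y \<in> S" "smooth_on S a" "smooth_on S b" "smooth_on S c"
  shows "N.nab (\<lambda>x. H x (a x) (b x) *\<^sub>R c x) y u
    = (H y (N.nab a y u) (b y) + H y (a y) (N.nab b y u)) *\<^sub>R c y + H y (a y) (b y) *\<^sub>R N.nab c y u"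
  using assms N.nab_scaleR[OF assms(1), of "\<lambda>x. H x (a x) (b x)" c]
  by (simp add: smooth_on_differentiable[OF smooth_H] smooth_on_differentiable
      dird_eqI[OF N.has_derivative_H])

text \<open>\<open>Q\<close> is built from the fibre metric alone, hence parallel for the normal connection, and it is invariant
  under simultaneous rotations of the two components, hence insensitive to \<open>s\<close>.\<close>

lemma Q_parallel:
  assumes y: "y \<in> S" and sm: "smooth_on S a" "smooth_on S b" "smooth_on S \<zeta>"
  shows "F.nab (\<lambda>x. Q x (a x) (b x) (\<zeta> x)) y u =
      Q y (F.nab a y u) (b y) (\<zeta> y) + Q y (a y) (F.nab b y u) (\<zeta> y) + Q y (a y) (b y) (F.nab \<zeta> y u)"
proof -
  have fs: "smooth_on S (\<lambda>x. fst (f x))" "smooth_on S (\<lambda>x. snd (f x))" if "smooth_on S f" for f :: "'v \<Rightarrow> 'f \<times> 'f"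
    by (rule smooth_on_bounded_linear[OF open_S bounded_linear_fst that]
        smooth_on_bounded_linear[OF open_S bounded_linear_snd that])+
  note sms = fs[OF sm(1)] fs[OF sm(2)] fs[OF sm(3)]
  have F: "F.nab f y u = (N.nab (\<lambda>x. fst (f x)) y u + s y u *\<^sub>R snd (f y), N.nab (\<lambda>x. snd (f x)) y u - s y u *\<^sub>R fst (f y))"
    if "smooth_on S f" for f
    using F_nab[OF y smooth_on_differentiable[OF fs(1)[OF that] y] smooth_on_differentiable[OF fs(2)[OF that] y], of u]
    by simp
  note rules = smooth_on_add[OF open_S] smooth_on_diff[OF open_S] smooth_on_scaleR[OF open_S] smooth_H sms
  have N: "smooth_on S \<zeta> \<Longrightarrow> smooth_on S \<eta> \<Longrightarrow> N.nab (\<lambda>x. \<zeta> x + \<eta> x) y u = N.nab \<zeta> y u + N.nab \<eta> y u"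
    "smooth_on S \<zeta> \<Longrightarrow> smooth_on S \<eta> \<Longrightarrow> N.nab (\<lambda>x. \<zeta> x - \<eta> x) y u = N.nab \<zeta> y u - N.nab \<eta> y u" for \<zeta> \<eta>
    using y by (auto intro!: N.nab_add N.nab_diff smooth_on_differentiable)
  have Qs: "smooth_on S (\<lambda>x. Q x (a x) (b x) (\<zeta> x))"
    unfolding Q_def Let_def by (intro smooth_on_Pair open_S rules)
  show ?thesis
    unfolding F[OF Qs] F[OF sm(1)] F[OF sm(2)] F[OF sm(3)]
    using H_sym[OF y, of "snd (a y)" "fst (b y)"] H_sym[OF y, of "fst (a y)" "snd (b y)"]
      H_sym[OF y, of "snd (a y)" "snd (b y)"] H_sym[OF y, of "fst (a y)" "fst (b y)"]
      H_sym[OF y, of "N.nab (\<lambda>x. snd (a x)) y u"] H_sym[OF y, of "N.nab (\<lambda>x. fst (b x)) y u"]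
    by (simp add: Q_def Let_def N rules N_nab_H_scaleR[OF y] scaleR_diff_left H_simps[OF y] algebra_simps)
qed

lemma Q_linear: "y \<in> S \<Longrightarrow> linear (\<lambda>c. Q y c b a)"
  by (rule linearI) (simp_all add: Q_def Let_def H_simps algebra_simps)

lemma Q_trace:
  assumes y: "y \<in> S"
  shows "(\<Sum>c\<in>Basis. Q y c b a \<bullet> c) = DIM('f) / \<kappa> * H2 y b a"
proof -
  have tr: "(\<Sum>i\<in>(Basis::'f set). (z \<bullet> i) * H y i x) = H y z x" for x z
    using linear_family_expand[of "\<lambda>_ i. H y i x", OF H_linear_left[OF y], of z]
    by (simp add: mult.commute)
  have "(\<Sum>c\<in>Basis. Q y c b a \<bullet> c) =
     (\<Sum>i\<in>(Basis::'f set). H y (fst b) (fst a) - H y i (fst a) * (fst b \<bullet> i) + H y i (snd b) * (snd a \<bullet> i))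
   + (\<Sum>i\<in>(Basis::'f set). H y (snd b) (snd a) - H y i (snd a) * (snd b \<bullet> i) + H y i (fst b) * (fst a \<bullet> i))"
    unfolding sum_Basis_prod_split
    using H_sym[OF y, of "fst b"]
    by (simp add: Q_def Let_def H_simps[OF y] inner_diff_left inner_add_left algebra_simps)
  also have "\<dots> = DIM('f) * (H y (fst b) (fst a) + H y (snd b) (snd a))"
    using H_sym[OF y, of "fst a" "fst b"] H_sym[OF y, of "snd a" "snd b"]
    by (simp add: sum.distrib sum_subtractf mult.commute[of "H y _ _"] tr)
       (simp add: algebra_simps)
  also have "\<dots> = DIM('f) / \<kappa> * H2 y b a"
    unfolding H2_def using \<kappa>_pos by simp
  finally show ?thesis .
qed

end


text \<open>\<open>(G, J)\<close> is locally the pull-back, up to the factor \<open>\<kappa>\<close>, of the Kaehler structure of the quadric.\<close>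

locale soldered_quadric = quadric_soldering S H C \<ll> e \<theta> \<kappa>
  for S :: "'v::euclidean_space set"
    and H :: "'v \<Rightarrow> 'f::euclidean_space \<Rightarrow> 'f \<Rightarrow> real"
    and C :: "'v \<Rightarrow> 'v \<Rightarrow> 'f \<Rightarrow> 'f"
    and \<ll> :: "'v \<Rightarrow> 'v \<Rightarrow> 'f" and e :: "'v \<Rightarrow> 'f" and \<theta> :: "'v \<Rightarrow> real" and \<kappa> :: real +
  fixes G :: "'v \<Rightarrow> 'v \<Rightarrow> 'v \<Rightarrow> real" and J :: "'v \<Rightarrow> 'v \<Rightarrow> 'v"
  assumes dim: "DIM('v) = 2 * DIM('f)"
    and inj: "y \<in> S \<Longrightarrow> \<alpha> y u = 0 \<Longrightarrow> \<beta> y u = 0 \<Longrightarrow> u = 0"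
    and G: "y \<in> S \<Longrightarrow> G y u v = \<kappa> * (H y (\<alpha> y u) (\<alpha> y v) + H y (\<beta> y u) (\<beta> y v))"
    and J: "y \<in> S \<Longrightarrow> \<alpha> y (J y u) = \<beta> y u" "y \<in> S \<Longrightarrow> \<beta> y (J y u) = - \<alpha> y u"

theorem (in soldered_quadric) quadric_structure:
  shows quadric_metric: "y \<in> S \<Longrightarrow> bilinear (G y)" "y \<in> S \<Longrightarrow> G y u v = G y v u"
      "y \<in> S \<Longrightarrow> u \<noteq> 0 \<Longrightarrow> G y u u > 0" "smooth_on S (\<lambda>y. G y u v)"
    and quadric_complex: "y \<in> S \<Longrightarrow> linear (J y)" "smooth_on S (\<lambda>y. J y u)"
      "y \<in> S \<Longrightarrow> J y (J y u) = - u" "y \<in> S \<Longrightarrow> nijenhuis J y u v = 0"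
    and quadric_kaehler: "y \<in> S \<Longrightarrow> G y (J y u) (J y v) = G y u v"
      "y \<in> S \<Longrightarrow> ext_deriv (\<lambda>x a b. G x a (J x b)) y u v w = 0"
    and quadric_symmetric: "y \<in> S \<Longrightarrow> nabla_curvature G y z u v w = 0"
    and quadric_einstein: "y \<in> S \<Longrightarrow> ricci G y v w = DIM('f) / \<kappa> * G y v w"
proof -
  define j :: "'f \<times> 'f \<Rightarrow> 'f \<times> 'f" where "j a = (snd a, - fst a)" for a
  have \<sigma>_linear: "linear (\<sigma> y)" if "y \<in> S" for y
    unfolding \<sigma>_def by (rule linearI)
      (simp_all add: linear_add[OF frame_linear(2)[OF that]] linear_scale[OF frame_linear(2)[OF that]]
        linear_add[OF frame_linear(3)[OF that]] linear_scale[OF frame_linear(3)[OF that]])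
  interpret soldered_complex_bundle S H2 C2 \<sigma> G j J
  proof (rule soldered_complex_bundle.intro[OF soldered_bundle.intro[OF F.metric_connection_axioms]])
    show "soldered_bundle_axioms S H2 C2 \<sigma> G"
    proof (rule soldered_bundle_axioms.intro)
      fix y assume y: "y \<in> S"
      show "linear (\<sigma> y)" by (rule \<sigma>_linear[OF y])
      show "inj (\<sigma> y)"
        using inj[OF y] by (subst linear_injective_0[OF \<sigma>_linear[OF y]]) (simp add: \<sigma>_def zero_prod_def)
      show "G y u v = H2 y (\<sigma> y u) (\<sigma> y v)" for u v
        by (simp add: G[OF y] H2_def \<sigma>_def)
      show "F.nab (\<lambda>x. \<sigma> x v) y u = F.nab (\<lambda>x. \<sigma> x u) y v" for u v
        unfolding \<sigma>_def
        using torsion_\<alpha>[OF y, of v u] torsion_\<beta>[OF y, of v u]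
        by (simp add: F_nab[OF y] smooth_on_differentiable[OF \<alpha>_smooth y] smooth_on_differentiable[OF \<beta>_smooth y])
    next
      show "DIM('v) = DIM('f \<times> 'f)" using dim by simp
      show "smooth_on S (\<lambda>y. \<sigma> y u)" for u
        unfolding \<sigma>_def by (rule smooth_on_Pair[OF open_S \<alpha>_smooth \<beta>_smooth])
    qed
    show "soldered_complex_bundle_axioms S H2 C2 \<sigma> j J"
    proof (rule soldered_complex_bundle_axioms.intro)
      show "linear j" by (rule linearI) (simp_all add: j_def)
      show "j (j a) = - a" for a by (simp add: j_def prod_eq_iff)
      fix y assume y: "y \<in> S"
      show "H2 y (j a) (j b) = H2 y a b" for a b by (simp add: H2_def j_def H_simps[OF y])
      show "C2 y u (j a) = j (C2 y u a)" for u a by (simp add: C2_def j_def N.C_simps[OF y])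
      show "\<sigma> y (J y u) = j (\<sigma> y u)" for u by (simp add: \<sigma>_def j_def J[OF y])
    qed
  qed
  show "bilinear (G y)" if "y \<in> S"
    unfolding bilinear_def
    by (intro conjI allI linearI)
       (simp_all add: G_eq[OF that] linear_add[OF \<sigma>_linear[OF that]] linear_scale[OF \<sigma>_linear[OF that]]
         F.H_simps[OF that])
  show "G y u v = G y v u" if "y \<in> S"
    by (simp add: G_eq[OF that] F.H_sym[OF that])
  show "G y u u > 0" if "y \<in> S" "u \<noteq> 0"
    unfolding G_eq[OF that(1)]
    by (rule F.H_pos[OF that(1)]) (use inj[OF that(1)] that(2) in \<open>auto simp: \<sigma>_def zero_prod_def\<close>)
  show "smooth_on S (\<lambda>y. G y u v)" by (rule G_smooth)
  show "linear (J y)" if "y \<in> S"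
  proof (rule linearI)
    note lin = linear_add[OF \<sigma>_linear[OF that]] linear_scale[OF \<sigma>_linear[OF that]]
      linear_add[OF j_linear] linear_scale[OF j_linear]
    show "J y (a + b) = J y a + J y b" "J y (r *\<^sub>R a) = r *\<^sub>R J y a" for a b r
      by (rule \<sigma>_eqD[OF that]; simp add: J_solder[OF that] lin)+
  qed
  show "smooth_on S (\<lambda>y. J y u)" by (rule J_smooth)
  show "J y (J y u) = - u" if "y \<in> S" by (rule J_J[OF that])
  show "nijenhuis J y u v = 0" if "y \<in> S" by (rule nijenhuis_zero[OF that])
  show "G y (J y u) (J y v) = G y u v" if "y \<in> S" by (rule J_isometry[OF that])
  show "ext_deriv (\<lambda>x a b. G x a (J x b)) y u v w = 0" if "y \<in> S" by (rule kaehler_form_closed[OF that])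
  show "nabla_curvature G y z u v w = 0" if "y \<in> S"
    by (rule nabla_curvature_zero[where Q = Q, OF that F_Rm_eq Q_parallel[OF that]])
  show "ricci G y v w = DIM('f) / \<kappa> * G y v w" if "y \<in> S"
    using ricci_solder[where Q = "Q y", OF that F_Rm_eq[OF that] Q_linear[OF that]] Q_trace[OF that]
    by (simp add: G_eq[OF that])
qed


section \<open>Riemannian metrics in a chart\<close>

text \<open>The musical isomorphism, realised as the linear system with the Gram matrix, so that its solutions
  depend smoothly on the metric.\<close>

lemma riesz_form:
  fixes h :: "'a::euclidean_space \<Rightarrow> 'a \<Rightarrow> real"
  assumes h: "bilinear h" "\<And>a. a \<noteq> 0 \<Longrightarrow> h a a > 0"
  shows "linear (\<lambda>z. \<Sum>b\<in>Basis. h z b *\<^sub>R b)" "inj (\<lambda>z. \<Sum>b\<in>Basis. h z b *\<^sub>R b)"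
    and "linear L \<Longrightarrow> \<exists>z. \<forall>w. h z w = L w"
proof -
  let ?f = "\<lambda>z. \<Sum>b\<in>Basis. h z b *\<^sub>R b"
  have ll: "linear (\<lambda>z. h z b)" "linear (h z)" for b z using h(1) by (simp_all add: bilinear_def)
  show lin: "linear ?f"
    by (rule linearI) (simp_all add: linear_add[OF ll(1)] linear_scale[OF ll(1)] scaleR_add_left sum.distrib scaleR_sum_right)
  have fb: "(\<Sum>b\<in>Basis. k b *\<^sub>R b) \<bullet> b' = k b'" if "b' \<in> Basis" for k :: "'a \<Rightarrow> real" and b'
    using that by (rule inner_sum_left_Basis)
  show inj: "inj ?f"
  proof (subst linear_injective_0[OF lin], intro allI impI)
    fix z assume "?f z = 0"
    then have "h z b = 0" if "b \<in> Basis" for b using fb[OF that, of "h z"] by simp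
    then have "h z = (\<lambda>_. 0)"
      by (rule linear_eq_stdbasis[OF ll(2) bounded_linear.linear[OF bounded_linear_zero]])
    then have "h z z = 0" by simp
    then show "z = 0" using h(2)[of z] by (cases "z = 0") simp_all
  qed
  show "\<exists>z. \<forall>w. h z w = L w" if L: "linear L"
  proof -
    obtain z where z: "(\<Sum>b\<in>Basis. L b *\<^sub>R b) = ?f z"
      using surjD[OF linear_injective_imp_surjective[OF lin inj]] by blast
    have "h z b = L b" if "b \<in> Basis" for b
      using fb[OF that, of "h z"] fb[OF that, of L] z by simp
    then have "h z = L" by (rule linear_eq_stdbasis[OF ll(2) L])
    then show ?thesis by auto
  qed
qed

lemma smooth_on_riesz:
  fixes H :: "'v::real_normed_vector \<Rightarrow> 'a::euclidean_space \<Rightarrow> 'a \<Rightarrow> real"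
  assumes S: "open S" and H: "\<And>y. y \<in> S \<Longrightarrow> bilinear (H y)" "\<And>y a. y \<in> S \<Longrightarrow> a \<noteq> 0 \<Longrightarrow> H y a a > 0"
      "\<And>a b. smooth_on S (\<lambda>y. H y a b)"
    and X: "\<And>y w. y \<in> S \<Longrightarrow> H y (X y) w = L y w" and L: "\<And>w. smooth_on S (\<lambda>y. L y w)"
  shows "smooth_on S X"
proof (rule smooth_on_linear_system_solution[where f = "\<lambda>y z. \<Sum>b\<in>Basis. H y z b *\<^sub>R b"
      and h = "\<lambda>y. \<Sum>b\<in>Basis. L y b *\<^sub>R b" and X = X, OF S])
  show "linear (\<lambda>z. \<Sum>b\<in>Basis. H x z b *\<^sub>R b)" "inj (\<lambda>z. \<Sum>b\<in>Basis. H x z b *\<^sub>R b)" if "x \<in> S" for x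
    by (rule riesz_form[where h = "H x", OF H(1)[OF that] H(2)[OF that]]; assumption)+
  show "smooth_on S (\<lambda>x. \<Sum>b\<in>Basis. H x a b *\<^sub>R b)" for a
    by (rule smooth_on_sum[OF S], rule smooth_on_scaleR[OF S H(3) smooth_on_const[OF S]])
  show "smooth_on S (\<lambda>x. \<Sum>b\<in>Basis. L x b *\<^sub>R b)"
    by (rule smooth_on_sum[OF S], rule smooth_on_scaleR[OF S L smooth_on_const[OF S]])
  show "(\<Sum>b\<in>Basis. H x (X x) b *\<^sub>R b) = (\<Sum>b\<in>Basis. L x b *\<^sub>R b)" if "x \<in> S" for x
    by (simp add: X[OF that])
qed

text \<open>The tangent bundle of a chart, with \<open>\<sigma>\<close> the identity, is a soldered bundle; its curvature is then
  the curvature of the metric.\<close>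

locale riemannian_chart =
  fixes U :: "'e::euclidean_space set" and g :: "'e \<Rightarrow> 'e \<Rightarrow> 'e \<Rightarrow> real"
  assumes open_U: "open U"
    and g_bilinear: "y \<in> U \<Longrightarrow> bilinear (g y)"
    and g_sym: "y \<in> U \<Longrightarrow> g y u v = g y v u"
    and g_pos: "y \<in> U \<Longrightarrow> u \<noteq> 0 \<Longrightarrow> g y u u > 0"
    and g_smooth: "smooth_on U (\<lambda>y. g y u v)"
begin

abbreviation \<Gamma> where "\<Gamma> \<equiv> christoffel g"

lemma g_linear: "y \<in> U \<Longrightarrow> linear (\<lambda>u. g y u v)" "y \<in> U \<Longrightarrow> linear (g y u)"
  using g_bilinear[of y] by (simp_all add: bilinear_def)

lemma g_simps:
  assumes "y \<in> U"
  shows "g y (a + a') b = g y a b + g y a' b" "g y (a - a') b = g y a b - g y a' b"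
    "g y (- a) b = - g y a b" "g y (r *\<^sub>R a) b = r * g y a b" "g y 0 b = 0"
    "g y b (a + a') = g y b a + g y b a'" "g y b (a - a') = g y b a - g y b a'"
    "g y b (- a) = - g y b a" "g y b (r *\<^sub>R a) = r * g y b a" "g y b 0 = 0"
  using linear_add[OF g_linear(1)[OF assms]] linear_diff[OF g_linear(1)[OF assms]]
    linear_neg[OF g_linear(1)[OF assms]] linear_scale[OF g_linear(1)[OF assms]]
    linear_0[OF g_linear(1)[OF assms]]
    linear_add[OF g_linear(2)[OF assms]] linear_diff[OF g_linear(2)[OF assms]]
    linear_neg[OF g_linear(2)[OF assms]] linear_scale[OF g_linear(2)[OF assms]]
    linear_0[OF g_linear(2)[OF assms]]
  by simp_all

lemma g_nondegenerate:
  assumes "y \<in> U" "\<And>w. g y a w = g y b w"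
  shows "a = b"
proof (rule ccontr)
  assume "a \<noteq> b"
  then have "g y (a - b) (a - b) > 0" by (intro g_pos assms(1)) simp
  then show False using assms by (simp add: g_simps)
qed

lemma dg_simps:
  assumes y: "y \<in> U"
  shows "dird (\<lambda>x. g x (u + u') v) y w = dird (\<lambda>x. g x u v) y w + dird (\<lambda>x. g x u' v) y w"
    "dird (\<lambda>x. g x v (u + u')) y w = dird (\<lambda>x. g x v u) y w + dird (\<lambda>x. g x v u') y w"
    "dird (\<lambda>x. g x (r *\<^sub>R u) v) y w = r * dird (\<lambda>x. g x u v) y w"
    "dird (\<lambda>x. g x v (r *\<^sub>R u)) y w = r * dird (\<lambda>x. g x v u) y w"
    "dird (\<lambda>x. g x u v) y (w + w') = dird (\<lambda>x. g x u v) y w + dird (\<lambda>x. g x u v) y w'"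
    "dird (\<lambda>x. g x u v) y (r *\<^sub>R w) = r * dird (\<lambda>x. g x u v) y w"
    "dird (\<lambda>x. g x u v) y w = dird (\<lambda>x. g x v u) y w"
proof -
  have d: "((\<lambda>x. g x u v) has_derivative (\<lambda>w. dird (\<lambda>x. g x u v) y w)) (at y)" for u v
    by (rule smooth_on_has_derivative[OF g_smooth y])
  have df: "(\<lambda>x. g x u v) differentiable (at y)" for u v
    by (rule smooth_on_differentiable[OF g_smooth y])
  note c = dird_cong_open[OF open_U y df]
  show "dird (\<lambda>x. g x (u + u') v) y w = dird (\<lambda>x. g x u v) y w + dird (\<lambda>x. g x u' v) y w"
    by (subst c[of "u + u'" v "\<lambda>x. g x u v + g x u' v"])
       (simp_all add: g_simps dird_eqI[OF has_derivative_add[OF d d]])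
  show "dird (\<lambda>x. g x v (u + u')) y w = dird (\<lambda>x. g x v u) y w + dird (\<lambda>x. g x v u') y w"
    by (subst c[of v "u + u'" "\<lambda>x. g x v u + g x v u'"])
       (simp_all add: g_simps dird_eqI[OF has_derivative_add[OF d d]])
  show "dird (\<lambda>x. g x (r *\<^sub>R u) v) y w = r * dird (\<lambda>x. g x u v) y w"
    by (subst c[of "r *\<^sub>R u" v "\<lambda>x. r * g x u v"])
       (simp_all add: g_simps dird_eqI[OF has_derivative_mult_right[OF d]])
  show "dird (\<lambda>x. g x v (r *\<^sub>R u)) y w = r * dird (\<lambda>x. g x v u) y w"
    by (subst c[of v "r *\<^sub>R u" "\<lambda>x. r * g x v u"])
       (simp_all add: g_simps dird_eqI[OF has_derivative_mult_right[OF d]])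
  show "dird (\<lambda>x. g x u v) y (w + w') = dird (\<lambda>x. g x u v) y w + dird (\<lambda>x. g x u v) y w'"
    "dird (\<lambda>x. g x u v) y (r *\<^sub>R w) = r * dird (\<lambda>x. g x u v) y w"
    using linear_add[OF has_derivative_linear[OF d]] linear_scale[OF has_derivative_linear[OF d]] by simp_all
  show "dird (\<lambda>x. g x u v) y w = dird (\<lambda>x. g x v u) y w"
    by (rule c) (rule g_sym)
qed

lemma koszul:
  assumes y: "y \<in> U"
  shows "g y (\<Gamma> y u v) w =
    (dird (\<lambda>x. g x v w) y u + dird (\<lambda>x. g x u w) y v - dird (\<lambda>x. g x u v) y w) / 2"
proof -
  let ?L = "\<lambda>w. (dird (\<lambda>x. g x v w) y u + dird (\<lambda>x. g x u w) y v - dird (\<lambda>x. g x u v) y w) / 2"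
  have "linear ?L"
    by (rule linearI) (simp_all add: dg_simps[OF y] algebra_simps diff_divide_distrib add_divide_distrib)
  then obtain z where z: "\<forall>w. g y z w = ?L w"
    using riesz_form(3)[OF g_bilinear[OF y] g_pos[OF y]] by blast
  have "\<Gamma> y u v = z" by (rule christoffel_eqI) (use z g_nondegenerate[OF y] in blast)+
  then show ?thesis using z by simp
qed

lemma christoffel_sym: "y \<in> U \<Longrightarrow> \<Gamma> y u v = \<Gamma> y v u"
  by (rule g_nondegenerate) (auto simp: koszul dg_simps(7)[of y u v])

lemma christoffel_linear:
  assumes y: "y \<in> U"
  shows "linear (\<Gamma> y u)"
proof (rule linearI)
  note ex = koszul[OF y] g_simps[OF y] dg_simps(1-6)[OF y] diff_divide_distrib add_divide_distrib algebra_simps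
  show "\<Gamma> y u (a + b) = \<Gamma> y u a + \<Gamma> y u b" for a b
    by (rule g_nondegenerate[OF y]) (simp add: ex)
  show "\<Gamma> y u (r *\<^sub>R a) = r *\<^sub>R \<Gamma> y u a" for r a
    by (rule g_nondegenerate[OF y]) (simp add: ex)
qed

lemma christoffel_linear_left:
  assumes y: "y \<in> U"
  shows "linear (\<lambda>u. \<Gamma> y u v)"
proof -
  have "(\<lambda>u. \<Gamma> y u v) = \<Gamma> y v" by (rule ext) (rule christoffel_sym[OF y])
  then show ?thesis using christoffel_linear[OF y] by simp
qed

lemma christoffel_smooth: "smooth_on U (\<lambda>y. \<Gamma> y u v)"
proof (rule smooth_on_riesz[where H = g, OF open_U g_bilinear g_pos g_smooth koszul])
  show "smooth_on U (\<lambda>y. (dird (\<lambda>x. g x v w) y u + dird (\<lambda>x. g x u w) y v - dird (\<lambda>x. g x u v) y w) / 2)" for w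
    by (intro smooth_on_divide smooth_on_add smooth_on_diff smooth_on_dird g_smooth smooth_on_const open_U) simp
qed

lemma metric_compatible:
  assumes y: "y \<in> U"
  shows "dird (\<lambda>x. g x a b) y u = g y (\<Gamma> y u a) b + g y a (\<Gamma> y u b)"
  using g_sym[OF y, of a] dg_simps(7)[OF y, of u a b] dg_simps(7)[OF y, of u b a] dg_simps(7)[OF y, of a b u]
  by (simp add: koszul[OF y] field_simps)

sublocale metric_connection U g \<Gamma>
  by (rule metric_connection.intro; (rule open_U g_smooth christoffel_smooth |
        (rule g_bilinear g_sym g_pos christoffel_linear_left christoffel_linear metric_compatible; assumption)))

sublocale soldered_bundle U g \<Gamma> "\<lambda>_ u. u" g
proof (rule soldered_bundle.intro[OF metric_connection_axioms])
  show "soldered_bundle_axioms U g \<Gamma> (\<lambda>_ u. u) g"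
    by (rule soldered_bundle_axioms.intro)
       (auto simp: nab_def christoffel_sym linear_ident intro!: smooth_on_const open_U)
qed

lemma curvature_eq_Rm: "y \<in> U \<Longrightarrow> curvature g y u v w = Rm y u v w"
  by (rule curvature_solder)

end


subsection \<open>Constant sectional curvature\<close>

text \<open>The symmetries give the pair symmetry; polarisation of the vanishing sectional values makes \<open>B\<close> skew
  in the two middle arguments, and then all three terms of the Bianchi identity are equal.\<close>

lemma algebraic_curvature_zero:
  fixes B :: "'e::real_vector \<Rightarrow> 'e \<Rightarrow> 'e \<Rightarrow> 'e \<Rightarrow> real"
  assumes add: "\<And>u v w z z'. B u v w (z + z') = B u v w z + B u v w z'"
      "\<And>u v w w' z. B u v (w + w') z = B u v w z + B u v w' z"
      "\<And>u v v' w z. B u (v + v') w z = B u v w z + B u v' w z"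
      "\<And>u u' v w z. B (u + u') v w z = B u v w z + B u' v w z"
    and skew: "\<And>u v w z. B u v w z = - B v u w z" "\<And>u v w z. B u v w z = - B u v z w"
    and bianchi: "\<And>u v w z. B u v w z + B v w u z + B w u v z = 0"
    and diag: "\<And>u v. B u v v u = 0"
  shows "B u v w z = 0"
proof -
  have pair: "B u v w z = B w z u v" for u v w z
    using bianchi[of u v w z] bianchi[of v w z u] bianchi[of w z u v] bianchi[of z u v w]
      skew(1)[of u v w z] skew(1)[of v w u z] skew(1)[of w u v z] skew(1)[of v w z u] skew(1)[of w z v u]
      skew(1)[of z v w u] skew(1)[of w z u v] skew(1)[of z u w v] skew(1)[of u w z v]
      skew(1)[of z u v w] skew(1)[of u v z w] skew(1)[of v z u w]
      skew(2)[of u v w z] skew(2)[of v w u z] skew(2)[of w u v z] skew(2)[of v w z u] skew(2)[of w z v u]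
      skew(2)[of z v w u] skew(2)[of w z u v] skew(2)[of z u w v] skew(2)[of u w z v]
      skew(2)[of z u v w] skew(2)[of u v z w] skew(2)[of v z u w] by linarith
  have d1: "B u v v z = 0" for u v z
  proof -
    have "B (u + z) v v (u + z) = B u v v u + B z v v u + (B u v v z + B z v v z)"
      by (simp only: add)
    then have "B z v v u + B u v v z = 0" using diag[of "u + z" v] diag[of u v] diag[of z v] by linarith
    moreover have "B z v v u = B u v v z"
      using pair[of z v v u] skew(1)[of v u z v] skew(2)[of u v z v] by linarith
    ultimately show ?thesis by linarith
  qed
  have d2: "B u v w z = - B u w v z" for u v w z
  proof -
    have "B u (v + w) (v + w) z = B u v v z + B u w v z + (B u v w z + B u w w z)" by (simp only: add)
    then show ?thesis using d1[of u "v + w" z] d1[of u v z] d1[of u w z] by linarith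
  qed
  show ?thesis
    using bianchi[of u v w z] d2[of u v w z] d2[of v w u z] d2[of w u v z] skew(1)[of u w v z]
      skew(1)[of v u w z] skew(1)[of w v u z] by linarith
qed

context riemannian_chart
begin

lemma first_Bianchi:
  assumes y: "y \<in> U"
  shows "Rm y u v w + Rm y v w u + Rm y w u v = 0"
proof -
  have eq: "nab (\<lambda>x. \<Gamma> x v w) y u = nab (\<lambda>x. \<Gamma> x w v) y u" for u v w
    by (rule nab_cong[OF y smooth_on_differentiable[OF christoffel_smooth y]]) (rule christoffel_sym)
  show ?thesis
    unfolding Rm_eq_nab[OF y] using eq[of u v w] eq[of v w u] eq[of w u v] by simp
qed

lemma Rm_linear:
  assumes y: "y \<in> U"
  shows "linear (\<lambda>u. Rm y u v w)" "linear (\<lambda>v. Rm y u v w)" "linear (\<lambda>w. Rm y u v w)"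
proof -
  have df: "(\<lambda>x. \<Gamma> x u v) differentiable (at y)" for u v
    by (rule smooth_on_differentiable[OF christoffel_smooth y])
  note d = df[THEN has_derivative_dird]
  have a1: "dird (\<lambda>x. \<Gamma> x (a + b) w) y z = dird (\<lambda>x. \<Gamma> x a w) y z + dird (\<lambda>x. \<Gamma> x b w) y z" for a b w z
    by (subst dird_cong_open[OF open_U y df, of "a + b" w "\<lambda>x. \<Gamma> x a w + \<Gamma> x b w"])
       (simp_all add: linear_add[OF christoffel_linear_left] dird_eqI[OF has_derivative_add[OF d d]])
  have a2: "dird (\<lambda>x. \<Gamma> x w (a + b)) y z = dird (\<lambda>x. \<Gamma> x w a) y z + dird (\<lambda>x. \<Gamma> x w b) y z" for a b w z
    by (subst dird_cong_open[OF open_U y df, of w "a + b" "\<lambda>x. \<Gamma> x w a + \<Gamma> x w b"])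
       (simp_all add: linear_add[OF christoffel_linear] dird_eqI[OF has_derivative_add[OF d d]])
  have a3: "dird (\<lambda>x. \<Gamma> x (r *\<^sub>R a) w) y z = r *\<^sub>R dird (\<lambda>x. \<Gamma> x a w) y z" for a w z r
    by (subst dird_cong_open[OF open_U y df, of "r *\<^sub>R a" w "\<lambda>x. r *\<^sub>R \<Gamma> x a w"])
       (simp_all add: linear_scale[OF christoffel_linear_left] dird_eqI[OF has_derivative_scaleR_right[OF d]])
  have a4: "dird (\<lambda>x. \<Gamma> x w (r *\<^sub>R a)) y z = r *\<^sub>R dird (\<lambda>x. \<Gamma> x w a) y z" for a w z r
    by (subst dird_cong_open[OF open_U y df, of w "r *\<^sub>R a" "\<lambda>x. r *\<^sub>R \<Gamma> x w a"])
       (simp_all add: linear_scale[OF christoffel_linear] dird_eqI[OF has_derivative_scaleR_right[OF d]])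
  note lin = a1 a2 a3 a4 linear_add[OF has_derivative_linear[OF d]] linear_scale[OF has_derivative_linear[OF d]]
    linear_add[OF christoffel_linear[OF y]] linear_scale[OF christoffel_linear[OF y]]
    linear_add[OF christoffel_linear_left[OF y]] linear_scale[OF christoffel_linear_left[OF y]]
  show "linear (\<lambda>u. Rm y u v w)" "linear (\<lambda>v. Rm y u v w)" "linear (\<lambda>w. Rm y u v w)"
    by (rule linearI; simp add: Rm_def lin algebra_simps)+
qed

lemma Rm_swap: "y \<in> U \<Longrightarrow> Rm y u v w = - Rm y v u w"
  by (simp add: Rm_def)

text \<open>The difference of the two sides has the symmetries of a curvature tensor and vanishing sectional values.
  For independent vectors the denominator of the sectional curvature is nonzero, since the quotient
  by zero would be zero and not \<open>c\<close>.\<close>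

theorem constant_curvature_tensor:
  assumes y: "y \<in> U" and c: "c > 0"
    and sec: "\<And>u v. u \<noteq> v \<Longrightarrow> independent {u, v} \<Longrightarrow> sectional_curvature g y u v = c"
  shows "Rm y u v w = c *\<^sub>R (g y v w *\<^sub>R u - g y u w *\<^sub>R v)"
proof (rule g_nondegenerate[OF y])
  fix z
  define B where "B u v w z = g y (Rm y u v w) z - c * (g y v w * g y u z - g y u w * g y v z)" for u v w z
  have sec': "g y (Rm y u v v) u = c * (g y v v * g y u u - g y u v * g y v u)" for u v
  proof (cases "\<exists>r. u = r *\<^sub>R v \<or> v = r *\<^sub>R u")
    case True
    have z: "Rm y a a b = 0" for a b using Rm_swap[OF y, of a a b] by (simp add: eq_neg_iff_add_eq_0 flip: scaleR_2)
    from True show ?thesis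
      by (auto simp: linear_scale[OF Rm_linear(1)[OF y]] linear_scale[OF Rm_linear(2)[OF y]] z g_simps[OF y])
  next
    case False
    then have ne: "u \<noteq> v" by (metis scaleR_one)
    have "v \<noteq> 0" using False by (metis scaleR_zero_left)
    then have "independent {u, v}"
      using False by (auto simp: independent_insert span_singleton)
    from sec[OF ne this]
    have q: "g y (Rm y u v v) u / (g y u u * g y v v - (g y u v)\<^sup>2) = c"
      by (simp add: sectional_curvature_def curvature_eq_Rm[OF y])
    then have "g y u u * g y v v - (g y u v)\<^sup>2 \<noteq> 0" using c by auto
    with q have "g y (Rm y u v v) u = c * (g y u u * g y v v - (g y u v)\<^sup>2)" by (simp add: field_simps)
    then show ?thesis using g_sym[OF y, of u v] by (simp add: power2_eq_square mult.commute)
  qed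
  have "B u v w z = 0"
  proof (rule algebraic_curvature_zero[where B = B])
    show "B u v w z = - B v u w z" for u v w z
      using Rm_swap[OF y, of u v w] by (simp add: B_def g_simps[OF y] algebra_simps)
    show "B u v w z = - B u v z w" for u v w z
      using Rm_skew[OF y, of u v w z] g_sym[OF y, of w "Rm y u v z"] by (simp add: B_def algebra_simps)
    show "B u v w z + B v w u z + B w u v z = 0" for u v w z
    proof -
      have "g y (Rm y u v w + Rm y v w u + Rm y w u v) z = 0"
        unfolding first_Bianchi[OF y] by (rule g_simps(5)[OF y])
      then show ?thesis
        using g_sym[OF y, of u v] g_sym[OF y, of v w] g_sym[OF y, of w u]
        by (simp add: B_def g_simps[OF y] algebra_simps)
    qed
    show "B u v v u = 0" for u v by (simp add: B_def sec')
  qed (simp_all add: B_def g_simps[OF y] linear_add[OF Rm_linear(1)[OF y]] linear_add[OF Rm_linear(2)[OF y]]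
      linear_add[OF Rm_linear(3)[OF y]] algebra_simps)
  then show "g y (Rm y u v w) z = g y (c *\<^sub>R (g y v w *\<^sub>R u - g y u w *\<^sub>R v)) z"
    by (simp add: B_def g_simps[OF y])
qed

end


section \<open>The nonzero cotangent bundle over a chart\<close>

lemma dird_fst:
  assumes "f differentiable (at (fst y))"
  shows "dird (\<lambda>x. f (fst x)) y u = dird f (fst y) (fst u)"
proof -
  have d: "(fst has_derivative fst) (at y)"
    by (rule bounded_linear_imp_has_derivative[OF bounded_linear_fst])
  then have "fst differentiable (at y)" unfolding differentiable_def by blast
  from dird_compose[OF this assms] show ?thesis by (simp add: dird_eqI[OF d])
qed

lemma smooth_on_compose_fst:
  fixes f :: "'a::euclidean_space \<Rightarrow> 'c::real_normed_vector" and V :: "'b::euclidean_space set"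
  assumes "open U" "open V" "smooth_on U f"
  shows "smooth_on (U \<times> V) (\<lambda>x. f (fst x))"
proof -
  have o: "open (U \<times> V)" by (rule open_Times[OF assms(1,2)])
  show ?thesis by (rule smooth_on_compose[OF o smooth_on_fst[OF o] _ assms(3)]) auto
qed

context riemannian_chart
begin

abbreviation T0 :: "('e \<times> 'e) set" where "T0 \<equiv> U \<times> (- {0})"

definition sharp :: "'e \<Rightarrow> 'e \<Rightarrow> 'e" where
  "sharp q p = (THE z. \<forall>w. g q z w = p \<bullet> w)"

lemma g_sharp: 
  assumes q: "q \<in> U"
  shows "g q (sharp q p) w = p \<bullet> w"
proof -
  have "linear (\<lambda>w. p \<bullet> w)" by (rule bounded_linear.linear[OF bounded_linear_inner_right])
  then obtain z where z: "\<forall>w. g q z w = p \<bullet> w"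
    using riesz_form(3)[OF g_bilinear[OF q] g_pos[OF q]] by blast
  then have "sharp q p = z"
    unfolding sharp_def by (rule the_equality) (use z in \<open>auto intro: g_nondegenerate[OF q]\<close>)
  then show ?thesis using z by simp
qed

lemma sharp_eqI: "q \<in> U \<Longrightarrow> (\<And>w. g q z w = p \<bullet> w) \<Longrightarrow> sharp q p = z"
  by (rule g_nondegenerate[of q]) (simp_all only: g_sharp)

lemma open_T0: "open T0"
  by (intro open_Times open_U) auto

sublocale X: metric_connection T0 "\<lambda>y. g (fst y)" "\<lambda>y u. \<Gamma> (fst y) (fst u)"
proof (rule metric_connection.intro)
  show "open T0" by (rule open_T0)
  show "smooth_on T0 (\<lambda>y. g (fst y) a b)" for a b
    by (rule smooth_on_compose_fst[OF open_U _ g_smooth]) auto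
  show "smooth_on T0 (\<lambda>y. \<Gamma> (fst y) (fst u) a)" for u :: "'e \<times> 'e" and a
    by (rule smooth_on_compose_fst[OF open_U _ christoffel_smooth]) auto
  fix y assume "y \<in> T0"
  then have q: "fst y \<in> U" by auto
  show "bilinear (g (fst y))" by (rule g_bilinear[OF q])
  show "g (fst y) a b = g (fst y) b a" for a b by (rule g_sym[OF q])
  show "g (fst y) a a > 0" if "a \<noteq> 0" for a by (rule g_pos[OF q that])
  show "linear (\<Gamma> (fst y) (fst u))" for u :: "'e \<times> 'e" by (rule christoffel_linear[OF q])
  show "linear (\<lambda>u. \<Gamma> (fst y) (fst u) a)" for a
    using linear_compose[OF linear_fst christoffel_linear_left[OF q, of a]] by (simp add: o_def)
  show "dird (\<lambda>x. g (fst x) a b) y u = g (fst y) (\<Gamma> (fst y) (fst u) a) b + g (fst y) a (\<Gamma> (fst y) (fst u) b)" for u a b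
    by (subst dird_fst[OF smooth_on_differentiable[OF g_smooth q]]) (rule metric_compatible[OF q])
qed

lemma X_Rm:
  assumes y: "y \<in> T0"
  shows "X.Rm y u v a = Rm (fst y) (fst u) (fst v) a"
proof -
  have q: "fst y \<in> U" using y by auto
  show ?thesis
    unfolding X.Rm_def Rm_def by (simp only: dird_fst[OF smooth_on_differentiable[OF christoffel_smooth q]])
qed

text \<open>The tautological section: the vector dual to the covector, as a section of the pulled-back tangent
  bundle.\<close>

definition P :: "'e \<times> 'e \<Rightarrow> 'e" where "P y = sharp (fst y) (snd y)"

lemma g_P: "y \<in> T0 \<Longrightarrow> g (fst y) (P y) w = snd y \<bullet> w"
  unfolding P_def by (rule g_sharp) auto

lemma P_smooth: "smooth_on T0 P"
proof (rule smooth_on_riesz[where H = "\<lambda>y. g (fst y)", OF open_T0 X.H_bilinear X.H_pos X.H_smooth g_P])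
  show "smooth_on T0 (\<lambda>y. snd y \<bullet> w)" for w
    by (intro smooth_on_inner smooth_on_snd smooth_on_const open_T0)
qed

text \<open>The covariant derivative of \<open>P\<close> is the vector dual to \<open>Dp\<close>.  Hence \<open>fst\<close> and \<open>X.nab P y\<close> are the components of
  a tangent vector with respect to the splitting into horizontal and vertical directions.\<close>

lemma g_nab_P:
  assumes y: "y \<in> T0"
  shows "g (fst y) (X.nab P y u) w = snd u \<bullet> w - snd y \<bullet> \<Gamma> (fst y) (fst u) w"
proof -
  have d: "((\<lambda>x. g (fst x) (P x) w) has_derivative (\<lambda>u. g (fst y) (X.nab P y u) w + g (fst y) (P y) (X.nab (\<lambda>_. w) y u))) (at y)"
    by (rule X.has_derivative_H[OF y smooth_on_differentiable[OF P_smooth y]]) simp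
  have 1: "((\<lambda>x. snd x \<bullet> w) has_derivative (\<lambda>u. snd u \<bullet> w)) (at y)"
    by (rule has_derivative_inner_left[OF has_derivative_snd[OF has_derivative_ident]])
  have 2: "((\<lambda>x. snd x \<bullet> w) has_derivative (\<lambda>u. g (fst y) (X.nab P y u) w + g (fst y) (P y) (X.nab (\<lambda>_. w) y u))) (at y)"
    by (rule has_derivative_transform_within_open[OF d open_T0 y]) (rule g_P)
  have "g (fst y) (X.nab P y u) w + g (fst y) (P y) (X.nab (\<lambda>_. w) y u) = snd u \<bullet> w"
    using fun_cong[OF has_derivative_unique[OF 2 1], of u] .
  then show ?thesis using g_P[OF y] by (simp add: X.nab_const)
qed

definition t :: "'e \<times> 'e \<Rightarrow> real" where "t y = g (fst y) (P y) (P y) / 2"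

lemma t_smooth: "smooth_on T0 t"
  unfolding t_def by (intro smooth_on_divide X.smooth_H P_smooth smooth_on_const open_T0) simp

lemma t_pos:
  assumes y: "y \<in> T0"
  shows "t y > 0"
proof -
  have "P y \<noteq> 0"
    using g_P[OF y, of "snd y"] y X.H_simps(5)[OF y, of "snd y"] by auto
  then show ?thesis unfolding t_def using X.H_pos[OF y] by simp
qed

lemma dird_t:
  assumes y: "y \<in> T0"
  shows "dird t y u = g (fst y) (P y) (X.nab P y u)"
proof -
  note P = smooth_on_differentiable[OF P_smooth y]
  have "((\<lambda>x. g (fst x) (P x) (P x) / 2) has_derivative
      (\<lambda>u. (g (fst y) (X.nab P y u) (P y) + g (fst y) (P y) (X.nab P y u)) / 2)) (at y)"
    using has_derivative_mult_right[OF X.has_derivative_H[OF y P P], of "1 / 2"] by simp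
  from dird_eqI[OF this] show ?thesis
    unfolding t_def[abs_def] using X.H_sym[OF y, of "P y"] by simp
qed

end


text \<open>The identities between coefficients behind the equality of the given \<open>G\<close> and \<open>J\<close> with the structure of the
  quadric.  Here \<open>l\<close>, \<open>l'\<close> are the values of \<open>\<lambda>\<close> and its derivative, \<open>k\<^sup>2 = c\<close>, \<open>r\<close> is the length of the
  covector, \<open>A r l / (2 k)\<close> and \<open>C\<close> are the sine and cosine of the angle, \<open>D\<close> is the factor in
  \<open>d\<theta> = D \<langle>P, \<nabla>P\<rangle>\<close>, and \<open>W = 2c - A\<^sup>2 t l\<^sup>2\<close>.  In the second
  lemma \<open>B\<close> and \<open>E\<close> are the coefficients of the terms of rank one in \<open>J\<^sup>(\<^sup>1\<^sup>)\<close> and \<open>J\<^sub>(\<^sub>2\<^sub>)\<close>, the latter up to sign.\<close>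

lemma quadric_metric_coefficients:
  fixes A t l l' W k r C D :: real
  assumes pos: "A > 0" "t > 0" "l > 0" "W > 0" "k > 0" "r > 0" "C > 0"
    and r: "r\<^sup>2 = 2 * t" and W: "W = 2 * k\<^sup>2 - A\<^sup>2 * t * l\<^sup>2" and C: "W = 2 * k\<^sup>2 * C\<^sup>2"
    and D: "D = A * (l + 2 * t * l') / (2 * r * k * C)"
  shows "2 / A * ((A * r * l / (2 * k))\<^sup>2 * k\<^sup>2) = A * t * l\<^sup>2"
    "2 / A * ((C\<^sup>2 - (A * r * l / (2 * k))\<^sup>2) * k\<^sup>2 / r\<^sup>2) = (k\<^sup>2 - A\<^sup>2 * t * l\<^sup>2) / (A * t)"
    "2 / A / r\<^sup>2 = 1 / (A * t)"
    "2 / A * (D\<^sup>2 - 1 / (r\<^sup>2)\<^sup>2)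
      = - ((k\<^sup>2 - A\<^sup>2 * t * (l\<^sup>2 + 2 * t * l' * (l + t * l'))) / (A * t\<^sup>2 * W))"
proof -
  have s: "(A * r * l / (2 * k))\<^sup>2 * k\<^sup>2 = A\<^sup>2 * (2 * t) * l\<^sup>2 / 4"
    unfolding r[symmetric] using pos by (simp add: field_simps power2_eq_square)
  show "2 / A * ((A * r * l / (2 * k))\<^sup>2 * k\<^sup>2) = A * t * l\<^sup>2"
    unfolding s using pos by (simp add: field_simps power2_eq_square)
  have "(C\<^sup>2 - (A * r * l / (2 * k))\<^sup>2) * k\<^sup>2 = W / 2 - A\<^sup>2 * (2 * t) * l\<^sup>2 / 4"
    unfolding C left_diff_distrib s by simp
  also have "\<dots> = k\<^sup>2 - A\<^sup>2 * t * l\<^sup>2" unfolding W by (simp add: field_simps)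
  finally have "(C\<^sup>2 - (A * r * l / (2 * k))\<^sup>2) * k\<^sup>2 = k\<^sup>2 - A\<^sup>2 * t * l\<^sup>2" .
  then have "2 / A * ((C\<^sup>2 - (A * r * l / (2 * k))\<^sup>2) * k\<^sup>2 / r\<^sup>2) = 2 / A * ((k\<^sup>2 - A\<^sup>2 * t * l\<^sup>2) / (2 * t))"
    unfolding r by (simp only:)
  also have "\<dots> = (k\<^sup>2 - A\<^sup>2 * t * l\<^sup>2) / (A * t)" using pos by (simp add: field_simps)
  finally show "2 / A * ((C\<^sup>2 - (A * r * l / (2 * k))\<^sup>2) * k\<^sup>2 / r\<^sup>2) = (k\<^sup>2 - A\<^sup>2 * t * l\<^sup>2) / (A * t)" .
  show "2 / A / r\<^sup>2 = 1 / (A * t)" unfolding r using pos by simp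
  have "(2 * r * k * C)\<^sup>2 = r\<^sup>2 * (2 * (2 * k\<^sup>2 * C\<^sup>2))" by (simp add: power_mult_distrib)
  also have "\<dots> = 4 * t * W" unfolding C[symmetric] r by simp
  finally have D2: "D\<^sup>2 = A\<^sup>2 * (l + 2 * t * l')\<^sup>2 / (4 * t * W)"
    unfolding D power_divide by (simp add: power_mult_distrib)
  have k: "k\<^sup>2 = (W + A\<^sup>2 * t * l\<^sup>2) / 2" using W by simp
  show "2 / A * (D\<^sup>2 - 1 / (r\<^sup>2)\<^sup>2)
      = - ((k\<^sup>2 - A\<^sup>2 * t * (l\<^sup>2 + 2 * t * l' * (l + t * l'))) / (A * t\<^sup>2 * W))"
    unfolding D2 k r using pos(1,2,4) by (simp add: field_simps power2_eq_square)
qed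

lemma quadric_complex_coefficients:
  fixes A t l l' W k r C D B E :: real
  assumes pos: "A > 0" "t > 0" "l > 0" "l + 2 * t * l' > 0" "W > 0" "k > 0" "r > 0" "C > 0"
    and r: "r\<^sup>2 = 2 * t" and W: "W = 2 * k\<^sup>2 - A\<^sup>2 * t * l\<^sup>2" and C: "W = 2 * k\<^sup>2 * C\<^sup>2"
    and D: "D = A * (l + 2 * t * l') / (2 * r * k * C)"
    and B: "B = (k\<^sup>2 - A\<^sup>2 * t * l * (l + t * l')) / (A * t * (l + 2 * t * l'))"
    and E: "E = (k\<^sup>2 - A\<^sup>2 * t * l * (l + t * l')) / (A * t\<^sup>2 * l * W)"
  shows "A * t * l / r = A * r * l / (2 * k) * k"
    "C * k * (1 / (A * t * l) - 2 * t * E) / r = D"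
    "D * (A * t * l + 2 * t * B) = C * k / r"
proof -
  show "A * t * l / r = A * r * l / (2 * k) * k"
    using pos r by (simp add: field_simps power2_eq_square)
  have k: "k\<^sup>2 = (W + A\<^sup>2 * t * l\<^sup>2) / 2" using W by simp
  have e: "1 / (A * t * l) - 2 * t * E = A * (l + 2 * t * l') / W"
    unfolding E k using pos(1,2,3,5) by (simp add: field_simps power2_eq_square)
  show "C * k * (1 / (A * t * l) - 2 * t * E) / r = D"
    unfolding e D unfolding C using pos by (simp add: field_simps power2_eq_square)
  define m where "m = l + 2 * t * l'"
  have m: "m > 0" using pos(4) by (simp add: m_def)
  have l': "2 * (t * l') = m - l" by (simp add: m_def)
  have "k\<^sup>2 - A\<^sup>2 * t * l * (l + t * l') = W / 2 - A\<^sup>2 * t * l * (2 * (t * l')) / 2 - A\<^sup>2 * t * l\<^sup>2 / 2"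
    unfolding k by (simp add: field_simps power2_eq_square)
  also have "\<dots> = (W - A\<^sup>2 * t * l * m) / 2" unfolding l' by (simp add: field_simps power2_eq_square)
  finally have num: "k\<^sup>2 - A\<^sup>2 * t * l * (l + t * l') = (W - A\<^sup>2 * t * l * m) / 2" .
  have e: "A * t * l + 2 * t * B = W / (A * m)"
    unfolding B num m_def[symmetric] using pos(1,2) m by (simp add: field_simps power2_eq_square)
  show "D * (A * t * l + 2 * t * B) = C * k / r"
    unfolding e D m_def[symmetric] unfolding C using pos m by (simp add: field_simps power2_eq_square)
qed


lemma quadric_metric_expansion:
  fixes x x' h h' dd hh r C k s D :: real
  assumes r: "r \<noteq> 0"
  shows "dd / r\<^sup>2 - (x' / r^3 + C * k * h' / r\<^sup>2) * x / r - (x / r^3 + C * k * h / r\<^sup>2) * x' / r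
      + (x / r^3 + C * k * h / r\<^sup>2) * (x' / r^3 + C * k * h' / r\<^sup>2) * r\<^sup>2
    = dd / r\<^sup>2 - x * x' / (r\<^sup>2)\<^sup>2 + C\<^sup>2 * k\<^sup>2 * h * h' / r\<^sup>2"
    "(s * k)\<^sup>2 * hh + s * k * (D * x' / r - s * k * h' / r\<^sup>2) * h + s * k * (D * x / r - s * k * h / r\<^sup>2) * h'
      + (D * x / r - s * k * h / r\<^sup>2) * (D * x' / r - s * k * h' / r\<^sup>2) * r\<^sup>2
    = s\<^sup>2 * (k\<^sup>2 * hh - k\<^sup>2 * h * h' / r\<^sup>2) + D\<^sup>2 * x * x'"
  using r by (simp_all add: field_simps power2_eq_square power3_eq_cube)

text \<open>The choice of \<open>e\<close> and \<open>\<theta>\<close> on the cotangent bundle: \<open>e\<close> is the direction of the covector, and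
  \<open>sin \<theta> = A r \<lambda> / (2 \<surd>c)\<close> depends on its length \<open>r\<close>.  The three inequalities for \<open>\<lambda>\<close> say that the sine is positive,
  that it is less than one, and that it increases with \<open>r\<close>.\<close>

locale cotangent_quadric = riemannian_chart U g
  for U :: "'e::euclidean_space set" and g :: "'e \<Rightarrow> 'e \<Rightarrow> 'e \<Rightarrow> real" +
  fixes A c :: real and lam :: "real \<Rightarrow> real"
  assumes A_pos: "A > 0" and c_pos: "c > 0"
    and lam_smooth: "smooth_on {0<..} lam"
    and lam_pos: "s > 0 \<Longrightarrow> lam s > 0"
    and lam_bound: "s > 0 \<Longrightarrow> 2 * c - A\<^sup>2 * s * (lam s)\<^sup>2 > 0"
    and lam_mono: "s > 0 \<Longrightarrow> lam s + 2 * s * deriv lam s > 0"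
    and Rm_const: "q \<in> U \<Longrightarrow> Rm q u v w = c *\<^sub>R (g q v w *\<^sub>R u - g q u w *\<^sub>R v)"
begin

abbreviation d where "d y u \<equiv> X.nab P y u"

definition r where "r y = sqrt (2 * t y)"

definition angle where "angle y = arcsin (A * r y * lam (t y) / (2 * sqrt c))"

definition direction where "direction y = (1 / r y) *\<^sub>R P y"

lemma r_sq: "y \<in> T0 \<Longrightarrow> (r y)\<^sup>2 = 2 * t y" and r_pos: "y \<in> T0 \<Longrightarrow> r y > 0"
  using t_pos[of y] by (simp_all add: r_def)

lemma r_smooth: "smooth_on T0 r"
  unfolding r_def
proof (rule smooth_on_compose[OF open_T0 _ _ smooth_on_real_sqrt])
  show "smooth_on T0 (\<lambda>y. 2 * t y)" by (intro smooth_on_mult smooth_on_const t_smooth open_T0)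
  show "(\<lambda>y. 2 * t y) ` T0 \<subseteq> {0<..}" by (rule image_subsetI) (simp only: greaterThan_iff t_pos zero_less_mult_iff, simp)
qed

lemma lam_t_smooth: "smooth_on T0 (\<lambda>y. lam (t y))"
proof (rule smooth_on_compose[OF open_T0 t_smooth _ lam_smooth])
  show "t ` T0 \<subseteq> {0<..}" by (rule image_subsetI) (simp only: greaterThan_iff t_pos)
qed

lemma sine_bounds:
  assumes y: "y \<in> T0"
  shows "A * r y * lam (t y) / (2 * sqrt c) > 0" "A * r y * lam (t y) / (2 * sqrt c) < 1"
    "(A * r y * lam (t y) / (2 * sqrt c))\<^sup>2 = A\<^sup>2 * t y * (lam (t y))\<^sup>2 / (2 * c)"
proof -
  let ?s = "A * r y * lam (t y) / (2 * sqrt c)"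
  show pos: "?s > 0" using A_pos c_pos r_pos[OF y] lam_pos[OF t_pos[OF y]] by simp
  show sq: "?s\<^sup>2 = A\<^sup>2 * t y * (lam (t y))\<^sup>2 / (2 * c)"
    using c_pos by (simp add: power_mult_distrib power_divide r_sq[OF y])
  have "?s\<^sup>2 < 1\<^sup>2" unfolding sq using lam_bound[OF t_pos[OF y]] c_pos by simp
  then show "?s < 1" by (rule power2_less_imp_less) simp
qed

lemma sin_angle: "y \<in> T0 \<Longrightarrow> sin (angle y) = A * r y * lam (t y) / (2 * sqrt c)"
  unfolding angle_def using sine_bounds(1,2)[of y] by (intro sin_arcsin) auto

lemma cos_angle:
  assumes y: "y \<in> T0"
  shows "cos (angle y) > 0" "2 * c - A\<^sup>2 * t y * (lam (t y))\<^sup>2 = 2 * c * (cos (angle y))\<^sup>2"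
proof -
  show "cos (angle y) > 0"
    unfolding angle_def
    using arcsin_lt_bounded[of "A * r y * lam (t y) / (2 * sqrt c)"] sine_bounds(1,2)[OF y]
    by (intro cos_gt_zero_pi) linarith+
  have "(cos (angle y))\<^sup>2 = 1 - A\<^sup>2 * t y * (lam (t y))\<^sup>2 / (2 * c)"
    using sin_cos_squared_add[of "angle y"] unfolding sin_angle[OF y] sine_bounds(3)[OF y] by simp
  then show "2 * c - A\<^sup>2 * t y * (lam (t y))\<^sup>2 = 2 * c * (cos (angle y))\<^sup>2"
    using c_pos by (simp add: field_simps)
qed

lemma sine_smooth: "smooth_on T0 (\<lambda>y. A * r y * lam (t y) / (2 * sqrt c))"
  using c_pos by (intro smooth_on_divide smooth_on_mult smooth_on_const r_smooth lam_t_smooth open_T0) auto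

lemma angle_smooth: "smooth_on T0 angle"
  unfolding angle_def
proof (rule smooth_on_compose[OF open_T0 sine_smooth _ smooth_on_real_arcsin])
  show "(\<lambda>y. A * r y * lam (t y) / (2 * sqrt c)) ` T0 \<subseteq> {-1<..<1}"
  proof (rule image_subsetI)
    fix y assume "y \<in> T0"
    from sine_bounds(1,2)[OF this] show "A * r y * lam (t y) / (2 * sqrt c) \<in> {-1<..<1}"
      unfolding greaterThanLessThan_iff by linarith
  qed
qed

lemma dird_r:
  assumes y: "y \<in> T0"
  shows "dird r y u = g (fst y) (P y) (d y u) / r y"
proof -
  have "((\<lambda>x. 2 * t x) has_derivative (\<lambda>u. 2 * dird t y u)) (at y)"
    by (rule has_derivative_mult_right[OF smooth_on_has_derivative[OF t_smooth y]])
  from has_derivative_real_sqrt[OF _ this]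
  have "((\<lambda>x. sqrt (2 * t x)) has_derivative (\<lambda>u. 2 * dird t y u * (inverse (sqrt (2 * t y)) / 2))) (at y)"
    using t_pos[OF y] by (simp add: mult.commute)
  then have "(r has_derivative (\<lambda>u. 2 * dird t y u * (inverse (r y) / 2))) (at y)"
    unfolding r_def[abs_def] .
  from dird_eqI[OF this, of u] have "dird r y u = 2 * dird t y u * (inverse (r y) / 2)" .
  also have "\<dots> = dird t y u / r y" by (simp add: inverse_eq_divide)
  finally show ?thesis unfolding dird_t[OF y] .
qed

lemma dird_angle:
  assumes y: "y \<in> T0"
  shows "dird angle y u = A * (lam (t y) + 2 * t y * deriv lam (t y)) / (2 * r y * sqrt c * cos (angle y))
    * g (fst y) (P y) (d y u)"
proof -
  let ?x = "g (fst y) (P y) (d y u)"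
  have rp: "r y > 0" by (rule r_pos[OF y])
  obtain l' where l': "(lam has_real_derivative l') (at (t y))"
    using has_real_derivative[OF smooth_on_has_derivative[OF lam_smooth]] t_pos[OF y] by auto
  have dl: "l' = deriv lam (t y)" using DERIV_imp_deriv[OF l'] by simp
  have "((\<lambda>x. lam (t x)) has_derivative (\<lambda>u. l' * dird t y u)) (at y)"
    using diff_chain_at[OF smooth_on_has_derivative[OF t_smooth y] l'[unfolded has_field_derivative_def]]
    by (simp add: o_def)
  from has_derivative_mult[OF smooth_on_has_derivative[OF r_smooth y] this]
  have "((\<lambda>x. A / (2 * sqrt c) * (r x * lam (t x))) has_derivative
      (\<lambda>u. A / (2 * sqrt c) * (r y * (l' * dird t y u) + dird r y u * lam (t y)))) (at y)"
    by (rule has_derivative_mult_right)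
  then have "((\<lambda>x. A * r x * lam (t x) / (2 * sqrt c)) has_derivative
      (\<lambda>u. A / (2 * sqrt c) * (r y * (l' * dird t y u) + dird r y u * lam (t y)))) (at y)"
    by (simp add: mult.assoc)
  from dird_eqI[OF this]
  have 1: "dird (\<lambda>x. A * r x * lam (t x) / (2 * sqrt c)) y u
      = A / (2 * sqrt c) * (r y * (l' * dird t y u) + dird r y u * lam (t y))" for u .
  have 2: "((\<lambda>x. sin (angle x)) has_derivative (\<lambda>u. dird (\<lambda>x. A * r x * lam (t x) / (2 * sqrt c)) y u)) (at y)"
    by (rule has_derivative_transform_within_open[OF smooth_on_has_derivative[OF sine_smooth y] open_T0 y])
       (rule sin_angle[symmetric])
  have 3: "((\<lambda>x. sin (angle x)) has_derivative (\<lambda>u. dird angle y u * cos (angle y))) (at y)"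
    by (rule has_derivative_sin[OF smooth_on_has_derivative[OF angle_smooth y]])
  have "dird angle y u * cos (angle y)
      = A / (2 * sqrt c) * (r y * (l' * ?x) + ?x / r y * lam (t y))"
    using fun_cong[OF has_derivative_unique[OF 3 2], of u] unfolding 1 dird_r[OF y] dird_t[OF y] .
  also have "\<dots> = A / (2 * sqrt c) * ((lam (t y) + (r y)\<^sup>2 * l') / r y * ?x)"
    using rp by (simp add: field_simps power2_eq_square)
  also have "\<dots> = A * (lam (t y) + 2 * t y * deriv lam (t y)) / (2 * r y * sqrt c) * ?x"
    unfolding r_sq[OF y] dl by (simp add: mult.commute mult.left_commute)
  finally have e: "dird angle y u * cos (angle y)
      = A * (lam (t y) + 2 * t y * deriv lam (t y)) / (2 * r y * sqrt c) * ?x" .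
  have cn: "cos (angle y) \<noteq> 0" using cos_angle(1)[OF y] by simp
  have "dird angle y u
      = A * (lam (t y) + 2 * t y * deriv lam (t y)) / (2 * r y * sqrt c) * ?x / cos (angle y)"
    by (rule iffD2[OF nonzero_eq_divide_eq[OF cn] e])
  then show ?thesis by simp
qed

lemma direction_smooth: "smooth_on T0 direction"
  unfolding direction_def using r_pos
  by (intro smooth_on_scaleR smooth_on_divide smooth_on_const r_smooth P_smooth open_T0) force

lemma nab_direction:
  assumes y: "y \<in> T0"
  shows "X.nab direction y u = (1 / r y) *\<^sub>R d y u - (g (fst y) (P y) (d y u) / (r y)^3) *\<^sub>R P y"
proof -
  have rp: "r y \<noteq> 0" using r_pos[OF y] by simp
  have i: "((\<lambda>x. 1 / r x) has_derivative (\<lambda>u. - (dird r y u / (r y)\<^sup>2))) (at y)"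
    using has_derivative_divide'[OF has_derivative_const[of 1] smooth_on_has_derivative[OF r_smooth y] rp]
    by (simp add: power2_eq_square)
  have "X.nab direction y u = - (dird r y u / (r y)\<^sup>2) *\<^sub>R P y + (1 / r y) *\<^sub>R d y u"
    unfolding direction_def[abs_def]
    using X.nab_scaleR[OF y _ smooth_on_differentiable[OF P_smooth y], of "\<lambda>x. 1 / r x"] i
    unfolding dird_eqI[OF i] differentiable_def by blast
  then show ?thesis
    unfolding dird_r[OF y] by (simp add: power2_eq_square power3_eq_cube)
qed

lemma g_PP: "y \<in> T0 \<Longrightarrow> g (fst y) (P y) (P y) = (r y)\<^sup>2"
  by (simp add: r_sq t_def)

sublocale K: quadric_soldering T0 "\<lambda>y. g (fst y)" "\<lambda>y u. \<Gamma> (fst y) (fst u)"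
  "\<lambda>y u. sqrt c *\<^sub>R fst u" direction angle "2 / A"
proof (rule quadric_soldering.intro[OF X.metric_connection_axioms], rule quadric_soldering_axioms.intro)
  show "smooth_on T0 direction" by (rule direction_smooth)
  show "smooth_on T0 angle" by (rule angle_smooth)
  show "2 / A > 0" using A_pos by simp
  show "smooth_on T0 (\<lambda>y. sqrt c *\<^sub>R fst u)" for u :: "'e \<times> 'e" by (rule smooth_on_const[OF open_T0])
  show "linear (\<lambda>u::'e \<times> 'e. sqrt c *\<^sub>R fst u)" by (rule linearI) (simp_all add: scaleR_add_right)
  fix y assume y: "y \<in> T0"
  then have q: "fst y \<in> U" by auto
  show "X.nab (\<lambda>x. sqrt c *\<^sub>R fst v) y u = X.nab (\<lambda>x. sqrt c *\<^sub>R fst u) y v" for u v :: "'e \<times> 'e"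
    using christoffel_sym[OF q, of "fst u" "fst v"]
    by (simp add: X.nab_const linear_scale[OF christoffel_linear[OF q]])
  show "g (fst y) (direction y) (direction y) = 1"
    using r_pos[OF y] by (simp add: direction_def g_simps[OF q] g_PP[OF y] power2_eq_square)
  show "X.Rm y u v \<zeta> = g (fst y) (sqrt c *\<^sub>R fst v) \<zeta> *\<^sub>R sqrt c *\<^sub>R fst u
      - g (fst y) (sqrt c *\<^sub>R fst u) \<zeta> *\<^sub>R sqrt c *\<^sub>R fst v" for u v :: "'e \<times> 'e" and \<zeta>
  proof -
    have sc: "sqrt c * (sqrt c * a) = c * a" for a using c_pos by (simp flip: mult.assoc)
    show ?thesis by (simp add: sc X_Rm[OF y] Rm_const[OF q] g_simps[OF q] algebra_simps)
  qed
qed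

abbreviation \<alpha> where "\<alpha> \<equiv> K.\<alpha>"
abbreviation \<beta> where "\<beta> \<equiv> K.\<beta>"

lemma \<alpha>_eq:
  assumes y: "y \<in> T0"
  shows "\<alpha> y u = (1 / r y) *\<^sub>R d y u - (g (fst y) (P y) (d y u) / (r y)^3) *\<^sub>R P y
    - (cos (angle y) * sqrt c * g (fst y) (P y) (fst u) / (r y)\<^sup>2) *\<^sub>R P y"
proof -
  have q: "fst y \<in> U" using y by auto
  show ?thesis
    using g_sym[OF q, of "fst u" "P y"]
    by (simp add: K.\<alpha>_def nab_direction[OF y] direction_def g_simps[OF q] power2_eq_square)
qed

lemma \<beta>_eq:
  assumes y: "y \<in> T0"
  shows "\<beta> y u = sin (angle y) *\<^sub>R (sqrt c *\<^sub>R fst u - (sqrt c * g (fst y) (P y) (fst u) / (r y)\<^sup>2) *\<^sub>R P y)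
    + (A * (lam (t y) + 2 * t y * deriv lam (t y)) / (2 * r y * sqrt c * cos (angle y))
        * g (fst y) (P y) (d y u) / r y) *\<^sub>R P y"
proof -
  have q: "fst y \<in> U" using y by auto
  show ?thesis
    using g_sym[OF q, of "fst u" "P y"]
    by (simp add: K.\<beta>_def dird_angle[OF y] direction_def g_simps[OF q] power2_eq_square)
qed

text \<open>The components along and orthogonal to \<open>P\<close> of the horizontal and of the vertical part are recovered
  one by one; none of the factors \<open>sin \<theta>\<close>, \<open>cos \<theta>\<close>, \<open>d\<theta>/dr\<close> vanishes.\<close>

lemma soldering_injective:
  assumes y: "y \<in> T0" and "\<alpha> y u = 0" "\<beta> y u = 0"
  shows "u = 0"
proof -
  have q: "fst y \<in> U" using y by auto
  have rp: "r y > 0" by (rule r_pos[OF y])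
  define D where "D = A * (lam (t y) + 2 * t y * deriv lam (t y)) / (2 * r y * sqrt c * cos (angle y))"
  note \<beta>_eq' = \<beta>_eq[OF y, folded D_def]
  have D: "D > 0" unfolding D_def using A_pos c_pos rp cos_angle(1)[OF y] lam_mono[OF t_pos[OF y]] by simp
  have s: "sin (angle y) > 0" unfolding sin_angle[OF y] by (rule sine_bounds(1)[OF y])
  have "g (fst y) (P y) (\<beta> y u) = D * g (fst y) (P y) (d y u) * r y"
    unfolding \<beta>_eq' using rp by (simp add: g_simps[OF q] g_PP[OF y] power2_eq_square)
  then have Pd: "g (fst y) (P y) (d y u) = 0" using assms(3) D rp by (simp add: g_simps[OF q])
  have "g (fst y) (P y) (\<alpha> y u) = - cos (angle y) * sqrt c * g (fst y) (P y) (fst u)"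
    unfolding \<alpha>_eq[OF y] Pd using rp by (simp add: g_simps[OF q] g_PP[OF y] power2_eq_square Pd)
  then have Ph: "g (fst y) (P y) (fst u) = 0"
    using assms(2) cos_angle(1)[OF y] c_pos by (simp add: g_simps[OF q])
  have h: "fst u = 0" using assms(3) s c_pos unfolding \<beta>_eq' Pd Ph by simp
  have "d y u = 0" using assms(2) rp unfolding \<alpha>_eq[OF y] Pd Ph by simp
  then have "snd u \<bullet> w = 0" for w
    using g_nab_P[OF y, of u w] h by (simp add: g_simps[OF q] linear_0[OF christoffel_linear_left[OF q]])
  then have "snd u = 0" using inner_eq_zero_iff by blast
  then show ?thesis using h by (simp add: prod_eq_iff)
qed

end


text \<open>\<open>G\<close> and \<open>J\<close> in terms of the horizontal part \<open>fst u\<close>, the vertical part \<open>d y u\<close> and \<open>P\<close>.\<close>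

locale cotangent_structure = cotangent_quadric U g A c lam
  for U :: "'e::euclidean_space set" and g :: "'e \<Rightarrow> 'e \<Rightarrow> 'e \<Rightarrow> real" and A c lam +
  fixes G :: "'e \<times> 'e \<Rightarrow> 'e \<times> 'e \<Rightarrow> 'e \<times> 'e \<Rightarrow> real" and J :: "'e \<times> 'e \<Rightarrow> 'e \<times> 'e \<Rightarrow> 'e \<times> 'e"
  assumes G: "y \<in> T0 \<Longrightarrow> G y u v =
      A * t y * (lam (t y))\<^sup>2 * g (fst y) (fst u) (fst v)
    + (c - A\<^sup>2 * t y * (lam (t y))\<^sup>2) / (A * t y) * g (fst y) (P y) (fst u) * g (fst y) (P y) (fst v)
    + (1 / (A * t y) * g (fst y) (d y u) (d y v)
    - (c - A\<^sup>2 * t y * ((lam (t y))\<^sup>2 + 2 * t y * deriv lam (t y) * (lam (t y) + t y * deriv lam (t y))))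
        / (A * (t y)\<^sup>2 * (2 * c - A\<^sup>2 * t y * (lam (t y))\<^sup>2))
        * g (fst y) (P y) (d y u) * g (fst y) (P y) (d y v))"
    and J_fst: "y \<in> T0 \<Longrightarrow> fst (J y u) =
      - ((1 / (A * t y * lam (t y))) *\<^sub>R d y u
      - ((c - A\<^sup>2 * t y * lam (t y) * (lam (t y) + t y * deriv lam (t y)))
          / (A * (t y)\<^sup>2 * lam (t y) * (2 * c - A\<^sup>2 * t y * (lam (t y))\<^sup>2))
          * g (fst y) (P y) (d y u)) *\<^sub>R P y)"
    and J_snd: "y \<in> T0 \<Longrightarrow> d y (J y u) =
      (A * t y * lam (t y)) *\<^sub>R fst u
      + ((c - A\<^sup>2 * t y * lam (t y) * (lam (t y) + t y * deriv lam (t y)))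
          / (A * t y * (lam (t y) + 2 * t y * deriv lam (t y))) * g (fst y) (P y) (fst u)) *\<^sub>R P y"
begin

lemma G_soldered:
  assumes y: "y \<in> T0"
  shows "G y u v = 2 / A * (g (fst y) (\<alpha> y u) (\<alpha> y v) + g (fst y) (\<beta> y u) (\<beta> y v))"
proof -
  have q: "fst y \<in> U" using y by auto
  let ?D = "A * (lam (t y) + 2 * t y * deriv lam (t y)) / (2 * r y * sqrt c * cos (angle y))"
  have rp: "r y > 0" by (rule r_pos[OF y])
  have sc: "(sqrt c)\<^sup>2 = c" "sqrt c > 0" using c_pos by simp_all
  \<comment> \<open>Each coefficient of \<open>G\<close> is replaced by its expression in \<open>r\<close> and the angle.\<close>
  note coeff = quadric_metric_coefficients[OF A_pos t_pos[OF y] lam_pos[OF t_pos[OF y]]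
      lam_bound[OF t_pos[OF y]] sc(2) rp cos_angle(1)[OF y] r_sq[OF y] _ _ refl,
      unfolded sc(1), OF refl cos_angle(2)[OF y], folded sin_angle[OF y], symmetric]
  have \<alpha>: "\<alpha> y v = (1 / r y) *\<^sub>R d y v - (g (fst y) (P y) (d y v) / (r y)^3
      + cos (angle y) * sqrt c * g (fst y) (P y) (fst v) / (r y)\<^sup>2) *\<^sub>R P y" for v
    unfolding \<alpha>_eq[OF y] by (simp add: algebra_simps)
  have \<beta>: "\<beta> y v = (sin (angle y) * sqrt c) *\<^sub>R fst v + (?D * g (fst y) (P y) (d y v) / r y
      - sin (angle y) * sqrt c * g (fst y) (P y) (fst v) / (r y)\<^sup>2) *\<^sub>R P y" for v
    unfolding \<beta>_eq[OF y] by (simp add: algebra_simps)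
  have left: "g (fst y) (a *\<^sub>R w - b *\<^sub>R P y) (a *\<^sub>R w' - b' *\<^sub>R P y) = g (fst y) w w' * a\<^sup>2
      - b' * g (fst y) (P y) w * a - b * g (fst y) (P y) w' * a + b * b' * (r y)\<^sup>2" for a b b' w w'
    using g_sym[OF q, of w "P y"] by (simp add: g_simps[OF q] g_PP[OF y] algebra_simps power2_eq_square)
  have right: "g (fst y) (a *\<^sub>R w + b *\<^sub>R P y) (a *\<^sub>R w' + b' *\<^sub>R P y) = a\<^sup>2 * g (fst y) w w'
      + a * b' * g (fst y) (P y) w + a * b * g (fst y) (P y) w' + b * b' * (r y)\<^sup>2" for a b b' w w'
    using g_sym[OF q, of w "P y"] by (simp add: g_simps[OF q] g_PP[OF y] algebra_simps power2_eq_square)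
  have r0: "r y \<noteq> 0" using rp by simp
  have \<alpha>\<alpha>: "g (fst y) (\<alpha> y u) (\<alpha> y v) = g (fst y) (d y u) (d y v) / (r y)\<^sup>2
      - g (fst y) (P y) (d y u) * g (fst y) (P y) (d y v) / ((r y)\<^sup>2)\<^sup>2
      + (cos (angle y))\<^sup>2 * (sqrt c)\<^sup>2 * g (fst y) (P y) (fst u) * g (fst y) (P y) (fst v) / (r y)\<^sup>2"
    unfolding \<alpha> left quadric_metric_expansion(1)[OF r0, symmetric] by (simp add: power_divide)
  have \<beta>\<beta>: "g (fst y) (\<beta> y u) (\<beta> y v) = (sin (angle y))\<^sup>2 * ((sqrt c)\<^sup>2 * g (fst y) (fst u) (fst v)
      - (sqrt c)\<^sup>2 * g (fst y) (P y) (fst u) * g (fst y) (P y) (fst v) / (r y)\<^sup>2)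
      + ?D\<^sup>2 * g (fst y) (P y) (d y u) * g (fst y) (P y) (d y v)"
    unfolding \<beta> right quadric_metric_expansion(2)[OF r0, symmetric] ..
  show ?thesis
    unfolding G[OF y] coeff(1-3) minus_equation_iff[THEN iffD1, OF coeff(4), symmetric] \<alpha>\<alpha> \<beta>\<beta> sc(1)
    by (simp add: algebra_simps diff_divide_distrib add_divide_distrib)
qed

lemma J_soldered:
  assumes y: "y \<in> T0"
  shows "\<alpha> y (J y u) = \<beta> y u" "\<beta> y (J y u) = - \<alpha> y u"
proof -
  have q: "fst y \<in> U" using y by auto
  have rp: "r y > 0" by (rule r_pos[OF y])
  have sc: "(sqrt c)\<^sup>2 = c" "sqrt c > 0" using c_pos by simp_all
  define l where "l = lam (t y)"
  define D where "D = A * (lam (t y) + 2 * t y * deriv lam (t y)) / (2 * r y * sqrt c * cos (angle y))"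
  define B where "B = (c - A\<^sup>2 * t y * lam (t y) * (lam (t y) + t y * deriv lam (t y)))
          / (A * t y * (lam (t y) + 2 * t y * deriv lam (t y)))"
  define E where "E = (c - A\<^sup>2 * t y * lam (t y) * (lam (t y) + t y * deriv lam (t y)))
          / (A * (t y)\<^sup>2 * lam (t y) * (2 * c - A\<^sup>2 * t y * (lam (t y))\<^sup>2))"
  define s where "s = sin (angle y)"
  define C where "C = cos (angle y)"
  define k where "k = sqrt c"
  have C: "2 * c - A\<^sup>2 * t y * (lam (t y))\<^sup>2 = 2 * (sqrt c)\<^sup>2 * C\<^sup>2"
    using cos_angle(2)[OF y] by (simp add: C_def sc(1))
  note coeff = quadric_complex_coefficients[OF A_pos t_pos[OF y] lam_pos[OF t_pos[OF y]]
      lam_mono[OF t_pos[OF y]] lam_bound[OF t_pos[OF y]] sc(2) rp _ r_sq[OF y] _ C _ _ _ ,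
      unfolded sc(1), of D B E, OF _ refl D_def[folded C_def] B_def E_def,
      folded sin_angle[OF y], folded s_def l_def k_def]
  \<comment> \<open>The factors by which \<open>J\<close> acts on the components along \<open>P\<close>.\<close>
  define mE where "mE = 1 / (A * t y * l) - 2 * t y * E"
  define mB where "mB = A * t y * l + 2 * t y * B"
  have co: "A * t y * l / r y = s * k" "C * k * mE / r y = D"
    "D * mB = C * k / r y"
    using coeff cos_angle(1)[OF y] unfolding C_def mE_def mB_def by blast+
  define Ph where "Ph = g (fst y) (P y) (fst u)"
  define Pd where "Pd = g (fst y) (P y) (d y u)"
  have tr: "2 * t y = (r y)\<^sup>2" using r_sq[OF y] by simp
  have PhJ: "g (fst y) (P y) (fst (J y u)) = - mE * Pd"
    unfolding J_fst[OF y] unfolding E_def[symmetric] unfolding l_def[symmetric] Pd_def mE_def tr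
    by (simp add: g_simps[OF q] g_PP[OF y] algebra_simps)
  have PdJ: "g (fst y) (P y) (d y (J y u)) = mB * Ph"
    unfolding J_snd[OF y] unfolding B_def[symmetric] unfolding l_def[symmetric] Ph_def mB_def tr
    by (simp add: g_simps[OF q] g_PP[OF y] algebra_simps)
  have \<alpha>: "\<alpha> y v = (1 / r y) *\<^sub>R d y v - (g (fst y) (P y) (d y v) / (r y)^3 + C * k * g (fst y) (P y) (fst v) / (r y)\<^sup>2) *\<^sub>R P y" for v
    unfolding \<alpha>_eq[OF y] C_def k_def by (simp add: algebra_simps)
  have \<beta>: "\<beta> y v = (s * k) *\<^sub>R fst v + (D * g (fst y) (P y) (d y v) / r y - s * k * g (fst y) (P y) (fst v) / (r y)\<^sup>2) *\<^sub>R P y" for v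
    unfolding \<beta>_eq[OF y] D_def[symmetric] s_def k_def by (simp add: algebra_simps)
  have "\<alpha> y (J y u) = (A * t y * l / r y) *\<^sub>R fst u
     + (B * Ph / r y - mB * Ph / (r y)^3 + C * k * mE * Pd / (r y)\<^sup>2) *\<^sub>R P y"
    unfolding \<alpha> PhJ PdJ unfolding J_snd[OF y] unfolding B_def[symmetric] unfolding l_def[symmetric] Ph_def[symmetric]
    by (simp add: algebra_simps)
  also have "B * Ph / r y - mB * Ph / (r y)^3 + C * k * mE * Pd / (r y)\<^sup>2
     = - (A * t y * l / r y) * Ph / (r y)\<^sup>2 + (C * k * mE / r y) * Pd / r y"
    unfolding mB_def tr using rp by (simp add: field_simps power2_eq_square power3_eq_cube)
  finally show "\<alpha> y (J y u) = \<beta> y u"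
    unfolding co \<beta> Ph_def Pd_def by (simp add: algebra_simps)
  have "\<beta> y (J y u) = - ((s * k) * (1 / (A * t y * l))) *\<^sub>R d y u
     + (s * k * E * Pd + D * mB * Ph / r y + s * k * mE * Pd / (r y)\<^sup>2) *\<^sub>R P y"
    unfolding \<beta> PhJ PdJ unfolding J_fst[OF y] unfolding E_def[symmetric] unfolding l_def[symmetric] Pd_def[symmetric]
    by (simp add: algebra_simps)
  also have "\<dots> = - (1 / r y) *\<^sub>R d y u + (Pd / (r y)^3 + C * k * Ph / (r y)\<^sup>2) *\<^sub>R P y"
  proof -
    have Atl: "A * t y * l > 0" using A_pos t_pos[OF y] lam_pos[OF t_pos[OF y]] by (simp add: l_def)
    have 1: "(s * k) * (1 / (A * t y * l)) = 1 / r y"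
    proof -
      have "a / r y * (1 / a) = 1 / r y" if "a > 0" for a :: real using that by simp
      from this[OF Atl] show ?thesis unfolding co(1) .
    qed
    have "s * k * E * Pd + D * mB * Ph / r y + s * k * mE * Pd / (r y)\<^sup>2
      = ((s * k) * (1 / (A * t y * l))) * Pd / (r y)\<^sup>2 + (D * mB) * Ph / r y"
      unfolding mE_def tr using rp by (simp add: field_simps)
    also have "\<dots> = Pd / (r y)^3 + C * k * Ph / (r y)\<^sup>2"
      unfolding 1 co(3) by (simp add: power2_eq_square power3_eq_cube)
    finally show ?thesis unfolding 1 by simp
  qed
  finally show "\<beta> y (J y u) = - \<alpha> y u"
    unfolding \<alpha> Ph_def Pd_def by (simp add: algebra_simps)
qed

sublocale Q: soldered_quadric T0 "\<lambda>y. g (fst y)" "\<lambda>y u. \<Gamma> (fst y) (fst u)"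
  "\<lambda>y u. sqrt c *\<^sub>R fst u" direction angle "2 / A" G J
  by (rule soldered_quadric.intro[OF K.quadric_soldering_axioms], rule soldered_quadric_axioms.intro)
     (simp, (rule soldering_injective G_soldered J_soldered; assumption)+)

end


section \<open>Coordinate expressions\<close>

lemma linear_axis_expand:
  fixes f :: "real^'n \<Rightarrow> 'b::real_vector"
  assumes "linear f"
  shows "f u = (\<Sum>i\<in>UNIV. (u $ i) *\<^sub>R f (axis i 1))"
proof -
  have "f u = f (\<Sum>i\<in>UNIV. (u $ i) *\<^sub>R axis i 1)"
    using basis_expansion[of u] by (simp add: scalar_mult_eq_scaleR)
  then show ?thesis using assms by (simp add: linear_sum linear_scale)
qed

locale vec_chart = riemannian_chart U g
  for U :: "(real^'n::finite) set" and g :: "real^'n \<Rightarrow> real^'n \<Rightarrow> real^'n \<Rightarrow> real"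
begin

lemma g_lo_mult:
  assumes q: "q \<in> U"
  shows "(g_lo g q *v u) \<bullet> w = g q u w"
proof -
  have "g q u w = (\<Sum>i\<in>UNIV. u $ i * g q (axis i 1) w)"
    using linear_axis_expand[OF g_linear(1)[OF q], of u w] by simp
  also have "\<dots> = (\<Sum>i\<in>UNIV. \<Sum>j\<in>UNIV. u $ i * (w $ j * g q (axis j 1) (axis i 1)))"
  proof -
    have "g q (axis i 1) w = (\<Sum>j\<in>UNIV. w $ j * g q (axis j 1) (axis i 1))" for i
      using linear_axis_expand[OF g_linear(1)[OF q, of "axis i 1"], of w] g_sym[OF q, of "axis i 1" w] by simp
    then show ?thesis by (simp add: sum_distrib_left)
  qed
  also have "\<dots> = (\<Sum>j\<in>UNIV. \<Sum>i\<in>UNIV. u $ i * (w $ j * g q (axis j 1) (axis i 1)))" by (rule sum.swap)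
  also have "\<dots> = (g_lo g q *v u) \<bullet> w"
    by (simp add: inner_vec_def matrix_vector_mult_def g_lo_def sum_distrib_left sum_distrib_right mult_ac)
  finally show ?thesis by simp
qed

lemma g_lo_sum:
  assumes q: "q \<in> U"
  shows "(\<Sum>i\<in>UNIV. \<Sum>j\<in>UNIV. g_lo g q $ i $ j * u $ i * w $ j) = g q u w"
  using g_lo_mult[OF q, of w u] g_sym[OF q, of u w]
  by (simp add: inner_vec_def matrix_vector_mult_def sum_distrib_left sum_distrib_right mult_ac)

text \<open>The matrix of the metric is injective because the metric is positive definite, so the choice in the
  definition of the inverse matrix is effective.\<close>

lemma g_up_inverse:
  assumes q: "q \<in> U"
  shows "g_lo g q *v (g_up g q *v p) = p" "transpose (g_up g q) = g_up g q"
proof -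
  let ?A = "g_lo g q"
  have inj: "inj ((*v) ?A)"
  proof (subst linear_injective_0[OF matrix_vector_mul_linear], intro allI impI)
    fix z assume "?A *v z = 0"
    then have "g q z z = 0" using g_lo_mult[OF q, of z z] by simp
    then show "z = 0" using g_pos[OF q, of z] by (cases "z = 0") auto
  qed
  then have inv: "invertible ?A"
    unfolding invertible_left_inverse matrix_left_invertible_injective by simp
  have "\<exists>A'. ?A ** A' = mat 1 \<and> A' ** ?A = mat 1" using inv unfolding invertible_def .
  from someI_ex[OF this] have 1: "?A ** g_up g q = mat 1" "g_up g q ** ?A = mat 1"
    unfolding g_up_def matrix_inv_def by auto
  then show "?A *v (g_up g q *v p) = p" by (simp add: matrix_vector_mul_assoc)
  have tr: "transpose ?A = ?A" by (simp add: transpose_def g_lo_def g_sym[OF q] vec_eq_iff)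
  have "transpose (?A ** g_up g q) = mat 1" unfolding 1(1) by (rule transpose_mat)
  then have 2: "transpose (g_up g q) ** ?A = mat 1" by (simp add: matrix_transpose_mul tr)
  have "transpose (g_up g q) = transpose (g_up g q) ** (?A ** g_up g q)" unfolding 1 by simp
  also have "\<dots> = g_up g q" unfolding matrix_mul_assoc 2 by simp
  finally show "transpose (g_up g q) = g_up g q" .
qed

lemma sharp_g_up: "q \<in> U \<Longrightarrow> sharp q p = g_up g q *v p"
  using g_lo_mult[of q "g_up g q *v p"] g_up_inverse(1)[of q p] by (intro sharp_eqI) (auto simp: inner_commute)

lemma g0_up_sharp:
  assumes q: "q \<in> U"
  shows "g0_up g q p i = sharp q p $ i"
proof -
  have "g_up g q $ h $ i = g_up g q $ i $ h" for h
    using g_up_inverse(2)[OF q] unfolding transpose_def vec_eq_iff by simp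
  then show ?thesis
    by (simp add: g0_up_def sharp_g_up[OF q] matrix_vector_mult_def mult.commute)
qed

lemma g_up_sum:
  assumes q: "q \<in> U"
  shows "(\<Sum>i\<in>UNIV. \<Sum>j\<in>UNIV. g_up g q $ i $ j * p $ i * p' $ j) = g q (sharp q p) (sharp q p')"
proof -
  have "(\<Sum>i\<in>UNIV. \<Sum>j\<in>UNIV. g_up g q $ i $ j * p $ i * p' $ j) = p \<bullet> (g_up g q *v p')"
    by (simp add: inner_vec_def matrix_vector_mult_def sum_distrib_left mult_ac)
  then show ?thesis using g_sharp[OF q, of p "g_up g q *v p'"] by (simp add: sharp_g_up[OF q])
qed

lemma energy_eq: "y \<in> T0 \<Longrightarrow> energy g (fst y) (snd y) = t y"
  using g_up_sum[of "fst y" "snd y" "snd y"] by (auto simp: energy_def t_def P_def)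

definition Dvec :: "(real^'n) \<times> (real^'n) \<Rightarrow> (real^'n) \<times> (real^'n) \<Rightarrow> real^'n" where
  "Dvec y v = (\<chi> i. Dp g (fst y) (snd y) i v)"

lemma Gamma0_eq: "Gamma0 g q p i h = p \<bullet> \<Gamma> q (axis i 1) (axis h 1)"
  by (simp add: Gamma0_def inner_vec_def)

lemma Gamma0_sum:
  assumes q: "q \<in> U"
  shows "(\<Sum>j\<in>UNIV. Gamma0 g q p i j * u $ j) = p \<bullet> \<Gamma> q (axis i 1) u"
  using linear_axis_expand[OF christoffel_linear[OF q], of "axis i 1" u]
  by (simp add: Gamma0_eq inner_sum_right mult.commute)

lemma Dvec_inner:
  assumes y: "y \<in> T0"
  shows "Dvec y v \<bullet> w = snd v \<bullet> w - snd y \<bullet> \<Gamma> (fst y) (fst v) w"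
proof -
  have q: "fst y \<in> U" using y by auto
  have "Dvec y v \<bullet> w = (\<Sum>i\<in>UNIV. (snd v $ i - snd y \<bullet> \<Gamma> (fst y) (axis i 1) (fst v)) * w $ i)"
    unfolding inner_vec_def[of "Dvec y v"] by (simp add: Dvec_def Dp_def Gamma0_sum[OF q])
  also have "\<dots> = snd v \<bullet> w - snd y \<bullet> (\<Sum>i\<in>UNIV. (w $ i) *\<^sub>R \<Gamma> (fst y) (axis i 1) (fst v))"
    by (simp add: inner_sum_right inner_vec_def[of "snd v"] sum_subtractf algebra_simps)
  also have "(\<Sum>i\<in>UNIV. (w $ i) *\<^sub>R \<Gamma> (fst y) (axis i 1) (fst v)) = \<Gamma> (fst y) (fst v) w"
    using linear_axis_expand[OF christoffel_linear_left[OF q], of w "fst v"] christoffel_sym[OF q, of w] by simp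
  finally show ?thesis .
qed

lemma sharp_Dvec:
  assumes y: "y \<in> T0"
  shows "sharp (fst y) (Dvec y v) = X.nab P y v"
  using y by (intro sharp_eqI) (auto simp: g_nab_P[OF y] Dvec_inner[OF y])

lemma G_diag_eq:
  assumes y: "y \<in> T0" and h: "h \<alpha> = g"
  shows "G_diag A c lam h \<alpha> y u v =
      A * t y * (lam (t y))\<^sup>2 * g (fst y) (fst u) (fst v)
    + (c - A\<^sup>2 * t y * (lam (t y))\<^sup>2) / (A * t y) * g (fst y) (P y) (fst u) * g (fst y) (P y) (fst v)
    + (1 / (A * t y) * g (fst y) (X.nab P y u) (X.nab P y v)
    - (c - A\<^sup>2 * t y * ((lam (t y))\<^sup>2 + 2 * t y * deriv lam (t y) * (lam (t y) + t y * deriv lam (t y))))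
        / (A * (t y)\<^sup>2 * (2 * c - A\<^sup>2 * t y * (lam (t y))\<^sup>2))
        * g (fst y) (P y) (X.nab P y u) * g (fst y) (P y) (X.nab P y v))"
proof -
  have q: "fst y \<in> U" using y by auto
  have sums: "(\<Sum>i\<in>UNIV. \<Sum>j\<in>UNIV. (a * M $ i $ j + b * z $ i * z $ j) * x $ i * w $ j)
      = a * (\<Sum>i\<in>UNIV. \<Sum>j\<in>UNIV. M $ i $ j * x $ i * w $ j) + b * (z \<bullet> x) * (z \<bullet> w)"
    for a b :: real and M :: "real^'n^'n" and z x w :: "real^'n"
  proof -
    have "(z \<bullet> x) * (z \<bullet> w) = (\<Sum>i\<in>UNIV. \<Sum>j\<in>UNIV. (z $ i * x $ i) * (z $ j * w $ j))"
      by (simp add: inner_vec_def sum_product)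
    then show ?thesis
      by (simp add: sum_distrib_left sum.distrib[symmetric] algebra_simps)
  qed
  have zz: "sharp (fst y) (snd y) \<bullet> Dvec y v = g (fst y) (P y) (X.nab P y v)" for v
    using g_sharp[OF q, of "Dvec y v" "P y"] sharp_Dvec[OF y, of v] g_sym[OF q, of "P y"]
    by (simp add: P_def inner_commute)
  have ph: "snd y \<bullet> w = g (fst y) (P y) w" for w using g_P[OF y] by simp
  define a1 where "a1 = A * t y * (lam (t y))\<^sup>2"
  define b1 where "b1 = (c - A\<^sup>2 * t y * (lam (t y))\<^sup>2) / (A * t y)"
  define a2 where "a2 = 1 / (A * t y)"
  define b2 where "b2 = (c - A\<^sup>2 * t y * ((lam (t y))\<^sup>2 + 2 * t y * deriv lam (t y) * (lam (t y) + t y * deriv lam (t y))))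
        / (A * (t y)\<^sup>2 * (2 * c - A\<^sup>2 * t y * (lam (t y))\<^sup>2))"
  have G1: "G1 A c lam g (fst y) (snd y) i j = a1 * g_lo g (fst y) $ i $ j + b1 * snd y $ i * snd y $ j" for i j
    by (simp add: G1_def Let_def energy_eq[OF y] a1_def b1_def)
  have G2: "G2 A c lam g (fst y) (snd y) i j
      = a2 * g_up g (fst y) $ i $ j + (- b2) * sharp (fst y) (snd y) $ i * sharp (fst y) (snd y) $ j" for i j
    by (simp add: G2_def Let_def energy_eq[OF y] a2_def b2_def g0_up_sharp[OF q])
  have "G_diag A c lam h \<alpha> y u v =
     (\<Sum>i\<in>UNIV. \<Sum>j\<in>UNIV. G1 A c lam g (fst y) (snd y) i j * fst u $ i * fst v $ j)
   + (\<Sum>i\<in>UNIV. \<Sum>j\<in>UNIV. G2 A c lam g (fst y) (snd y) i j * Dvec y u $ i * Dvec y v $ j)"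
    by (simp add: G_diag_def h dq_def Dvec_def split_beta)
  also have "\<dots> = a1 * g (fst y) (fst u) (fst v) + b1 * g (fst y) (P y) (fst u) * g (fst y) (P y) (fst v)
     + (a2 * g (fst y) (X.nab P y u) (X.nab P y v) + (- b2) * g (fst y) (P y) (X.nab P y u) * g (fst y) (P y) (X.nab P y v))"
    unfolding G1 G2 sums g_lo_sum[OF q] g_up_sum[OF q] sharp_Dvec[OF y] zz ph ..
  finally show ?thesis by (simp add: a1_def b1_def a2_def b2_def)
qed

text \<open>In the adapted frame \<open>J\<close> exchanges the two parts, so its image is read off from \<open>fst\<close> and \<open>Dvec\<close>; the
  contribution of the connection to the fibre components of \<open>\<delta>/\<delta>q\<^sup>j\<close> is cancelled by the one in \<open>Dp\<close>.\<close>

lemma J_diag_components: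
  assumes y: "y \<in> T0" and h: "h \<alpha> = g"
  shows "fst (J_diag A c lam h \<alpha> y u) = - (\<chi> j. \<Sum>i\<in>UNIV. Dvec y u $ i * J2 A c lam g (fst y) (snd y) i j)"
    "Dvec y (J_diag A c lam h \<alpha> y u) = (\<chi> j. \<Sum>i\<in>UNIV. fst u $ i * J1 A c lam g (fst y) (snd y) i j)"
proof -
  have q: "fst y \<in> U" using y by auto
  let ?J1 = "J1 A c lam g (fst y) (snd y)" and ?J2 = "J2 A c lam g (fst y) (snd y)"
  let ?w = "- (\<chi> j. \<Sum>i\<in>UNIV. Dvec y u $ i * ?J2 i j)"
  have J: "J_diag A c lam h \<alpha> y u = (\<Sum>i\<in>UNIV. fst u $ i *\<^sub>R (\<Sum>j\<in>UNIV. ?J1 i j *\<^sub>R partial_p j))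
   + (\<Sum>i\<in>UNIV. Dvec y u $ i *\<^sub>R (- (\<Sum>j\<in>UNIV. ?J2 i j *\<^sub>R delta_q g (fst y) (snd y) j)))"
    by (simp add: J_diag_def h dq_def Dvec_def split_beta)
  have ax: "axis i (1::real) $ j = (if j = i then 1 else 0)" for i j :: 'n by (simp add: axis_def)
  show fJ: "fst (J_diag A c lam h \<alpha> y u) = ?w"
    unfolding J
    by (simp add: fst_sum partial_p_def delta_q_def vec_eq_iff ax if_distrib sum_negf
        sum_distrib_left cong: if_cong)
  have sJ: "snd (J_diag A c lam h \<alpha> y u) $ k = (\<Sum>i\<in>UNIV. fst u $ i * ?J1 i k)
     + (\<Sum>j\<in>UNIV. ?w $ j * Gamma0 g (fst y) (snd y) j k)" for k
  proof -
    have "snd (J_diag A c lam h \<alpha> y u) $ k = (\<Sum>i\<in>UNIV. fst u $ i * ?J1 i k)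
     - (\<Sum>i\<in>UNIV. \<Sum>j\<in>UNIV. Dvec y u $ i * (?J2 i j * Gamma0 g (fst y) (snd y) j k))"
      unfolding J
      by (simp add: snd_sum partial_p_def delta_q_def ax if_distrib sum_negf
          sum_distrib_left cong: if_cong)
    also have "(\<Sum>i\<in>UNIV. \<Sum>j\<in>UNIV. Dvec y u $ i * (?J2 i j * Gamma0 g (fst y) (snd y) j k))
      = (\<Sum>j\<in>UNIV. \<Sum>i\<in>UNIV. Dvec y u $ i * (?J2 i j * Gamma0 g (fst y) (snd y) j k))" by (rule sum.swap)
    finally show ?thesis by (simp add: sum_distrib_right sum_negf mult.assoc)
  qed
  have sym: "Gamma0 g (fst y) (snd y) j k = Gamma0 g (fst y) (snd y) k j" for j k
    by (simp add: Gamma0_eq christoffel_sym[OF q, of "axis j 1"])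
  show "Dvec y (J_diag A c lam h \<alpha> y u) = (\<chi> j. \<Sum>i\<in>UNIV. fst u $ i * ?J1 i j)"
    unfolding Dvec_def[of y "J_diag A c lam h \<alpha> y u"] Dp_def fJ sJ vec_eq_iff
    using sym by (simp add: mult.commute)
qed

lemma J_diag_fst:
  assumes y: "y \<in> T0" and h: "h \<alpha> = g"
  shows "fst (J_diag A c lam h \<alpha> y u) =
      - ((1 / (A * t y * lam (t y))) *\<^sub>R X.nab P y u
      - ((c - A\<^sup>2 * t y * lam (t y) * (lam (t y) + t y * deriv lam (t y)))
          / (A * (t y)\<^sup>2 * lam (t y) * (2 * c - A\<^sup>2 * t y * (lam (t y))\<^sup>2))
          * g (fst y) (P y) (X.nab P y u)) *\<^sub>R P y)"
proof -
  have q: "fst y \<in> U" using y by auto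
  define a where "a = 1 / (A * t y * lam (t y))"
  define b where "b = (c - A\<^sup>2 * t y * lam (t y) * (lam (t y) + t y * deriv lam (t y)))
          / (A * (t y)\<^sup>2 * lam (t y) * (2 * c - A\<^sup>2 * t y * (lam (t y))\<^sup>2))"
  have J2: "J2 A c lam g (fst y) (snd y) i j = a * g_up g (fst y) $ i $ j - b * P y $ i * P y $ j" for i j
    by (simp add: J2_def Let_def energy_eq[OF y] a_def b_def g0_up_sharp[OF q] P_def)
  have zz: "P y \<bullet> Dvec y u = g (fst y) (P y) (X.nab P y u)"
    using g_sharp[OF q, of "Dvec y u" "P y"] sharp_Dvec[OF y, of u] g_sym[OF q, of "P y"]
    by (simp add: inner_commute)
  have sy: "g_up g (fst y) $ i $ j = g_up g (fst y) $ j $ i" for i j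
    using g_up_inverse(2)[OF q] unfolding transpose_def vec_eq_iff by simp
  have "(\<chi> j. \<Sum>i\<in>UNIV. Dvec y u $ i * J2 A c lam g (fst y) (snd y) i j)
      = a *\<^sub>R (g_up g (fst y) *v Dvec y u) - (b * (P y \<bullet> Dvec y u)) *\<^sub>R P y"
    unfolding J2 vec_eq_iff using sy
    by (simp add: matrix_vector_mult_def inner_vec_def sum_distrib_left sum_distrib_right sum_subtractf algebra_simps)
  also have "g_up g (fst y) *v Dvec y u = X.nab P y u"
    using sharp_g_up[OF q] sharp_Dvec[OF y] by simp
  finally show ?thesis
    unfolding J_diag_components(1)[of y h, OF y h] zz by (simp only: a_def b_def)
qed

lemma J_diag_snd:
  assumes y: "y \<in> T0" and h: "h \<alpha> = g"
  shows "X.nab P y (J_diag A c lam h \<alpha> y u) =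
      (A * t y * lam (t y)) *\<^sub>R fst u
      + ((c - A\<^sup>2 * t y * lam (t y) * (lam (t y) + t y * deriv lam (t y)))
          / (A * t y * (lam (t y) + 2 * t y * deriv lam (t y))) * g (fst y) (P y) (fst u)) *\<^sub>R P y"
proof -
  have q: "fst y \<in> U" using y by auto
  define a where "a = A * t y * lam (t y)"
  define b where "b = (c - A\<^sup>2 * t y * lam (t y) * (lam (t y) + t y * deriv lam (t y)))
          / (A * t y * (lam (t y) + 2 * t y * deriv lam (t y)))"
  have J1: "J1 A c lam g (fst y) (snd y) i j = a * g_lo g (fst y) $ i $ j + b * snd y $ i * snd y $ j" for i j
    by (simp add: J1_def Let_def energy_eq[OF y] a_def b_def)
  have sy: "g_lo g (fst y) $ i $ j = g_lo g (fst y) $ j $ i" for i j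
    by (simp add: g_lo_def g_sym[OF q])
  have "Dvec y (J_diag A c lam h \<alpha> y u) = a *\<^sub>R (g_lo g (fst y) *v fst u) + (b * (snd y \<bullet> fst u)) *\<^sub>R snd y"
    unfolding J_diag_components(2)[of y h, OF y h] J1 vec_eq_iff using sy
    by (simp add: matrix_vector_mult_def inner_vec_def sum_distrib_left sum_distrib_right sum.distrib algebra_simps)
  then have "sharp (fst y) (Dvec y (J_diag A c lam h \<alpha> y u)) = a *\<^sub>R fst u + (b * (snd y \<bullet> fst u)) *\<^sub>R P y"
    by (intro sharp_eqI[OF q])
       (simp add: g_simps[OF q] inner_add_left g_lo_mult[OF q] g_P[OF y])
  then show ?thesis unfolding sharp_Dvec[OF y] using g_P[OF y] by (simp add: a_def b_def)
qed

end


section \<open>Changes of charts\<close>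

text \<open>An isometric change of coordinates \<open>\<phi>\<close> of the base and the induced change \<open>\<Phi>\<close> of the cotangent bundle, which
  is determined by the invariance of the pairing of covectors and vectors.\<close>

locale chart_change = I: vec_chart U g + J: vec_chart U' g'
  for U :: "(real^'n::finite) set" and g and U' :: "(real^'n) set" and g' +
  fixes W :: "(real^'n) set" and \<phi> :: "real^'n \<Rightarrow> real^'n"
    and \<Phi> :: "(real^'n) \<times> (real^'n) \<Rightarrow> (real^'n) \<times> (real^'n)"
  assumes open_W: "open W" and W_subset: "W \<subseteq> U" and \<phi>_maps: "\<phi> ` W \<subseteq> U'"
    and \<phi>_smooth: "smooth_on W \<phi>"
    and isometric: "q \<in> W \<Longrightarrow> g q u v = g' (\<phi> q) (dird \<phi> q u) (dird \<phi> q v)"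
    and \<Phi>_fst: "y \<in> W \<times> (- {0}) \<Longrightarrow> fst (\<Phi> y) = \<phi> (fst y)"
    and \<Phi>_snd: "y \<in> W \<times> (- {0}) \<Longrightarrow> snd (\<Phi> y) \<bullet> dird \<phi> (fst y) h = snd y \<bullet> h"
begin

abbreviation W0 :: "((real^'n) \<times> (real^'n)) set" where "W0 \<equiv> W \<times> (- {0})"

lemma open_W0: "open W0"
  by (intro open_Times open_W) auto

lemma d\<phi>:
  assumes q: "q \<in> W"
  shows "linear (dird \<phi> q)" "inj (dird \<phi> q)" "\<exists>h. w = dird \<phi> q h"
proof -
  show l: "linear (dird \<phi> q)"
    by (rule has_derivative_linear[OF smooth_on_has_derivative[OF \<phi>_smooth q]])
  have q': "q \<in> U" "\<phi> q \<in> U'" using q W_subset \<phi>_maps by auto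
  show i: "inj (dird \<phi> q)"
  proof (subst linear_injective_0[OF l], intro allI impI)
    fix u assume "dird \<phi> q u = 0"
    then have "g q u u = 0" using isometric[OF q, of u u] by (simp add: J.g_simps[OF q'(2)])
    then show "u = 0" using I.g_pos[OF q'(1), of u] by (cases "u = 0") auto
  qed
  show "\<exists>h. w = dird \<phi> q h"
    using surjD[OF linear_injective_imp_surjective[OF l i]] by blast
qed

sublocale E: metric_connection W "\<lambda>q. g' (\<phi> q)" "\<lambda>q u. J.\<Gamma> (\<phi> q) (dird \<phi> q u)"
proof (rule metric_connection.intro)
  show "open W" by (rule open_W)
  show "smooth_on W (\<lambda>q. g' (\<phi> q) a b)" for a b
    by (rule smooth_on_compose[OF open_W \<phi>_smooth \<phi>_maps J.g_smooth])
  show "smooth_on W (\<lambda>q. J.\<Gamma> (\<phi> q) (dird \<phi> q u) a)" for u a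
  proof (rule smooth_on_linear_family[where f = "\<lambda>q v. J.\<Gamma> (\<phi> q) v a", OF open_W _ _ smooth_on_dird[OF \<phi>_smooth]])
    show "linear (\<lambda>v. J.\<Gamma> (\<phi> x) v a)" if "x \<in> W" for x
      by (rule J.christoffel_linear_left) (use that \<phi>_maps in auto)
    show "smooth_on W (\<lambda>q. J.\<Gamma> (\<phi> q) b a)" for b
      by (rule smooth_on_compose[OF open_W \<phi>_smooth \<phi>_maps J.christoffel_smooth])
  qed
  fix q assume q: "q \<in> W"
  then have q': "\<phi> q \<in> U'" using \<phi>_maps by auto
  show "bilinear (g' (\<phi> q))" by (rule J.g_bilinear[OF q'])
  show "g' (\<phi> q) a b = g' (\<phi> q) b a" for a b by (rule J.g_sym[OF q'])
  show "g' (\<phi> q) a a > 0" if "a \<noteq> 0" for a by (rule J.g_pos[OF q' that])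
  show "linear (J.\<Gamma> (\<phi> q) (dird \<phi> q u))" for u by (rule J.christoffel_linear[OF q'])
  show "linear (\<lambda>u. J.\<Gamma> (\<phi> q) (dird \<phi> q u) a)" for a
    using linear_compose[OF d\<phi>(1)[OF q] J.christoffel_linear_left[OF q', of a]] by (simp add: o_def)
  show "dird (\<lambda>x. g' (\<phi> x) a b) q u
      = g' (\<phi> q) (J.\<Gamma> (\<phi> q) (dird \<phi> q u) a) b + g' (\<phi> q) a (J.\<Gamma> (\<phi> q) (dird \<phi> q u) b)" for u a b
    by (subst dird_compose[OF smooth_on_differentiable[OF \<phi>_smooth q] smooth_on_differentiable[OF J.g_smooth q']])
       (rule J.metric_compatible[OF q'])
qed

text \<open>The transformation law of the Christoffel symbols is the uniqueness of the Levi-Civita connection: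
  \<open>d\<phi>\<close> is torsion-free from the tangent bundle to the bundle pulled back along \<open>\<phi>\<close>, by the symmetry of second
  derivatives.\<close>

sublocale E: soldered_bundle W "\<lambda>q. g' (\<phi> q)" "\<lambda>q u. J.\<Gamma> (\<phi> q) (dird \<phi> q u)" "\<lambda>q u. dird \<phi> q u" g
proof (rule soldered_bundle.intro[OF E.metric_connection_axioms], rule soldered_bundle_axioms.intro)
  show "smooth_on W (\<lambda>q. dird \<phi> q u)" for u by (rule smooth_on_dird[OF \<phi>_smooth])
  fix q assume q: "q \<in> W"
  then have q': "\<phi> q \<in> U'" using \<phi>_maps by auto
  show "linear (\<lambda>u. dird \<phi> q u)" by (rule d\<phi>(1)[OF q])
  show "inj (\<lambda>u. dird \<phi> q u)" by (rule d\<phi>(2)[OF q])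
  show "g q u v = g' (\<phi> q) (dird \<phi> q u) (dird \<phi> q v)" for u v by (rule isometric[OF q])
  show "E.nab (\<lambda>x. dird \<phi> x v) q u = E.nab (\<lambda>x. dird \<phi> x u) q v" for u v
    unfolding E.nab_def
    using dird_dird_commute[OF open_W q \<phi>_smooth, of v u] J.christoffel_sym[OF q', of "dird \<phi> q u"] by simp
qed (rule refl)

lemma christoffel_transformation:
  "q \<in> W \<Longrightarrow> dird \<phi> q (I.\<Gamma> q u v)
    = dird (\<lambda>x. dird \<phi> x v) q u + J.\<Gamma> (\<phi> q) (dird \<phi> q u) (dird \<phi> q v)"
  using E.christoffel_solder[of q u v] by (simp add: E.nab_def)

lemma \<Phi>_in:
  assumes y: "y \<in> W0"
  shows "y \<in> I.T0" "\<Phi> y \<in> J.T0"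
proof -
  show "y \<in> I.T0" using y W_subset by auto
  have "snd (\<Phi> y) \<noteq> 0" using \<Phi>_snd[OF y, of "snd y"] y by auto
  then show "\<Phi> y \<in> J.T0" using \<Phi>_fst[OF y] y \<phi>_maps by (auto simp: mem_Times_iff)
qed

lemma snd_\<Phi>_smooth: "smooth_on W0 (\<lambda>y. snd (\<Phi> y))"
proof (rule smooth_on_linear_system_solution[where f = "\<lambda>y z. \<Sum>b\<in>Basis. (z \<bullet> dird \<phi> (fst y) b) *\<^sub>R b" and h = snd, OF open_W0])
  fix y assume y: "y \<in> W0"
  then have q: "fst y \<in> W" by auto
  let ?f = "\<lambda>z. \<Sum>b\<in>Basis. (z \<bullet> dird \<phi> (fst y) b) *\<^sub>R b"
  show l: "linear ?f"
    by (rule linearI) (simp_all add: inner_add_left scaleR_add_left sum.distrib scaleR_sum_right)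
  show "inj ?f"
  proof (subst linear_injective_0[OF l], intro allI impI)
    fix z assume "?f z = 0"
    then have "?f z \<bullet> b = 0" for b by simp
    then have b: "z \<bullet> dird \<phi> (fst y) b = 0" if "b \<in> Basis" for b
      using inner_sum_left_Basis[OF that, of "\<lambda>b. z \<bullet> dird \<phi> (fst y) b"] by metis
    have "linear (\<lambda>h. z \<bullet> dird \<phi> (fst y) h)"
      using linear_compose[OF d\<phi>(1)[OF q] bounded_linear.linear[OF bounded_linear_inner_right[of z]]]
      by (simp add: o_def)
    from linear_family_expand[of "\<lambda>_. \<lambda>h. z \<bullet> dird \<phi> (fst y) h", OF this] b
    have "z \<bullet> dird \<phi> (fst y) h = 0" for h by simp
    moreover obtain h where "z = dird \<phi> (fst y) h" using d\<phi>(3)[OF q] by blast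
    ultimately have "z \<bullet> z = 0" by metis
    then show "z = 0" by simp
  qed
  show "?f (snd (\<Phi> y)) = snd y"
    unfolding \<Phi>_snd[OF y] by (rule euclidean_representation)
next
  show "smooth_on W0 (\<lambda>y. \<Sum>b\<in>Basis. (a \<bullet> dird \<phi> (fst y) b) *\<^sub>R b)" for a
  proof (rule smooth_on_sum[OF open_W0])
    fix b :: "real^'n"
    have "smooth_on W0 (\<lambda>y. dird \<phi> (fst y) b)"
      by (rule smooth_on_compose_fst[OF open_W _ smooth_on_dird[OF \<phi>_smooth]]) auto
    then show "smooth_on W0 (\<lambda>y. (a \<bullet> dird \<phi> (fst y) b) *\<^sub>R b)"
      by (intro smooth_on_scaleR smooth_on_inner smooth_on_const open_W0)
  qed
  show "smooth_on W0 snd" by (rule smooth_on_snd[OF open_W0])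
qed

lemma d\<Phi>:
  assumes y: "y \<in> W0"
  shows "fst (dird \<Phi> y u) = dird \<phi> (fst y) (fst u)"
    "snd (dird \<Phi> y u) \<bullet> dird \<phi> (fst y) h + snd (\<Phi> y) \<bullet> dird (\<lambda>x. dird \<phi> x h) (fst y) (fst u) = snd u \<bullet> h"
proof -
  have q: "fst y \<in> W" using y by auto
  have 1: "((\<lambda>x. \<phi> (fst x)) has_derivative (\<lambda>u. dird \<phi> (fst y) (fst u))) (at y)"
    using diff_chain_at[OF has_derivative_fst[OF has_derivative_ident] smooth_on_has_derivative[OF \<phi>_smooth q]]
    by (simp add: o_def)
  have 2: "((\<lambda>x. snd (\<Phi> x)) has_derivative (\<lambda>u. dird (\<lambda>x. snd (\<Phi> x)) y u)) (at y)"
    by (rule smooth_on_has_derivative[OF snd_\<Phi>_smooth y])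
  have "(\<Phi> has_derivative (\<lambda>u. (dird \<phi> (fst y) (fst u), dird (\<lambda>x. snd (\<Phi> x)) y u))) (at y)"
    by (rule has_derivative_transform_within_open[OF has_derivative_Pair[OF 1 2] open_W0 y])
       (simp add: \<Phi>_fst[symmetric] prod_eq_iff)
  then have d: "dird \<Phi> y u = (dird \<phi> (fst y) (fst u), dird (\<lambda>x. snd (\<Phi> x)) y u)" for u
    by (simp add: dird_eqI)
  then show "fst (dird \<Phi> y u) = dird \<phi> (fst y) (fst u)" by simp
  have 3: "((\<lambda>x. dird \<phi> (fst x) h) has_derivative (\<lambda>u. dird (\<lambda>x. dird \<phi> x h) (fst y) (fst u))) (at y)"
    using diff_chain_at[OF has_derivative_fst[OF has_derivative_ident] smooth_on_has_derivative[OF smooth_on_dird[OF \<phi>_smooth] q]]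
    by (simp add: o_def)
  have 4: "((\<lambda>x. snd x \<bullet> h) has_derivative (\<lambda>u. snd (\<Phi> y) \<bullet> dird (\<lambda>x. dird \<phi> x h) (fst y) (fst u)
      + dird (\<lambda>x. snd (\<Phi> x)) y u \<bullet> dird \<phi> (fst y) h)) (at y)"
    by (rule has_derivative_transform_within_open[OF has_derivative_inner[OF 2 3] open_W0 y]) (rule \<Phi>_snd)
  have 5: "((\<lambda>x. snd x \<bullet> h) has_derivative (\<lambda>u. snd u \<bullet> h)) (at y)"
    by (rule has_derivative_inner_left[OF has_derivative_snd[OF has_derivative_ident]])
  show "snd (dird \<Phi> y u) \<bullet> dird \<phi> (fst y) h + snd (\<Phi> y) \<bullet> dird (\<lambda>x. dird \<phi> x h) (fst y) (fst u) = snd u \<bullet> h"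
    using fun_cong[OF has_derivative_unique[OF 4 5], of u] by (simp add: d)
qed

lemma P_\<Phi>:
  assumes y: "y \<in> W0"
  shows "J.P (\<Phi> y) = dird \<phi> (fst y) (I.P y)"
proof (rule J.g_nondegenerate)
  have q: "fst y \<in> W" using y by auto
  show "fst (\<Phi> y) \<in> U'" using \<Phi>_in(2)[OF y] by auto
  fix w
  obtain h where w: "w = dird \<phi> (fst y) h" using d\<phi>(3)[OF q] by blast
  show "g' (fst (\<Phi> y)) (J.P (\<Phi> y)) w = g' (fst (\<Phi> y)) (dird \<phi> (fst y) (I.P y)) w"
    unfolding J.g_P[OF \<Phi>_in(2)[OF y]] w \<Phi>_snd[OF y] unfolding \<Phi>_fst[OF y] isometric[OF q, symmetric]
    by (rule I.g_P[OF \<Phi>_in(1)[OF y], symmetric])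
qed

lemma t_\<Phi>:
  assumes y: "y \<in> W0"
  shows "J.t (\<Phi> y) = I.t y"
proof -
  have q: "fst y \<in> W" using y by auto
  show ?thesis unfolding J.t_def I.t_def P_\<Phi>[OF y] \<Phi>_fst[OF y] isometric[OF q] ..
qed

text \<open>The vertical part of a tangent vector is a tensor: the second derivatives of \<open>\<phi>\<close> in the derivative of \<open>\<Phi>\<close>
  cancel against those in the transformation of the Christoffel symbols.\<close>

lemma nab_P_\<Phi>:
  assumes y: "y \<in> W0"
  shows "J.X.nab J.P (\<Phi> y) (dird \<Phi> y u) = dird \<phi> (fst y) (I.X.nab I.P y u)"
proof (rule J.g_nondegenerate)
  have q: "fst y \<in> W" using y by auto
  show "fst (\<Phi> y) \<in> U'" using \<Phi>_in(2)[OF y] by auto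
  fix w
  obtain h where w: "w = dird \<phi> (fst y) h" using d\<phi>(3)[OF q] by blast
  have "snd (dird \<Phi> y u) \<bullet> dird \<phi> (fst y) h
      - snd (\<Phi> y) \<bullet> J.\<Gamma> (\<phi> (fst y)) (dird \<phi> (fst y) (fst u)) (dird \<phi> (fst y) h)
    = snd u \<bullet> h - snd (\<Phi> y) \<bullet> dird \<phi> (fst y) (I.\<Gamma> (fst y) (fst u) h)"
    unfolding christoffel_transformation[OF q] using d\<Phi>(2)[OF y, of u h] by (simp add: inner_add_right)
  also have "\<dots> = snd u \<bullet> h - snd y \<bullet> I.\<Gamma> (fst y) (fst u) h" unfolding \<Phi>_snd[OF y] ..
  finally show "g' (fst (\<Phi> y)) (J.X.nab J.P (\<Phi> y) (dird \<Phi> y u)) w = g' (fst (\<Phi> y)) (dird \<phi> (fst y) (I.X.nab I.P y u)) w"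
    unfolding J.g_nab_P[OF \<Phi>_in(2)[OF y]] w unfolding \<Phi>_fst[OF y] d\<Phi>(1)[OF y] isometric[OF q, symmetric]
      I.g_nab_P[OF \<Phi>_in(1)[OF y]] .
qed

lemma isometric':
  "y \<in> W0 \<Longrightarrow> g' (fst (\<Phi> y)) (dird \<phi> (fst y) u) (dird \<phi> (fst y) v) = g (fst y) u v"
  using isometric[of "fst y" u v] \<Phi>_fst by auto

text \<open>\<open>G\<close> and \<open>J\<close> are expressed by the metric, \<open>P\<close>, \<open>t\<close> and the horizontal and vertical parts, all of which are
  carried to each other.\<close>

lemma G_diag_invariant:
  assumes y: "y \<in> W0" and h: "h \<alpha> = g" "h \<beta> = g'"
  shows "G_diag A c lam h \<alpha> y u v = G_diag A c lam h \<beta> (\<Phi> y) (dird \<Phi> y u) (dird \<Phi> y v)"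
  unfolding I.G_diag_eq[of y h, OF \<Phi>_in(1)[OF y] h(1)] J.G_diag_eq[of "\<Phi> y" h, OF \<Phi>_in(2)[OF y] h(2)]
    nab_P_\<Phi>[OF y] P_\<Phi>[OF y] t_\<Phi>[OF y] d\<Phi>(1)[OF y] isometric'[OF y] ..

lemma J_diag_equivariant:
  assumes y: "y \<in> W0" and h: "h \<alpha> = g" "h \<beta> = g'"
  shows "dird \<Phi> y (J_diag A c lam h \<alpha> y u) = J_diag A c lam h \<beta> (\<Phi> y) (dird \<Phi> y u)"
proof -
  have q: "fst y \<in> W" using y by auto
  have y': "\<Phi> y \<in> J.T0" by (rule \<Phi>_in(2)[OF y])
  have lin: "dird \<phi> (fst y) (- a) = - dird \<phi> (fst y) a" "dird \<phi> (fst y) (a - b) = dird \<phi> (fst y) a - dird \<phi> (fst y) b"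
    "dird \<phi> (fst y) (a + b) = dird \<phi> (fst y) a + dird \<phi> (fst y) b" "dird \<phi> (fst y) (r *\<^sub>R a) = r *\<^sub>R dird \<phi> (fst y) a" for a b r
    using linear_neg[OF d\<phi>(1)[OF q]] linear_diff[OF d\<phi>(1)[OF q]] linear_add[OF d\<phi>(1)[OF q]] linear_scale[OF d\<phi>(1)[OF q]]
    by auto
  have fst: "fst (dird \<Phi> y (J_diag A c lam h \<alpha> y u)) = fst (J_diag A c lam h \<beta> (\<Phi> y) (dird \<Phi> y u))"
    unfolding d\<Phi>(1)[OF y] I.J_diag_fst[of y h, OF \<Phi>_in(1)[OF y] h(1)] J.J_diag_fst[of "\<Phi> y" h, OF y' h(2)]
      nab_P_\<Phi>[OF y] P_\<Phi>[OF y] t_\<Phi>[OF y] isometric'[OF y] lin ..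
  have nab: "J.X.nab J.P (\<Phi> y) (dird \<Phi> y (J_diag A c lam h \<alpha> y u)) = J.X.nab J.P (\<Phi> y) (J_diag A c lam h \<beta> (\<Phi> y) (dird \<Phi> y u))"
    unfolding nab_P_\<Phi>[OF y] I.J_diag_snd[of y h, OF \<Phi>_in(1)[OF y] h(1)] J.J_diag_snd[of "\<Phi> y" h, OF y' h(2)]
      P_\<Phi>[OF y] t_\<Phi>[OF y] d\<Phi>(1)[OF y] isometric'[OF y] lin ..
  have "snd (dird \<Phi> y (J_diag A c lam h \<alpha> y u)) \<bullet> w = snd (J_diag A c lam h \<beta> (\<Phi> y) (dird \<Phi> y u)) \<bullet> w" for w
    using J.g_nab_P[OF y', of "dird \<Phi> y (J_diag A c lam h \<alpha> y u)" w]
      J.g_nab_P[OF y', of "J_diag A c lam h \<beta> (\<Phi> y) (dird \<Phi> y u)" w] unfolding nab fst by simp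
  then have "\<forall>w. snd (dird \<Phi> y (J_diag A c lam h \<alpha> y u)) \<bullet> w = snd (J_diag A c lam h \<beta> (\<Phi> y) (dird \<Phi> y u)) \<bullet> w"
    by (rule allI)
  then have "snd (dird \<Phi> y (J_diag A c lam h \<alpha> y u)) = snd (J_diag A c lam h \<beta> (\<Phi> y) (dird \<Phi> y u))"
    by (rule vector_eq_rdot[THEN iffD1])
  then show ?thesis using fst by (simp add: prod_eq_iff)
qed

end


section \<open>The atlas of the nonzero cotangent bundle\<close>

lemma chart_range_open:
  assumes "smooth_manifold M" "i \<in> chart_ix M"
  shows "open (chart_range M i)"
  using assms unfolding smooth_manifold_def chart_range_def by (metis Int_absorb)

lemma cotangent0_ix: "chart_ix (cotangent0 M) = chart_ix M"
  by (simp add: cotangent0_def)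

lemma transition_point:
  assumes "smooth_manifold M" "i \<in> chart_ix M" "x \<in> chart_dom M i"
  shows "transition M i j (chart_map M i x) = chart_map M j x"
  using assms by (simp add: transition_def smooth_manifold_def)

lemma jacobian_cocycle:
  assumes M: "smooth_manifold M" and ix: "i \<in> chart_ix M" "j \<in> chart_ix M" "k \<in> chart_ix M"
    and x: "x \<in> chart_dom M i" "x \<in> chart_dom M j" "x \<in> chart_dom M k"
  shows "jacobian M i k x u = jacobian M j k x (jacobian M i j x u)"
proof -
  let ?W = "chart_map M i ` (chart_dom M i \<inter> chart_dom M j)"
  let ?V = "chart_map M i ` (chart_dom M i \<inter> chart_dom M k)"
  have o: "open ?W" "open ?V" using M ix unfolding smooth_manifold_def by blast+
  have inj: "inj_on (chart_map M i) (chart_dom M i)" using M ix unfolding smooth_manifold_def by blast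
  have xin: "chart_map M i x \<in> ?W \<inter> ?V" using x by blast
  have d: "transition M a b differentiable (at (chart_map M a x))"
    if "a \<in> chart_ix M" "b \<in> chart_ix M" "x \<in> chart_dom M a" "x \<in> chart_dom M b" for a b
    by (rule smooth_on_differentiable[where S = "chart_map M a ` (chart_dom M a \<inter> chart_dom M b)"])
       (use M that in \<open>auto simp: smooth_manifold_def\<close>)
  have t: "transition M i j (chart_map M i x) = chart_map M j x" by (rule transition_point[OF M ix(1) x(1)])
  have d2: "transition M j k differentiable (at (transition M i j (chart_map M i x)))"
    unfolding t by (rule d[OF ix(2,3) x(2,3)])
  have "dird (transition M i k) (chart_map M i x) u
      = dird (\<lambda>y. transition M j k (transition M i j y)) (chart_map M i x) u"
  proof (rule dird_cong_open[OF open_Int[OF o] xin d[OF ix(1,3) x(1,3)]])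
    fix y assume "y \<in> ?W \<inter> ?V"
    then obtain z z' where z: "y = chart_map M i z" "z \<in> chart_dom M i" "z \<in> chart_dom M j"
      and z': "y = chart_map M i z'" "z' \<in> chart_dom M i" "z' \<in> chart_dom M k" by blast
    have "z' = z" using inj_onD[OF inj _ z'(2) z(2)] z(1) z'(1) by simp
    then show "transition M i k y = transition M j k (transition M i j y)"
      unfolding z(1) transition_point[OF M ix(1) z(2)] using transition_point[OF M ix(2) z(3)] by simp
  qed
  also have "\<dots> = dird (transition M j k) (transition M i j (chart_map M i x)) (dird (transition M i j) (chart_map M i x) u)"
    by (rule dird_compose[OF d[OF ix(1,2) x(1,2)] d2])
  finally show ?thesis unfolding jacobian_def t .
qed

lemma jacobian_refl:
  assumes M: "smooth_manifold M" and i: "i \<in> chart_ix M" and x: "x \<in> chart_dom M i"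
  shows "jacobian M i i x u = u"
proof -
  have o: "open (chart_range M i)" by (rule chart_range_open[OF M i])
  have xin: "chart_map M i x \<in> chart_range M i" using x by (simp add: chart_range_def)
  have "dird (\<lambda>y. y) (chart_map M i x) u = dird (transition M i i) (chart_map M i x) u"
    by (rule dird_cong_open[OF o xin differentiable_ident]) (auto simp: chart_range_def transition_point[OF M i])
  then show ?thesis by (simp add: jacobian_def)
qed

text \<open>A covector is determined by its components in one chart; the cocycle property of the Jacobians makes the
  components in the other charts consistent.\<close>

lemma covector_exists:
  fixes M :: "('i, 'a, 'e::euclidean_space) atlas"
  assumes M: "smooth_manifold M" and i: "i \<in> chart_ix M" and x: "x \<in> chart_dom M i"
  shows "\<exists>P\<in>cotangent_space M x. P i = p"
proof -
  define P :: "'i \<Rightarrow> 'e" where "P k = (if k \<in> chart_ix M \<and> x \<in> chart_dom M k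
      then \<Sum>b\<in>Basis. (p \<bullet> jacobian M k i x b) *\<^sub>R b else 0)" for k
  have P: "P k \<bullet> u = p \<bullet> jacobian M k i x u" if k: "k \<in> chart_ix M" "x \<in> chart_dom M k" for k u
  proof -
    have "transition M k i differentiable (at (chart_map M k x))"
      by (rule smooth_on_differentiable[where S = "chart_map M k ` (chart_dom M k \<inter> chart_dom M i)"])
         (use M k i x in \<open>auto simp: smooth_manifold_def\<close>)
    then have "linear (jacobian M k i x)"
      unfolding jacobian_def by (rule linear_frechet_derivative)
    then have "linear (\<lambda>u. p \<bullet> jacobian M k i x u)"
      using linear_compose[OF _ bounded_linear.linear[OF bounded_linear_inner_right[of p]]] by (simp add: o_def)
    from linear_family_expand[of "\<lambda>_ u. p \<bullet> jacobian M k i x u", OF this, of u]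
    show ?thesis using k by (simp add: P_def inner_sum_left inner_sum_right inner_commute mult.commute)
  qed
  have "P \<in> cotangent_space M x"
    unfolding cotangent_space_def mem_Collect_eq
  proof (intro conjI ballI impI allI)
    fix k l u
    assume kl: "k \<in> chart_ix M" "l \<in> chart_ix M" "x \<in> chart_dom M k \<inter> chart_dom M l"
    then have x': "x \<in> chart_dom M k" "x \<in> chart_dom M l" by auto
    show "P k \<bullet> u = P l \<bullet> jacobian M k l x u"
      unfolding P[OF kl(1) x'(1)] P[OF kl(2) x'(2)]
        jacobian_cocycle[OF M kl(1,2) i x' x, of u] ..
  next
    fix k assume "k \<notin> chart_ix M \<or> x \<notin> chart_dom M k"
    then show "P k = 0" by (auto simp: P_def)
  qed
  moreover have "P i = p"
    by (rule vector_eq_rdot[THEN iffD1]) (simp add: P[OF i x] jacobian_refl[OF M i x])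
  ultimately show ?thesis by blast
qed

lemma covector_nonzero:
  fixes M :: "('i, 'a, 'e::euclidean_space) atlas"
  assumes P: "P \<in> cotangent_space M x" "P \<noteq> (\<lambda>_. 0)" and i: "i \<in> chart_ix M" "x \<in> chart_dom M i"
  shows "P i \<noteq> 0"
proof
  assume z: "P i = 0"
  have "P k = 0" for k
  proof (cases "k \<in> chart_ix M \<and> x \<in> chart_dom M k")
    case True
    then have "P k \<bullet> u = P i \<bullet> jacobian M k i x u" for u
      using P(1) i unfolding cotangent_space_def by blast
    then have "P k \<bullet> P k = 0" unfolding z by simp
    then show ?thesis by simp
  qed (use P(1) in \<open>auto simp: cotangent_space_def\<close>)
  then show False using P(2) by auto
qed

lemma cotangent0_domD:
  assumes "z \<in> chart_dom (cotangent0 M) i"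
  shows "fst z \<in> chart_dom M i" "snd z \<in> cotangent_space M (fst z)" "snd z \<noteq> (\<lambda>_. 0)"
    "chart_map (cotangent0 M) i z = (chart_map M i (fst z), snd z i)"
  using assms by (auto simp: cotangent0_def)

lemma cotangent0_range_subset:
  assumes i: "i \<in> chart_ix M"
  shows "chart_range (cotangent0 M) i \<subseteq> chart_range M i \<times> (- {0})"
proof
  fix y assume "y \<in> chart_range (cotangent0 M) i"
  then obtain z where z: "z \<in> chart_dom (cotangent0 M) i" "y = chart_map (cotangent0 M) i z"
    unfolding chart_range_def by blast
  note d = cotangent0_domD[OF z(1)]
  show "y \<in> chart_range M i \<times> (- {0})"
    using covector_nonzero[OF d(2,3) i d(1)] d(1) unfolding z(2) d(4) by (auto simp: chart_range_def)
qed

text \<open>The points of the chart domain over \<open>y\<close> are recovered from \<open>y\<close>, whence the transition map is known on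
  the whole open set and can be differentiated.\<close>

lemma cotangent0_transition:
  fixes M :: "('i, 'a, 'e::euclidean_space) atlas"
  assumes M: "smooth_manifold M" and ix: "i \<in> chart_ix M" "j \<in> chart_ix M"
    and y: "y \<in> chart_map M i ` (chart_dom M i \<inter> chart_dom M j) \<times> (- {0})"
  shows "fst (transition (cotangent0 M) i j y) = transition M i j (fst y)"
    "snd (transition (cotangent0 M) i j y) \<bullet> dird (transition M i j) (fst y) h = snd y \<bullet> h"
proof -
  obtain x where x: "fst y = chart_map M i x" "x \<in> chart_dom M i" "x \<in> chart_dom M j" using y unfolding mem_Times_iff by blast
  have y0: "snd y \<noteq> 0" using y unfolding mem_Times_iff by blast
  obtain P where P: "P \<in> cotangent_space M x" "P i = snd y"
    using covector_exists[OF M ix(1) x(2)] by blast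
  have "P \<noteq> (\<lambda>_. 0)" using P(2) y0 by auto
  then have "(x, P) \<in> chart_dom (cotangent0 M) i" using x P by (simp add: cotangent0_def)
  moreover have "chart_map (cotangent0 M) i (x, P) = y" using x P by (simp add: cotangent0_def prod_eq_iff)
  ultimately have im: "y \<in> chart_map (cotangent0 M) i ` chart_dom (cotangent0 M) i" by blast
  define z where "z = inv_into (chart_dom (cotangent0 M) i) (chart_map (cotangent0 M) i) y"
  have z: "z \<in> chart_dom (cotangent0 M) i" "chart_map (cotangent0 M) i z = y"
    unfolding z_def using inv_into_into[OF im] f_inv_into_f[OF im] by auto
  note d = cotangent0_domD[OF z(1)]
  have "inj_on (chart_map M i) (chart_dom M i)" using M ix unfolding smooth_manifold_def by blast
  then have zx: "fst z = x" using inj_onD[of _ _ "fst z" x] d(1,4) z(2) x by auto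
  have zi: "snd z i = snd y" using d(4) z(2) by auto
  have tr: "transition (cotangent0 M) i j y = (chart_map M j x, snd z j)"
  proof -
    have "transition (cotangent0 M) i j y = chart_map (cotangent0 M) j z" by (simp add: transition_def z_def)
    also have "\<dots> = (chart_map M j (fst z), snd z j)" by (simp add: cotangent0_def split_beta)
    finally show ?thesis unfolding zx .
  qed
  then show "fst (transition (cotangent0 M) i j y) = transition M i j (fst y)"
    using transition_point[OF M ix(1) x(2)] x(1) by simp
  have "snd z j \<bullet> w = snd z i \<bullet> jacobian M j i x w" for w
    using d(2) ix x(2,3) unfolding cotangent_space_def zx by blast
  then have "snd z j \<bullet> jacobian M i j x h = snd z i \<bullet> jacobian M j i x (jacobian M i j x h)" by blast
  also have "\<dots> = snd y \<bullet> h"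
    using jacobian_cocycle[OF M ix(1,2,1) x(2,3,2), of h] jacobian_refl[OF M ix(1) x(2)] zi by simp
  finally show "snd (transition (cotangent0 M) i j y) \<bullet> dird (transition M i j) (fst y) h = snd y \<bullet> h"
    unfolding tr by (simp add: jacobian_def x(1))
qed

lemma vec_chart_of_metric:
  fixes M :: "('i, 'a, real^'n::finite) atlas"
  assumes M: "smooth_manifold M" and g: "riemannian_metric M g" and i: "i \<in> chart_ix M"
  shows "vec_chart (chart_range M i) (g i)"
  unfolding vec_chart_def
  by (rule riemannian_chart.intro[OF chart_range_open[OF M i]])
     (use g i in \<open>auto simp: riemannian_metric_def\<close>)

lemma chart_change_of_atlas:
  fixes M :: "('i, 'a, real^'n::finite) atlas"
  assumes M: "smooth_manifold M" and g: "riemannian_metric M g" and ix: "i \<in> chart_ix M" "j \<in> chart_ix M"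
  shows "chart_change (chart_range M i) (g i) (chart_range M j) (g j)
    (chart_map M i ` (chart_dom M i \<inter> chart_dom M j)) (transition M i j) (transition (cotangent0 M) i j)"
proof (rule chart_change.intro[OF vec_chart_of_metric[OF M g ix(1)] vec_chart_of_metric[OF M g ix(2)]],
    rule chart_change_axioms.intro)
  let ?W = "chart_map M i ` (chart_dom M i \<inter> chart_dom M j)"
  show "open ?W" "smooth_on ?W (transition M i j)" using M ix unfolding smooth_manifold_def by blast+
  show "?W \<subseteq> chart_range M i" by (auto simp: chart_range_def)
  show "transition M i j ` ?W \<subseteq> chart_range M j"
    using transition_point[OF M ix(1)] by (auto simp: chart_range_def)
  show "g i q u v = g j (transition M i j q) (dird (transition M i j) q u) (dird (transition M i j) q v)"
    if q: "q \<in> ?W" for q u v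
  proof -
    obtain x where x: "q = chart_map M i x" "x \<in> chart_dom M i" "x \<in> chart_dom M j" using q by auto
    have "g i (chart_map M i x) u v = g j (chart_map M j x) (jacobian M i j x u) (jacobian M i j x v)"
      using g ix x(2,3) unfolding riemannian_metric_def by blast
    then show ?thesis unfolding jacobian_def x(1) transition_point[OF M ix(1) x(2)] .
  qed
  show "fst (transition (cotangent0 M) i j y) = transition M i j (fst y)"
    "snd (transition (cotangent0 M) i j y) \<bullet> dird (transition M i j) (fst y) h = snd y \<bullet> h"
    if "y \<in> ?W \<times> (- {0})" for y h
    by (rule cotangent0_transition[OF M ix that])+
qed

section \<open>The locally symmetric Kaehler Einstein structure\<close>

theorem theorem9:
  fixes M :: "('i, 'a, real^'n::finite) atlas"
    and g :: "('i, real^'n) form2"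
    and c A :: real
    and lam :: "real \<Rightarrow> real"
  assumes "CARD('n) > 1"
    and "smooth_manifold M"
    and "riemannian_metric M g"
    and "constant_sectional_curvature M g c"
    and "c > 0"
    and "A > 0"
    and "smooth_on {0<..} lam"
    and "\<And>t. t > 0 \<Longrightarrow> lam t > 0"
    and "\<And>t. t > 0 \<Longrightarrow> 2 * c - A\<^sup>2 * t * (lam t)\<^sup>2 > 0"
    and "\<And>t. t > 0 \<Longrightarrow> lam t + 2 * t * deriv lam t > 0"
  shows "kaehler_structure (cotangent0 M) (G_diag A c lam g) (J_diag A c lam g)
       \<and> locally_symmetric (cotangent0 M) (G_diag A c lam g)
       \<and> einstein (cotangent0 M) (G_diag A c lam g)"
proof -
  note M = assms(2) and g = assms(3)
  let ?M = "cotangent0 M" and ?G = "G_diag A c lam g" and ?J = "J_diag A c lam g"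
  let ?k = "DIM(real^'n) / (2 / A)"
  have over_chart: "cotangent_structure (chart_range M i) (g i) A c lam (?G i) (?J i)"
    if i: "i \<in> chart_ix M" for i
  proof -
    interpret vec_chart "chart_range M i" "g i" by (rule vec_chart_of_metric[OF M g i])
    have "Rm q u v w = c *\<^sub>R (g i q v w *\<^sub>R u - g i q u w *\<^sub>R v)" if q: "q \<in> chart_range M i" for q u v w
      by (rule constant_curvature_tensor[OF q assms(5)])
         (use assms(4) i q in \<open>simp add: constant_sectional_curvature_def\<close>)
    then have cq: "cotangent_quadric (chart_range M i) (g i) A c lam"
      by (intro cotangent_quadric.intro[OF riemannian_chart_axioms] cotangent_quadric_axioms.intro)
         (use assms in auto)
    show ?thesis
      by (rule cotangent_structure.intro[OF cq], rule cotangent_structure_axioms.intro;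
          rule G_diag_eq[of _ g, OF _ refl] J_diag_fst[of _ g, OF _ refl] J_diag_snd[of _ g, OF _ refl]; assumption)
  qed
  have chart: "bilinear (?G i y)" "?G i y u v = ?G i y v u" "u \<noteq> 0 \<Longrightarrow> ?G i y u u > 0"
      "linear (?J i y)" "?J i y (?J i y u) = - u" "nijenhuis (?J i) y u v = 0"
      "?G i y (?J i y u) (?J i y v) = ?G i y u v"
      "ext_deriv (\<lambda>x a b. ?G i x a (?J i x b)) y u v w = 0"
      "nabla_curvature (?G i) y z u v w = 0"
      "ricci (?G i) y v w = ?k * ?G i y v w"
    if i: "i \<in> chart_ix ?M" and y: "y \<in> chart_range ?M i" for i y u v w z
  proof -
    have i': "i \<in> chart_ix M" using i by (simp add: cotangent0_ix)
    interpret cotangent_structure "chart_range M i" "g i" A c lam "?G i" "?J i" by (rule over_chart[OF i'])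
    have y: "y \<in> T0" using y cotangent0_range_subset[OF i'] by blast
    note st = Q.quadric_structure
    show "bilinear (?G i y)" by (rule st(1)[OF y])
    show "?G i y u v = ?G i y v u" by (rule st(2)[OF y])
    show "u \<noteq> 0 \<Longrightarrow> ?G i y u u > 0" by (rule st(3)[OF y])
    show "linear (?J i y)" by (rule st(5)[OF y])
    show "?J i y (?J i y u) = - u" by (rule st(7)[OF y])
    show "nijenhuis (?J i) y u v = 0" by (rule st(8)[OF y])
    show "?G i y (?J i y u) (?J i y v) = ?G i y u v" by (rule st(9)[OF y])
    show "ext_deriv (\<lambda>x a b. ?G i x a (?J i x b)) y u v w = 0" by (rule st(10)[OF y])
    show "nabla_curvature (?G i) y z u v w = 0" by (rule st(11)[OF y])
    show "ricci (?G i) y v w = ?k * ?G i y v w" by (rule st(12)[OF y])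
  qed
  have smooth: "smooth_on (chart_range ?M i) (\<lambda>y. ?G i y u v)" "smooth_on (chart_range ?M i) (\<lambda>y. ?J i y u)"
    if i: "i \<in> chart_ix ?M" for i u v
  proof -
    have i': "i \<in> chart_ix M" using i by (simp add: cotangent0_ix)
    interpret cotangent_structure "chart_range M i" "g i" A c lam "?G i" "?J i" by (rule over_chart[OF i'])
    note sub = cotangent0_range_subset[OF i']
    show "smooth_on (chart_range ?M i) (\<lambda>y. ?G i y u v)" by (rule smooth_on_subset[OF Q.quadric_structure(4) sub])
    show "smooth_on (chart_range ?M i) (\<lambda>y. ?J i y u)" by (rule smooth_on_subset[OF Q.quadric_structure(6) sub])
  qed
  have change: "?G i (chart_map ?M i x) u v = ?G j (chart_map ?M j x) (jacobian ?M i j x u) (jacobian ?M i j x v)"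
      "jacobian ?M i j x (?J i (chart_map ?M i x) u) = ?J j (chart_map ?M j x) (jacobian ?M i j x u)"
    if ix: "i \<in> chart_ix ?M" "j \<in> chart_ix ?M" and x: "x \<in> chart_dom ?M i" "x \<in> chart_dom ?M j" for i j x u v
  proof -
    have ix': "i \<in> chart_ix M" "j \<in> chart_ix M" using ix by (simp_all add: cotangent0_ix)
    note di = cotangent0_domD[OF x(1)] and dj = cotangent0_domD[OF x(2)]
    interpret chart_change "chart_range M i" "g i" "chart_range M j" "g j"
      "chart_map M i ` (chart_dom M i \<inter> chart_dom M j)" "transition M i j" "transition ?M i j"
      by (rule chart_change_of_atlas[OF M g ix'])
    let ?y = "chart_map ?M i x"
    have y: "?y \<in> W0"
      using covector_nonzero[OF di(2,3) ix'(1) di(1)] di(1) dj(1) unfolding di(4) by auto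
    have "snd (transition ?M i j ?y) \<bullet> w = snd x j \<bullet> w" for w
    proof -
      have "fst ?y \<in> chart_map M i ` (chart_dom M i \<inter> chart_dom M j)" using y unfolding mem_Times_iff by (rule conjunct1)
      then obtain h where h: "w = dird (transition M i j) (fst ?y) h" using d\<phi>(3) by blast
      have h': "w = jacobian M i j (fst x) h" unfolding h jacobian_def di(4) by simp
      have "snd x i \<bullet> h = snd x j \<bullet> jacobian M i j (fst x) h"
        using di(2) ix' di(1) dj(1) unfolding cotangent_space_def by blast
      then have "snd x j \<bullet> w = snd ?y \<bullet> h" unfolding h' di(4) by simp
      also have "\<dots> = snd (transition ?M i j ?y) \<bullet> w" unfolding h by (rule \<Phi>_snd[OF y, symmetric])
      finally show ?thesis by (rule sym)
    qed
    then have "\<forall>w. snd (transition ?M i j ?y) \<bullet> w = snd x j \<bullet> w" by (rule allI)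
    then have "snd (transition ?M i j ?y) = snd x j" by (rule vector_eq_rdot[THEN iffD1])
    moreover have "fst (transition ?M i j ?y) = chart_map M j (fst x)"
      using \<Phi>_fst[OF y] transition_point[OF M ix'(1) di(1)] unfolding di(4) by simp
    ultimately have tr: "transition ?M i j ?y = chart_map ?M j x" unfolding dj(4) by (simp add: prod_eq_iff)
    show "?G i ?y u v = ?G j (chart_map ?M j x) (jacobian ?M i j x u) (jacobian ?M i j x v)"
      using G_diag_invariant[of ?y g i j, OF y refl refl] unfolding tr jacobian_def .
    show "jacobian ?M i j x (?J i ?y u) = ?J j (chart_map ?M j x) (jacobian ?M i j x u)"
      using J_diag_equivariant[of ?y g i j, OF y refl refl] unfolding tr jacobian_def .
  qed
  have metric: "riemannian_metric ?M ?G"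
    unfolding riemannian_metric_def
    by (intro conjI ballI allI impI)
       (rule chart(1); assumption | rule chart(2); assumption | rule chart(3); assumption
         | rule smooth(1); assumption | (erule IntE, rule change(1); assumption))+
  have complex: "complex_structure ?M ?J"
    unfolding complex_structure_def endo_field_def
    by (intro conjI ballI allI)
       (rule chart(4); assumption | rule chart(5); assumption | rule chart(6); assumption
         | rule smooth(2); assumption | (erule IntE, rule change(2); assumption))+
  have "kaehler_structure ?M ?G ?J"
    unfolding kaehler_structure_def
    by (intro conjI ballI allI)
       (rule metric | rule complex | rule chart(7); assumption | rule chart(8); assumption)+
  moreover have "locally_symmetric ?M ?G"
    unfolding locally_symmetric_def by (intro ballI allI) (rule chart(9))
  moreover have "einstein ?M ?G"
    unfolding einstein_def by (intro exI[of _ ?k] ballI allI) (rule chart(10))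
  ultimately show ?thesis by blast
qed

end
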